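(* Let $1/2<H<1$ and $\gamma\in(0,2H)$. Let $G=\{G_t\}_{t\ge0}$ be (a continuous version of) the centered Gaussian process with covariance $$\mathbb{E}(G_tG_s)=\mathbb{E}\left[\left(\int_0^tZ_{t-r}\,dB^H_r\right)\left(\int_0^sZ_{s-r}\,dB^H_r\right)\right],\qquad s,t\ge0,$$ where $B^H$ is a fractional Brownian motion with Hurst parameter $H$ and $Z=\{Z_t,t>0\}$ is a centered Gaussian process, independent of $B^H$, with covariance $\mathbb{E}(Z_tZ_s)=(t+s)^{-\gamma}$. Then, almost surely, the path $t\mapsto G_t$ restricted to $I=(0,1)$ belongs to the Besov-Orlicz space $\mathcal{B}^{H-\gamma/2}_{\Phi_2,\infty}(I)$.
   Context: For $H\in(1/2,1)$ the covariance of $G$ is explicitly $$\mathbb{E}(G_tG_s)=H(2H-1)\int_0^t\int_0^s|u-v|^{2H-2}(t+s-u-v)^{-\gamma}\,dv\,du .$$ Besov-Orlicz space: let $I=(0,1)$ and, for $h\in\mathbb{R}$, $I(h)=\{s\in I: s+h\in I\}$. For an interval $J\subseteq I$ and a measurable $f:J\to\mathbb{R}$ put $\|f\|_{L^{\Phi_2}(J)}=\sup_{p\ge 1}p^{-1/2}\|f\|_{L^p(J)}$, the supremum being over real $p\ge1$ (this is the exponential Orlicz norm associated with $\Phi_2(x)=e^{x^2}-1$). For $\alpha\in(0,1)$, $\mathcal{B}^{\alpha}_{\Phi_2,\infty}(I)$ is the space of measurable $f$ on $I$ with $\|f\|_{L^{\Phi_2}(I)}<\infty$ and $$\sup_{0<t\le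 1}t^{-\alpha}\sup_{|h|\le t}\|f(\cdot+h)-f(\cdot)\|_{L^{\Phi_2}(I(h))}<\infty .$$ This last seminorm is equivalent to $\sup_{n\ge 1}2^{n\alpha}\|f(\cdot+2^{-n})-f(\cdot)\|_{L^{\Phi_2}(I(2^{-n}))}$, and the norm used on the space is $\|f\|_{L^{\Phi_2}(I)}+\sup_{n\ge1}2^{n\alpha}\|f(\cdot+2^{-n})-f(\cdot)\|_{L^{\Phi_2}(I(2^{-n}))}$. *)

theory Defs
  imports "HOL-Probability.Probability"
begin

subsection \<open>Gaussian processes\<close>

text \<open>Almost surely constant random variables count as (degenerate) Gaussian.\<close>

definition gaussian_rv :: "'a measure \<Rightarrow> ('a \<Rightarrow> real) \<Rightarrow> bool" where
  "gaussian_rv M X \<longleftrightarrow> X \<in> borel_measurable M \<and>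
     ((\<exists>m. AE \<omega> in M. X \<omega> = m) \<or>
      (\<exists>m s. s > 0 \<and> distributed M lborel X (\<lambda>x. ennreal (normal_density m s x))))"

definition centered_gaussian_process ::
    "'a measure \<Rightarrow> real set \<Rightarrow> (real \<Rightarrow> 'a \<Rightarrow> real) \<Rightarrow> bool" where
  "centered_gaussian_process M T X \<longleftrightarrow>
     (\<forall>F c. finite F \<and> F \<subseteq> T \<longrightarrow> gaussian_rv M (\<lambda>\<omega>. \<Sum>t\<in>F. c t * X t \<omega>)) \<and>
     (\<forall>t\<in>T. (LINT \<omega>|M. X t \<omega>) = 0)"

definition fractional_brownian_motion ::
    "'a measure \<Rightarrow> real \<Rightarrow> (real \<Rightarrow> 'a \<Rightarrow> real) \<Rightarrow> bool" where
  "fractional_brownian_motion M H B \<longleftrightarrow> centered_gaussian_process M {0..} B \<and>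
     (\<forall>s\<ge>0. \<forall>t\<ge>0. (LINT \<omega>|M. B t \<omega> * B s \<omega>) =
        (t powr (2 * H) + s powr (2 * H) - \<bar>t - s\<bar> powr (2 * H)) / 2)"

text \<open>The path of a process, as a random element of the product space over \<open>T\<close>.\<close>

definition path_on :: "real set \<Rightarrow> (real \<Rightarrow> 'a \<Rightarrow> real) \<Rightarrow> 'a \<Rightarrow> real \<Rightarrow> real" where
  "path_on T X \<omega> = (\<lambda>t\<in>T. X t \<omega>)"

abbreviation path_space :: "real set \<Rightarrow> (real \<Rightarrow> real) measure" where
  "path_space T \<equiv> PiM T (\<lambda>_. borel)"

definition independent_processes :: "'a measure \<Rightarrow> real set \<Rightarrow> (real \<Rightarrow> 'a \<Rightarrow> real) \<Rightarrow>
    real set \<Rightarrow> (real \<Rightarrow> 'a \<Rightarrow> real) \<Rightarrow> bool" where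
  "independent_processes M S X T Y \<longleftrightarrow>
     prob_space.indep_var M (path_space S) (path_on S X) (path_space T) (path_on T Y)"

subsection \<open>Wiener integral with respect to fractional Brownian motion\<close>

text \<open>
  For \<open>H > 1/2\<close> and a random element \<open>Y\<close> of \<open>E\<close> that is independent of \<open>B\<close>, the integral over
  \<open>(0, t)\<close> of an integrand depending on \<open>Y\<close> only is defined by \<open>L\<^sup>2\<close>-extension from step processes.
  A step process is coded as a list of triples \<open>(a, b, g)\<close>, each of which stands for the summand
  \<open>g (Y \<omega>)\<close> times the indicator function of \<open>(a, b]\<close>.
\<close>

type_synonym 'c step_process = "(real \<times> real \<times> ('c \<Rightarrow> real)) list"

definition step_processes ::
    "'b measure \<Rightarrow> 'c measure \<Rightarrow> ('b \<Rightarrow> 'c) \<Rightarrow> real \<Rightarrow> 'c step_process set" where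
  "step_processes N E Y t =
     {S. \<forall>(a, b, g) \<in> set S. 0 \<le> a \<and> a \<le> b \<and> b \<le> t \<and> g \<in> borel_measurable E \<and>
           integrable N (\<lambda>\<omega>. (g (Y \<omega>))\<^sup>2)}"

definition step_value :: "('b \<Rightarrow> 'c) \<Rightarrow> 'c step_process \<Rightarrow> real \<Rightarrow> 'b \<Rightarrow> real" where
  "step_value Y S r \<omega> = (\<Sum>(a, b, g) \<leftarrow> S. g (Y \<omega>) * indicator {a<..b} r)"

definition step_integral ::
    "(real \<Rightarrow> 'b \<Rightarrow> real) \<Rightarrow> ('b \<Rightarrow> 'c) \<Rightarrow> 'c step_process \<Rightarrow> 'b \<Rightarrow> real" where
  "step_integral B Y S \<omega> = (\<Sum>(a, b, g) \<leftarrow> S. g (Y \<omega>) * (B b \<omega> - B a \<omega>))"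

text \<open>
  The square of the norm of \<open>L\<^sup>2(\<Omega>; |\<H>|)\<close>, where \<open>|\<H>|\<close> is the usual space of functions \<open>f\<close>
  for which \<open>H (2 H - 1)\<close> times the double integral of \<open>|f u| |f v| |u - v| powr (2 H - 2)\<close> is
  finite. For step processes independent of \<open>B\<close> the second moment of the integral is given by the
  same expression without absolute values, so the \<open>L\<^sup>2\<close> limit below is unique almost surely. The
  expectation is taken innermost, so no joint measurability of the process \<open>D\<close> is needed.
\<close>

definition fbm_sqnorm :: "'b measure \<Rightarrow> real \<Rightarrow> real \<Rightarrow> (real \<Rightarrow> 'b \<Rightarrow> real) \<Rightarrow> ennreal" where
  "fbm_sqnorm N H t D =
     ennreal (H * (2 * H - 1)) *
     (\<integral>\<^sup>+u\<in>{0<..<t}. (\<integral>\<^sup>+v\<in>{0<..<t}.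
        ennreal (\<bar>u - v\<bar> powr (2 * H - 2)) * (\<integral>\<^sup>+\<omega>. ennreal \<bar>D u \<omega> * D v \<omega>\<bar> \<partial>N) \<partial>lborel) \<partial>lborel)"

definition has_fbm_integral :: "'b measure \<Rightarrow> real \<Rightarrow> (real \<Rightarrow> 'b \<Rightarrow> real) \<Rightarrow>
    'c measure \<Rightarrow> ('b \<Rightarrow> 'c) \<Rightarrow> real \<Rightarrow> (real \<Rightarrow> 'b \<Rightarrow> real) \<Rightarrow> ('b \<Rightarrow> real) \<Rightarrow> bool" where
  "has_fbm_integral N H B E Y t F X \<longleftrightarrow> X \<in> borel_measurable N \<and>
     (\<exists>S :: nat \<Rightarrow> 'c step_process.
        (\<forall>n. S n \<in> step_processes N E Y t) \<and>
        (\<lambda>n. fbm_sqnorm N H t (\<lambda>r \<omega>. step_value Y (S n) r \<omega> - F r \<omega>)) \<longlonglongrightarrow> 0 \<and>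
        (\<lambda>n. \<integral>\<^sup>+\<omega>. ennreal ((step_integral B Y (S n) \<omega> - X \<omega>)\<^sup>2) \<partial>N) \<longlonglongrightarrow> 0)"

subsection \<open>Besov-Orlicz spaces\<close>

definition Lp_norm :: "real \<Rightarrow> real set \<Rightarrow> (real \<Rightarrow> real) \<Rightarrow> ennreal" where
  "Lp_norm p J f =
     (let A = (\<integral>\<^sup>+x. ennreal (\<bar>f x\<bar> powr p) \<partial>lebesgue_on J)
      in if A = \<infinity> then \<infinity> else ennreal (enn2real A powr (1 / p)))"

definition orlicz_norm :: "real set \<Rightarrow> (real \<Rightarrow> real) \<Rightarrow> ennreal" where
  "orlicz_norm J f = (SUP p\<in>{1..}. ennreal (p powr (- 1 / 2)) * Lp_norm p J f)"

definition shift_dom :: "real set \<Rightarrow> real \<Rightarrow> real set" where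
  "shift_dom I h = {s \<in> I. s + h \<in> I}"

definition besov_orlicz_seminorm :: "real \<Rightarrow> real set \<Rightarrow> (real \<Rightarrow> real) \<Rightarrow> ennreal" where
  "besov_orlicz_seminorm \<alpha> I f =
     (SUP t\<in>{0<..1}. ennreal (t powr (- \<alpha>)) *
        (SUP h\<in>{h. \<bar>h\<bar> \<le> t}. orlicz_norm (shift_dom I h) (\<lambda>s. f (s + h) - f s)))"

text \<open>
  Elements are represented by functions on all of \<open>\<real>\<close>; only their values on \<open>I\<close> matter.
\<close>

definition besov_orlicz_space :: "real \<Rightarrow> real set \<Rightarrow> (real \<Rightarrow> real) set" where
  "besov_orlicz_space \<alpha> I =
     {f. f \<in> borel_measurable (lebesgue_on I) \<and> orlicz_norm I f < \<infinity> \<and>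
         besov_orlicz_seminorm \<alpha> I f < \<infinity>}"

end

theory Submission
  imports Defs
begin

text \<open>
  Write \<open>\<alpha> = H - \<gamma> / 2\<close>, \<open>c = H (2 H - 1)\<close>, and let \<open>D\<^sub>h(t) = G\<^sub>t\<^sub>+\<^sub>h - G\<^sub>t\<close>. A Gaussian process is
  determined by its covariance, and the proof uses only two estimates for the increments:
  the variance of \<open>D\<^sub>h(t)\<close> is at most \<open>C h powr (2 \<alpha>)\<close>, uniformly in \<open>t\<close>, and the integral of
  \<open>\<bar>Cov (D\<^sub>h(s), D\<^sub>h(t))\<bar>\<close> over the unit square is at most \<open>C h powr (2 - \<gamma>)\<close>. Relative to the
  variance bound, the second quantity is of order \<open>h powr (2 - 2 H)\<close>: increments at different
  places are nearly uncorrelated. Both follow from the formula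
  \<open>Cov (G\<^sub>t, G\<^sub>s) = c \<integral>\<integral> \<bar>u - v\<bar> powr (2 H - 2) (t + s - u - v) powr (- \<gamma>) dv du\<close>, the integral
  being over \<open>0 < u < t\<close> and \<open>0 < v < s\<close>.

  The variance bound alone would lose a logarithm, since it controls the norms of \<open>D\<^sub>h\<close> for
  each single \<open>h = 2\<^sup>-\<^sup>n\<close> but not for all of them at once. The decorrelation removes the loss.
  Let \<open>X\<^sub>n(s) = D\<^sub>h(s) / (L h powr \<alpha>)\<close>, with \<open>L\<close> so large that the variances are at most 1, and
  \<open>\<Phi>\<^sub>n = \<integral> exp (X\<^sub>n(s)\<^sup>2 / 8) ds\<close>. For a Gaussian pair with variances at most 1 and covariance
  \<open>\<rho>\<close>, the exponentials \<open>exp (X\<^sup>2 / 8)\<close> and \<open>exp (Y\<^sup>2 / 8)\<close> have covariance at most \<open>2 \<bar>\<rho>\<bar>\<close>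
  (\<open>gaussian_pair_exp_square\<close>). Hence \<open>\<Phi>\<^sub>n\<close> has bounded mean and a variance of order
  \<open>2 powr (- n (2 - 2 H))\<close>, which is summable because \<open>H < 1\<close>. By Chebyshev's idea in the form
  of \<open>AE_bounded_of_summable_variance\<close>, almost surely \<open>\<Phi>\<^sub>n\<close> is bounded in \<open>n\<close>.

  The rest is deterministic. A bound on \<open>\<integral> exp (f\<^sup>2 / 8)\<close> controls all \<open>L\<^sup>p\<close> norms of \<open>f\<close> with the
  right growth in \<open>p\<close> (\<open>orlicz_norm_le_of_exp_square\<close>). An arbitrary shift is a sum of dyadic
  shifts given by its binary expansion, and convexity of \<open>x \<mapsto> exp (x\<^sup>2 / 8)\<close> transfers the
  exponential bound to it (\<open>exp_square_increment_all_shifts\<close>).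

  It remains to obtain the covariance formula from the definition of the integral by
  approximation (\<open>fbm_integral_covariance\<close>). For step processes independence gives the
  formula directly. The limit is justified by a Cauchy-Schwarz inequality for the bilinear form
  with kernel \<open>\<bar>u - v\<bar> powr (2 H - 2)\<close>. This kernel is positive definite, being up to a constant the
  convolution square of a one-sided power (\<open>riesz_factor_convolution\<close>). Here a jointly
  measurable version of \<open>Z\<close> is needed to interchange integrals.
\<close>

section \<open>Integrals of powers and of the kernel \<open>\<bar>u - v\<bar> powr q\<close>\<close>

text \<open>The fundamental theorem of calculus for an antiderivative that fails to be differentiable at
  finitely many points. Kernels such as \<open>\<bar>u - v\<bar> powr q\<close> are singular on the diagonal, which is
  inside the interval of integration.\<close>
lemma
  fixes f F :: "real \<Rightarrow> real"
  assumes f[measurable]: "f \<in> borel_measurable borel" and nonneg: "\<And>x. 0 \<le> f x"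
    and "finite S" "a \<le> b" "continuous_on {a..b} F"
    and der: "\<And>x. x \<in> {a<..<b} - S \<Longrightarrow> (F has_real_derivative f x) (at x)"
  shows nn_integral_FTC_exceptional: "(\<integral>\<^sup>+x. ennreal (f x) * indicator {a..b} x \<partial>lborel) = ennreal (F b - F a)"
    and FTC_exceptional_nonneg: "0 \<le> F b - F a"
proof -
  have "(f has_integral (F b - F a)) {a..b}"
    using assms by (intro fundamental_theorem_of_calculus_interior_strong[of S])
      (auto simp: has_real_derivative_iff_has_vector_derivative)
  then show "0 \<le> F b - F a" by (rule has_integral_nonneg) (use nonneg in auto)
  from \<open>(f has_integral (F b - F a)) {a..b}\<close> have "((\<lambda>x. indicator {a..b} x *\<^sub>R f x) has_integral (F b - F a)) UNIV"
    by (subst (asm) has_integral_restrict_UNIV[symmetric])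
      (erule back_subst[of "\<lambda>f. (f has_integral _) UNIV"], auto simp: indicator_def)
  from nn_integral_has_integral_lborel[OF _ _ this]
  have "(\<integral>\<^sup>+x. ennreal (indicator {a..b} x *\<^sub>R f x) \<partial>lborel) = ennreal (F b - F a)"
    using nonneg by auto
  also have "(\<integral>\<^sup>+x. ennreal (indicator {a..b} x *\<^sub>R f x) \<partial>lborel) =
      (\<integral>\<^sup>+x. ennreal (f x) * indicator {a..b} x \<partial>lborel)"
    by (intro nn_integral_cong) (auto simp: indicator_def)
  finally show "(\<integral>\<^sup>+x. ennreal (f x) * indicator {a..b} x \<partial>lborel) = ennreal (F b - F a)" .
qed

lemma nn_integral_powr_near_0:
  assumes "q > -1" "h \<ge> 0"
  shows "(\<integral>\<^sup>+x. ennreal (x powr q) * indicator {0..h} x \<partial>lborel) = ennreal (h powr (q + 1) / (q + 1))"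
proof -
  have "(\<integral>\<^sup>+x. ennreal (x powr q) * indicator {0..h} x \<partial>lborel) =
     ennreal (h powr (q + 1) / (q + 1) - 0 powr (q + 1) / (q + 1))"
    using assms
    by (intro nn_integral_FTC_exceptional[of _ "{}"])
       (auto intro!: continuous_intros continuous_on_powr' derivative_eq_intros)
  then show ?thesis using assms by simp
qed

lemma nn_integral_powr_at_top:
  assumes "q < -1" "h > 0"
  shows "(\<integral>\<^sup>+x. ennreal (x powr q) * indicator {h..} x \<partial>lborel) = ennreal (h powr (q + 1) / (- q - 1))"
proof -
  have "((\<lambda>x::real. x powr (q + 1)) \<longlongrightarrow> 0) at_top"
    using assms by (intro tendsto_neg_powr filterlim_ident) auto
  then have "((\<lambda>x::real. x powr (q + 1) / (q + 1)) \<longlongrightarrow> 0 / (q + 1)) at_top"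
    using assms by (intro tendsto_divide tendsto_const) auto
  then have "(\<integral>\<^sup>+x. ennreal (x powr q) * indicator {h..} x \<partial>lborel) = ennreal (0 - h powr (q + 1) / (q + 1))"
    using assms
    by (intro nn_integral_FTC_atLeast[where F="\<lambda>x. x powr (q + 1) / (q + 1)"])
       (auto intro!: derivative_eq_intros)
  also have "0 - h powr (q + 1) / (q + 1) = h powr (q + 1) / (- q - 1)"
    using assms by (simp add: field_simps)
  finally show ?thesis .
qed

lemma nn_integral_reflect:
  fixes f :: "real \<Rightarrow> ennreal" assumes "f \<in> borel_measurable borel"
  shows "(\<integral>\<^sup>+x. f x \<partial>lborel) = (\<integral>\<^sup>+x. f (t - x) \<partial>lborel)"
  using nn_integral_real_affine[OF assms, of "-1" t] by simp

lemma nn_integral_riesz_below: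
  assumes "q > -1" "u \<ge> 0"
  shows "(\<integral>\<^sup>+v. ennreal (\<bar>u - v\<bar> powr q) * indicator {0..u} v \<partial>lborel) = ennreal (u powr (q + 1) / (q + 1))"
proof -
  have "(\<integral>\<^sup>+v. ennreal (\<bar>u - v\<bar> powr q) * indicator {0..u} v \<partial>lborel) =
     (\<integral>\<^sup>+v. ennreal (\<bar>u - (u - v)\<bar> powr q) * indicator {0..u} (u - v) \<partial>lborel)"
    by (rule nn_integral_reflect) measurable
  also have "\<dots> = (\<integral>\<^sup>+v. ennreal (v powr q) * indicator {0..u} v \<partial>lborel)"
    by (intro nn_integral_cong) (auto simp: indicator_def)
  finally show ?thesis using nn_integral_powr_near_0[OF assms] by simp
qed

lemma nn_integral_riesz_unit:
  assumes "q > -1" "0 \<le> u" "u \<le> 1"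
  shows "(\<integral>\<^sup>+v. ennreal (\<bar>u - v\<bar> powr q) * indicator {0..1} v \<partial>lborel) \<le> ennreal (2 / (q + 1))"
proof -
  have "(\<integral>\<^sup>+v. ennreal (\<bar>u - v\<bar> powr q) * indicator {0..1} v \<partial>lborel) \<le>
    (\<integral>\<^sup>+v. ennreal (\<bar>u - v\<bar> powr q) * indicator {0..u} v
        + ennreal (\<bar>u - v\<bar> powr q) * indicator {u..1} v \<partial>lborel)"
    by (intro nn_integral_mono) (auto simp: indicator_def)
  also have "\<dots> = (\<integral>\<^sup>+v. ennreal (\<bar>u - v\<bar> powr q) * indicator {0..u} v \<partial>lborel) +
     (\<integral>\<^sup>+v. ennreal (\<bar>u - v\<bar> powr q) * indicator {u..1} v \<partial>lborel)"
    by (rule nn_integral_add) measurable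
  also have "(\<integral>\<^sup>+v. ennreal (\<bar>u - v\<bar> powr q) * indicator {u..1} v \<partial>lborel) =
     (\<integral>\<^sup>+v. ennreal (\<bar>u - (u + 1 * v)\<bar> powr q) * indicator {u..1} (u + 1 * v) \<partial>lborel)"
    by (subst nn_integral_real_affine[of _ 1 u]) auto
  also have "\<dots> = (\<integral>\<^sup>+v. ennreal (v powr q) * indicator {0..1-u} v \<partial>lborel)"
    by (intro nn_integral_cong) (auto simp: indicator_def)
  also have "(\<integral>\<^sup>+v. ennreal (\<bar>u - v\<bar> powr q) * indicator {0..u} v \<partial>lborel) +
     (\<integral>\<^sup>+v. ennreal (v powr q) * indicator {0..1-u} v \<partial>lborel) =
     ennreal (u powr (q + 1) / (q + 1) + (1 - u) powr (q + 1) / (q + 1))"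
    using assms by (subst nn_integral_riesz_below nn_integral_powr_near_0; simp add: ennreal_plus)+
  also have "\<dots> \<le> ennreal (2 / (q + 1))"
  proof -
    have "u powr (q + 1) \<le> 1" "(1 - u) powr (q + 1) \<le> 1"
      using assms by (auto intro: powr_le1)
    then show ?thesis using assms unfolding add_divide_distrib[symmetric]
      by (intro ennreal_leI divide_right_mono) auto
  qed
  finally show ?thesis .
qed

text \<open>In the applications the weight is bounded by a decreasing function of \<open>a + b\<close>, hence by its
  value at \<open>max a b\<close>. Splitting the quadrant along the diagonal then leaves one integral
  in the larger variable; the smaller one only enters through the partial integral \<open>G\<close> of
  the kernel.\<close>
lemma nn_integral_kernel_max_le:
  fixes m :: "real \<Rightarrow> real \<Rightarrow> ennreal" and g :: "real \<Rightarrow> ennreal"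
  assumes [measurable]: "case_prod m \<in> borel_measurable (lborel \<Otimes>\<^sub>M lborel)" "g \<in> borel_measurable borel"
    and sym: "\<And>a b. m a b = m b a"
    and bd: "\<And>a. a > 0 \<Longrightarrow> (\<integral>\<^sup>+b. m a b * indicator {0..a} b \<partial>lborel) \<le> G a"
  shows "(\<integral>\<^sup>+a. \<integral>\<^sup>+b. m a b * g (max a b) * indicator {0<..} a * indicator {0<..} b \<partial>lborel \<partial>lborel)
     \<le> 2 * (\<integral>\<^sup>+a. g a * G a * indicator {0<..} a \<partial>lborel)"
proof -
  let ?f = "\<lambda>a b. m a b * indicator {0..a} b * g a * indicator {0<..} a"
  have m1[measurable]: "(\<lambda>x. m (fst x) (snd x)) \<in> borel_measurable (lborel \<Otimes>\<^sub>M lborel)"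
    using assms(1) by (simp add: case_prod_beta')
  have m2[measurable]: "(\<lambda>x. m (snd x) (fst x)) \<in> borel_measurable (lborel \<Otimes>\<^sub>M lborel)"
    using m1 by (simp add: sym)
  have P[measurable]: "Measurable.pred (lborel \<Otimes>\<^sub>M lborel) (\<lambda>x::real \<times> real. snd x \<in> {0..fst x})"
     "Measurable.pred (lborel \<Otimes>\<^sub>M lborel) (\<lambda>x::real \<times> real. fst x \<in> {0..snd x})"
    by (simp_all only: atLeastAtMost_iff) measurable
  have f[measurable]: "(\<lambda>(a,b). ?f a b) \<in> borel_measurable (lborel \<Otimes>\<^sub>M lborel)"
      "(\<lambda>(a,b). ?f b a) \<in> borel_measurable (lborel \<Otimes>\<^sub>M lborel)"
    by (simp_all add: case_prod_beta') measurable
  have "(\<integral>\<^sup>+a. \<integral>\<^sup>+b. m a b * g (max a b) * indicator {0<..} a * indicator {0<..} b \<partial>lborel \<partial>lborel)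
    \<le> (\<integral>\<^sup>+a. \<integral>\<^sup>+b. ?f a b + ?f b a \<partial>lborel \<partial>lborel)"
    by (intro nn_integral_mono) (auto simp: indicator_def max_def sym)
  also have "\<dots> = (\<integral>\<^sup>+a. (\<integral>\<^sup>+b. ?f a b \<partial>lborel) + (\<integral>\<^sup>+b. ?f b a \<partial>lborel) \<partial>lborel)"
    by (intro nn_integral_cong nn_integral_add) (use f in measurable)
  also have "\<dots> = (\<integral>\<^sup>+a. \<integral>\<^sup>+b. ?f a b \<partial>lborel \<partial>lborel) + (\<integral>\<^sup>+a. \<integral>\<^sup>+b. ?f b a \<partial>lborel \<partial>lborel)"
    by (intro nn_integral_add) (use f in measurable)
  also have "(\<integral>\<^sup>+a. \<integral>\<^sup>+b. ?f b a \<partial>lborel \<partial>lborel) = (\<integral>\<^sup>+a. \<integral>\<^sup>+b. ?f a b \<partial>lborel \<partial>lborel)"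
    by (rule lborel_pair.Fubini') (use f in measurable)
  also have "(\<integral>\<^sup>+a. \<integral>\<^sup>+b. ?f a b \<partial>lborel \<partial>lborel) \<le> (\<integral>\<^sup>+a. g a * G a * indicator {0<..} a \<partial>lborel)"
  proof (intro nn_integral_mono)
    fix a :: real
    have "(\<integral>\<^sup>+b. ?f a b \<partial>lborel) = (\<integral>\<^sup>+b. m a b * indicator {0..a} b \<partial>lborel) * (g a * indicator {0<..} a)"
      by (subst nn_integral_multc[symmetric]) (auto simp: mult_ac intro: measurable_compose_Pair1[OF _ assms(1), simplified])
    also have "\<dots> \<le> g a * G a * indicator {0<..} a"
      using bd[of a] by (cases "a > 0") (auto simp: mult.commute[of _ "g a"] intro!: mult_left_mono)
    finally show "(\<integral>\<^sup>+b. ?f a b \<partial>lborel) \<le> g a * G a * indicator {0<..} a" .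
  qed
  finally show ?thesis by (simp add: mult_2 add_mono)
qed

section \<open>First and second differences of a negative power\<close>

lemma powr_diff_bounds:
  fixes x h p :: real
  assumes "x > 0" "h \<ge> 0" "p > 0"
  shows "0 \<le> x powr (-p) - (x + h) powr (-p)"
    and "x powr (-p) - (x + h) powr (-p) \<le> p * h * x powr (- p - 1)"
proof -
  show "0 \<le> x powr (-p) - (x + h) powr (-p)"
    using assms by (simp add: powr_mono2')
  show "x powr (-p) - (x + h) powr (-p) \<le> p * h * x powr (- p - 1)"
  proof (cases "h = 0")
    case False
    then have "x < x + h" using assms by simp
    have "\<exists>z>x. z < x + h \<and> (x + h) powr (-p) - x powr (-p) = (x + h - x) * (- p * z powr (- p - 1))"
      using \<open>x < x + h\<close> assms by (intro MVT2) (auto intro!: derivative_eq_intros)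
    then obtain z where z: "x < z" "(x + h) powr (-p) - x powr (-p) = h * (- p * z powr (- p - 1))"
      by auto
    have "z powr (-p - 1) \<le> x powr (- p - 1)" using z assms by (intro powr_mono2') auto
    then have "p * h * z powr (-p - 1) \<le> p * h * x powr (- p - 1)"
      using assms by (intro mult_left_mono) auto
    with z show ?thesis by (simp add: algebra_simps)
  qed simp
qed

lemma powr_second_diff_bounds:
  fixes x h p :: real
  assumes "x > 0" "h > 0" "p > 0"
  defines "D \<equiv> x powr (-p) - 2 * (x + h) powr (-p) + (x + 2 * h) powr (-p)"
  shows "0 \<le> D" "D \<le> p * (p + 1) * h\<^sup>2 * x powr (- p - 2)" "D \<le> 2 * x powr (-p)"
proof -
  let ?\<theta> = "\<lambda>y. y powr (-p) - (y + h) powr (-p)"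
  have "x < x + h" using assms by simp
  then have "\<exists>z>x. z < x + h \<and>
      ?\<theta> (x + h) - ?\<theta> x = (x + h - x) * ((-p) * z powr (-p - 1) + p * (z + h) powr (-p - 1))"
    using assms by (intro MVT2) (auto intro!: derivative_eq_intros)
  then obtain z where z: "x < z"
      "?\<theta> (x + h) - ?\<theta> x = h * ((-p) * z powr (-p - 1) + p * (z + h) powr (-p - 1))"
    by auto
  have D: "D = h * p * (z powr (-(p + 1)) - (z + h) powr (-(p+1)))"
    using z by (simp add: D_def algebra_simps minus_diff_commute)
  have b: "0 \<le> z powr (-(p + 1)) - (z + h) powr (-(p+1))"
     "z powr (-(p + 1)) - (z + h) powr (-(p+1)) \<le> (p + 1) * h * z powr (- (p + 1) - 1)"
    using powr_diff_bounds[of z h "p + 1"] z assms by auto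
  have "z powr (-(p + 1) - 1) \<le> x powr (-(p + 1) - 1)" using z assms by (intro powr_mono2') auto
  then have "z powr (-(p + 1) - 1) \<le> x powr (-p-2)" by (simp add: diff_diff_eq)
  then have "(p + 1) * h * z powr (-(p + 1) - 1) \<le> (p + 1) * h * x powr (-p-2)"
    using assms by (intro mult_left_mono) auto
  with b have b2: "z powr (-(p + 1)) - (z + h) powr (-(p+1)) \<le> (p + 1) * h * x powr (-p-2)" by linarith
  show "0 \<le> D" using D b assms by simp
  have "D \<le> h * p * ((p + 1) * h * x powr (-p-2))"
    unfolding D using b2 assms by (intro mult_left_mono) auto
  then show "D \<le> p * (p + 1) * h\<^sup>2 * x powr (- p - 2)" by (simp add: power2_eq_square mult_ac)
  have "(x + 2 * h) powr (-p) \<le> x powr (-p)"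
    using assms by (intro powr_mono2') auto
  moreover have "(x + h) powr (-p) \<ge> 0" by simp
  ultimately show "D \<le> 2 * x powr (-p)" unfolding D_def by linarith
qed

text \<open>The covariance of \<open>Z\<^sub>a - Z\<^sub>a\<^sub>-\<^sub>h\<close> and \<open>Z\<^sub>b - Z\<^sub>b\<^sub>-\<^sub>h\<close>, where \<open>Z\<close> is set to 0 at nonpositive times.
  In the time-reversed variables \<open>a = t + h - u\<close> and \<open>b = s + h - v\<close> it is the density with
  which the kernel is integrated in the covariance of two increments of \<open>G\<close>.\<close>
definition incr_weight :: "real \<Rightarrow> real \<Rightarrow> real \<Rightarrow> real \<Rightarrow> real" where
  "incr_weight \<gamma> h a b =
     (if 0 < a \<and> 0 < b then (a + b) powr (-\<gamma>) else 0)
   - (if h < a \<and> 0 < b then (a + b - h) powr (-\<gamma>) else 0)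
   - (if 0 < a \<and> h < b then (a + b - h) powr (-\<gamma>) else 0)
   + (if h < a \<and> h < b then (a + b - 2 * h) powr (-\<gamma>) else 0)"

text \<open>The three bounds belong to the three regions cut out by the lines \<open>a = h\<close> and \<open>b = h\<close>: the
  corner \<open>a, b \<le> h\<close>, where no difference is taken; the bulk \<open>a, b > h\<close>, with a second
  difference; and the two edges, with a first difference. A coordinate
  that exceeds \<open>h\<close> is shifted by \<open>h\<close> when the bound is applied, so that the singularity sits at 0.\<close>
definition corner_bound :: "real \<Rightarrow> real \<Rightarrow> real \<Rightarrow> real" where
  "corner_bound \<gamma> h x = (if x \<le> h then x powr (-\<gamma>) else 0)"

definition bulk_bound :: "real \<Rightarrow> real \<Rightarrow> real \<Rightarrow> real" where
  "bulk_bound \<gamma> h x = (if x \<le> h then 2 * x powr (-\<gamma>) else \<gamma> * (\<gamma> + 1) * h\<^sup>2 * x powr (-\<gamma> - 2))"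

definition edge_bound :: "real \<Rightarrow> real \<Rightarrow> real \<Rightarrow> real \<Rightarrow> real" where
  "edge_bound \<gamma> h x y =
     (if 0 < x \<and> 0 < y \<and> y \<le> h
      then corner_bound \<gamma> h (max x y) + (if h < x then \<gamma> * h * x powr (-\<gamma> - 1) else 0) else 0)"

lemma corner_bound_nonneg: "0 \<le> corner_bound \<gamma> h x"
  by (simp add: corner_bound_def)

lemma bulk_bound_nonneg: "\<gamma> > 0 \<Longrightarrow> 0 \<le> bulk_bound \<gamma> h x"
  by (simp add: bulk_bound_def)

lemma edge_bound_nonneg: "\<gamma> > 0 \<Longrightarrow> h > 0 \<Longrightarrow> 0 \<le> edge_bound \<gamma> h x y"
  by (simp add: edge_bound_def corner_bound_nonneg)

lemma measurable_bounds[measurable]: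
  "corner_bound \<gamma> h \<in> borel_measurable borel" "bulk_bound \<gamma> h \<in> borel_measurable borel"
  "(\<lambda>x. edge_bound \<gamma> h (fst x) (snd x)) \<in> borel_measurable (borel \<Otimes>\<^sub>M borel)"
  "(\<lambda>x. incr_weight \<gamma> h (fst x) (snd x)) \<in> borel_measurable (borel \<Otimes>\<^sub>M borel)"
  unfolding corner_bound_def[abs_def] bulk_bound_def[abs_def] edge_bound_def[abs_def] incr_weight_def[abs_def]
  by measurable

lemma incr_weight_commute: "incr_weight \<gamma> h a b = incr_weight \<gamma> h b a"
  by (simp add: incr_weight_def add.commute conj_commute)

lemma incr_weight_outside: "h > 0 \<Longrightarrow> a \<le> 0 \<or> b \<le> 0 \<Longrightarrow> incr_weight \<gamma> h a b = 0"
  by (auto simp: incr_weight_def)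

lemma incr_weight_corner:
  assumes "\<gamma> > 0" "0 < a" "a \<le> h" "0 < b" "b \<le> h"
  shows "0 \<le> incr_weight \<gamma> h a b" "incr_weight \<gamma> h a b \<le> corner_bound \<gamma> h (max a b)"
  using assms by (auto simp: incr_weight_def corner_bound_def max_def intro!: powr_mono2')

text \<open>On the edges the weight is negative, being minus a first difference of a decreasing
  function. Upper bounds for variances may therefore ignore the edges.\<close>
lemma incr_weight_edge:
  assumes "\<gamma> > 0" "h < a" "0 < b" "b \<le> h"
  shows "incr_weight \<gamma> h a b \<le> 0" "- incr_weight \<gamma> h a b \<le> edge_bound \<gamma> h (a - h) b"
proof -
  define x where "x = a - h"
  have x: "x > 0" and a: "a = x + h" using assms by (auto simp: x_def)
  have w: "- incr_weight \<gamma> h a b = (x + b) powr (-\<gamma>) - (x + b + h) powr (-\<gamma>)"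
    using assms by (simp add: incr_weight_def a algebra_simps)
  show "incr_weight \<gamma> h a b \<le> 0"
    using powr_diff_bounds(1)[of "x + b" h \<gamma>] w assms x by simp
  have 1: "- incr_weight \<gamma> h a b \<le> \<gamma> * h * (x + b) powr (-\<gamma> - 1)"
    using powr_diff_bounds(2)[of "x + b" h \<gamma>] w assms x by simp
  have "(x + b) powr (-\<gamma> - 1) \<le> x powr (-\<gamma> - 1)"
    using assms x by (intro powr_mono2') auto
  then have "\<gamma> * h * (x + b) powr (-\<gamma> - 1) \<le> \<gamma> * h * x powr (-\<gamma> - 1)"
    using assms by (intro mult_left_mono) auto
  with 1 have far: "- incr_weight \<gamma> h a b \<le> \<gamma> * h * x powr (-\<gamma> - 1)" by linarith
  have "- incr_weight \<gamma> h a b \<le> (x + b) powr (-\<gamma>)" unfolding w by simp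
  also have "\<dots> \<le> max x b powr (-\<gamma>)" using assms x by (intro powr_mono2') auto
  finally have near: "- incr_weight \<gamma> h a b \<le> max x b powr (-\<gamma>)" .
  show "- incr_weight \<gamma> h a b \<le> edge_bound \<gamma> h (a - h) b"
    unfolding x_def[symmetric] using near far assms x
    by (cases "x \<le> h") (auto simp: edge_bound_def corner_bound_def max_def)
qed

text \<open>In the bulk the weight is a second difference of a convex function.\<close>
lemma incr_weight_bulk:
  assumes "\<gamma> > 0" "h > 0" "h < a" "h < b"
  shows "0 \<le> incr_weight \<gamma> h a b" "incr_weight \<gamma> h a b \<le> bulk_bound \<gamma> h (max (a - h) (b - h))"
proof -
  define x where "x = a + b - 2 * h"
  define m where "m = max (a - h) (b - h)"
  have x: "x > 0" and m: "0 < m" "m \<le> x" using assms by (auto simp: x_def m_def)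
  have w: "incr_weight \<gamma> h a b = x powr (-\<gamma>) - 2 * (x + h) powr (-\<gamma>) + (x + 2 * h) powr (-\<gamma>)"
    using assms by (simp add: incr_weight_def x_def algebra_simps)
  note b = powr_second_diff_bounds[OF x \<open>h > 0\<close> \<open>\<gamma> > 0\<close>, folded w]
  show "0 \<le> incr_weight \<gamma> h a b" by (rule b)
  have "x powr (-\<gamma>) \<le> m powr (-\<gamma>)" "x powr (-\<gamma> - 2) \<le> m powr (-\<gamma> - 2)"
    using assms m by (auto intro!: powr_mono2')
  then have "2 * x powr (-\<gamma>) \<le> 2 * m powr (-\<gamma>)"
    "\<gamma> * (\<gamma> + 1) * h\<^sup>2 * x powr (-\<gamma> - 2) \<le> \<gamma> * (\<gamma> + 1) * h\<^sup>2 * m powr (-\<gamma> - 2)"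
    using assms by (auto intro!: mult_left_mono)
  with b show "incr_weight \<gamma> h a b \<le> bulk_bound \<gamma> h (max (a - h) (b - h))"
    unfolding m_def[symmetric] bulk_bound_def by auto
qed

lemma incr_weight_le:
  assumes "\<gamma> > 0" "h > 0"
  shows "incr_weight \<gamma> h a b \<le>
      (if 0 < a \<and> 0 < b then corner_bound \<gamma> h (max a b) else 0) +
      (if 0 < a - h \<and> 0 < b - h then bulk_bound \<gamma> h (max (a - h) (b - h)) else 0)"
proof -
  consider "a \<le> 0 \<or> b \<le> 0" | "0 < a" "a \<le> h" "0 < b" "b \<le> h" | "h < a" "0 < b" "b \<le> h"
    | "h < b" "0 < a" "a \<le> h" | "h < a" "h < b"
    by linarith
  then show ?thesis
  proof cases
    case 1 then show ?thesis using incr_weight_outside[of h a b \<gamma>] assms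
      by (auto simp: bulk_bound_nonneg)
  next
    case 2 then show ?thesis using incr_weight_corner[of \<gamma> a h b] assms by auto
  next
    case 3 then show ?thesis using incr_weight_edge(1)[of \<gamma> h a b] assms
      by (auto intro: order_trans[OF _ corner_bound_nonneg])
  next
    case 4 then show ?thesis using incr_weight_edge(1)[of \<gamma> h b a] assms
      by (auto simp: incr_weight_commute[of _ _ a b] intro: order_trans[OF _ corner_bound_nonneg])
  next
    case 5 then show ?thesis using incr_weight_bulk[of \<gamma> h a b] assms corner_bound_nonneg[of \<gamma> h "max a b"]
      by auto
  qed
qed

lemma abs_incr_weight_le:
  assumes "\<gamma> > 0" "h > 0"
  shows "\<bar>incr_weight \<gamma> h a b\<bar> \<le>
      (if 0 < a \<and> 0 < b then corner_bound \<gamma> h (max a b) else 0) +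
      (if 0 < a - h \<and> 0 < b - h then bulk_bound \<gamma> h (max (a - h) (b - h)) else 0) +
      (edge_bound \<gamma> h (a - h) b + edge_bound \<gamma> h (b - h) a)" (is "_ \<le> ?c + ?b + (?e1 + ?e2)")
proof -
  have nn: "0 \<le> ?c" "0 \<le> ?b" "0 \<le> ?e1" "0 \<le> ?e2"
    using assms by (auto simp: corner_bound_nonneg bulk_bound_nonneg edge_bound_nonneg)
  consider "0 \<le> incr_weight \<gamma> h a b" | "h < a" "0 < b" "b \<le> h" | "h < b" "0 < a" "a \<le> h"
    using incr_weight_outside[of h a b \<gamma>] incr_weight_corner(1)[of \<gamma> a h b] incr_weight_bulk(1)[of \<gamma> h a b] assms
    by (metis linorder_not_less order_refl)
  then show ?thesis
  proof cases
    case 1 then show ?thesis using incr_weight_le[OF assms, of a b] nn by linarith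
  next
    case 2 then show ?thesis using incr_weight_edge[of \<gamma> h a b] assms nn by linarith
  next
    case 3 then show ?thesis using incr_weight_edge[of \<gamma> h b a] assms nn
      unfolding incr_weight_commute[of \<gamma> h b a] by linarith
  qed
qed

section \<open>Kernel integrals of the increment weight\<close>

lemma nn_integral_corner_moment:
  assumes "q + 1 - \<gamma> > 0" "h > 0"
  shows "(\<integral>\<^sup>+x. ennreal (corner_bound \<gamma> h x) * ennreal (x powr q) * indicator {0<..} x \<partial>lborel)
    \<le> ennreal (h powr (q + 1 - \<gamma>) / (q + 1 - \<gamma>))"
proof -
  have "(\<integral>\<^sup>+x. ennreal (corner_bound \<gamma> h x) * ennreal (x powr q) * indicator {0<..} x \<partial>lborel)
    \<le> (\<integral>\<^sup>+x. ennreal (x powr (q - \<gamma>)) * indicator {0..h} x \<partial>lborel)"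
    by (intro nn_integral_mono)
      (auto simp: corner_bound_def indicator_def powr_add[symmetric] ennreal_mult[symmetric])
  also have "\<dots> = ennreal (h powr (q - \<gamma> + 1) / (q - \<gamma> + 1))"
    using assms by (intro nn_integral_powr_near_0) auto
  finally show ?thesis by (simp add: algebra_simps)
qed

lemma nn_integral_bulk_moment:
  assumes "\<gamma> > 0" "q + 1 - \<gamma> > 0" "q < \<gamma> + 1" "h > 0"
  shows "(\<integral>\<^sup>+x. ennreal (bulk_bound \<gamma> h x) * ennreal (x powr q) * indicator {0<..} x \<partial>lborel)
    \<le> ennreal ((2 / (q + 1 - \<gamma>) + \<gamma> * (\<gamma> + 1) / (\<gamma> + 1 - q)) * h powr (q + 1 - \<gamma>))"
proof -
  have "(\<integral>\<^sup>+x. ennreal (bulk_bound \<gamma> h x) * ennreal (x powr q) * indicator {0<..} x \<partial>lborel)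
    \<le> (\<integral>\<^sup>+x. 2 * (ennreal (x powr (q - \<gamma>)) * indicator {0..h} x) +
         ennreal (\<gamma> * (\<gamma> + 1) * h\<^sup>2) * (ennreal (x powr (q - \<gamma> - 2)) * indicator {h..} x) \<partial>lborel)"
  proof (intro nn_integral_mono)
    fix x
    have "bulk_bound \<gamma> h x * x powr q = 2 * x powr (q - \<gamma>)" if "x \<le> h"
      using that by (simp add: bulk_bound_def mult.assoc powr_add[symmetric])
    moreover have "bulk_bound \<gamma> h x * x powr q = \<gamma> * (\<gamma> + 1) * h\<^sup>2 * x powr (q - \<gamma> - 2)" if "\<not> x \<le> h"
      using that by (simp add: bulk_bound_def mult.assoc powr_add[symmetric])
        (simp add: algebra_simps)
    ultimately show "ennreal (bulk_bound \<gamma> h x) * ennreal (x powr q) * indicator {0<..} x \<le>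
       2 * (ennreal (x powr (q - \<gamma>)) * indicator {0..h} x) +
         ennreal (\<gamma> * (\<gamma> + 1) * h\<^sup>2) * (ennreal (x powr (q - \<gamma> - 2)) * indicator {h..} x)"
      using assms
      by (cases "x \<le> h"; cases "x > 0")
        (simp_all add: ennreal_mult'[symmetric] ennreal_numeral[symmetric] bulk_bound_nonneg
          del: ennreal_numeral)
  qed
  also have "\<dots> = 2 * (\<integral>\<^sup>+x. ennreal (x powr (q - \<gamma>)) * indicator {0..h} x \<partial>lborel) +
         ennreal (\<gamma> * (\<gamma> + 1) * h\<^sup>2) * (\<integral>\<^sup>+x. ennreal (x powr (q - \<gamma> - 2)) * indicator {h..} x \<partial>lborel)"
    by (simp add: nn_integral_add nn_integral_cmult)
  also have "(\<integral>\<^sup>+x. ennreal (x powr (q - \<gamma>)) * indicator {0..h} x \<partial>lborel) =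
      ennreal (h powr (q + 1 - \<gamma>) / (q + 1 - \<gamma>))"
    using assms nn_integral_powr_near_0[of "q - \<gamma>" h] by (simp add: algebra_simps)
  also have "(\<integral>\<^sup>+x. ennreal (x powr (q - \<gamma> - 2)) * indicator {h..} x \<partial>lborel) =
      ennreal (h powr (q + 1 - \<gamma> - 2) / (\<gamma> + 1 - q))"
    using assms nn_integral_powr_at_top[of "q - \<gamma> - 2" h] by (simp add: algebra_simps)
  also have "2 * ennreal (h powr (q + 1 - \<gamma>) / (q + 1 - \<gamma>)) +
      ennreal (\<gamma> * (\<gamma> + 1) * h\<^sup>2) * ennreal (h powr (q + 1 - \<gamma> - 2) / (\<gamma> + 1 - q)) =
     ennreal (2 * (h powr (q + 1 - \<gamma>) / (q + 1 - \<gamma>)) + \<gamma> * (\<gamma> + 1) * h\<^sup>2 * (h powr (q + 1 - \<gamma> - 2) / (\<gamma> + 1 - q)))"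
    using assms by (subst ennreal_plus)
      (simp_all only: ennreal_mult'[symmetric] ennreal_numeral[symmetric], simp_all add: ennreal_mult'[symmetric])
  also have "h\<^sup>2 * h powr (q + 1 - \<gamma> - 2) = h powr (q + 1 - \<gamma>)"
    using assms by (simp add: powr_diff powr_add powr_numeral power2_eq_square)
  then have "2 * (h powr (q + 1 - \<gamma>) / (q + 1 - \<gamma>)) + \<gamma> * (\<gamma> + 1) * h\<^sup>2 * (h powr (q + 1 - \<gamma> - 2) / (\<gamma> + 1 - q))
     = (2 / (q + 1 - \<gamma>) + \<gamma> * (\<gamma> + 1) / (\<gamma> + 1 - q)) * h powr (q + 1 - \<gamma>)"
    by (simp add: algebra_simps add_divide_distrib)
  finally show ?thesis by simp
qed

lemma nn_integral_diff_shift: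
  fixes f :: "real \<Rightarrow> ennreal" assumes "f \<in> borel_measurable borel"
  shows "(\<integral>\<^sup>+x. f (x - h) \<partial>lborel) = (\<integral>\<^sup>+x. f x \<partial>lborel)"
  using nn_integral_real_affine[OF assms, of 1 "-h"] by simp

lemma nn_integral_kernel_diff_shift:
  fixes f :: "real \<Rightarrow> real \<Rightarrow> ennreal"
  assumes "(\<lambda>x. f (fst x) (snd x)) \<in> borel_measurable (borel \<Otimes>\<^sub>M borel)"
  shows "(\<integral>\<^sup>+a. \<integral>\<^sup>+b. f (a - h) (b - h) \<partial>lborel \<partial>lborel) = (\<integral>\<^sup>+a. \<integral>\<^sup>+b. f a b \<partial>lborel \<partial>lborel)"
proof -
  note [measurable] = measurable_compose[OF _ assms]
  have f: "f a \<in> borel_measurable borel" for a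
    using measurable_compose[OF measurable_Pair1' assms, of a] by simp
  have "(\<lambda>x. f (fst x) (snd x)) \<in> borel_measurable (borel \<Otimes>\<^sub>M lborel)" using assms by simp
  then have "(\<lambda>a. \<integral>\<^sup>+b. f a b \<partial>lborel) \<in> borel_measurable borel"
    using lborel.borel_measurable_nn_integral[of "f" borel] by (simp add: case_prod_beta')
  from nn_integral_diff_shift[OF this, of h] show ?thesis
    by (simp add: nn_integral_diff_shift[OF f])
qed

lemma nn_integral_double_add:
  fixes f g :: "real \<Rightarrow> real \<Rightarrow> ennreal"
  assumes "(\<lambda>x. f (fst x) (snd x)) \<in> borel_measurable (borel \<Otimes>\<^sub>M borel)"
    and "(\<lambda>x. g (fst x) (snd x)) \<in> borel_measurable (borel \<Otimes>\<^sub>M borel)"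
  shows "(\<integral>\<^sup>+a. \<integral>\<^sup>+b. f a b + g a b \<partial>lborel \<partial>lborel) =
    (\<integral>\<^sup>+a. \<integral>\<^sup>+b. f a b \<partial>lborel \<partial>lborel) + (\<integral>\<^sup>+a. \<integral>\<^sup>+b. g a b \<partial>lborel \<partial>lborel)"
proof -
  note [measurable] = measurable_compose[OF _ assms(1)] measurable_compose[OF _ assms(2)]
  have f: "f a \<in> borel_measurable borel" "g a \<in> borel_measurable borel" for a
    using measurable_compose[OF measurable_Pair1' assms(1), of a]
      measurable_compose[OF measurable_Pair1' assms(2), of a] by simp_all
  have "(\<lambda>x. f (fst x) (snd x)) \<in> borel_measurable (borel \<Otimes>\<^sub>M lborel)"
    "(\<lambda>x. g (fst x) (snd x)) \<in> borel_measurable (borel \<Otimes>\<^sub>M lborel)" using assms by simp_all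
  then have "(\<lambda>a. \<integral>\<^sup>+b. f a b \<partial>lborel) \<in> borel_measurable borel"
    "(\<lambda>a. \<integral>\<^sup>+b. g a b \<partial>lborel) \<in> borel_measurable borel"
    using lborel.borel_measurable_nn_integral[of _ borel] by (simp_all add: case_prod_beta')
  then show ?thesis by (simp add: nn_integral_add f)
qed

text \<open>This is the variance bound for increments, with \<open>q = 2 H - 2\<close>. Since \<open>ennreal\<close> sends negative
  numbers to 0, the left-hand side only sees the positive part of the weight, that is, the
  corner and the bulk. The power of \<open>h\<close> is dictated by scaling; convergence at the origin
  needs \<open>\<gamma> < q + 2\<close> and convergence at infinity needs \<open>q < \<gamma>\<close>.\<close>
lemma riesz_incr_weight_bound:
  assumes "\<gamma> > 0" "q > -1" "q < 0" "\<gamma> < q + 2"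
  obtains C where "C \<ge> 0" "\<And>h. h > 0 \<Longrightarrow>
     (\<integral>\<^sup>+a. \<integral>\<^sup>+b. ennreal (\<bar>a - b\<bar> powr q) * ennreal (incr_weight \<gamma> h a b) \<partial>lborel \<partial>lborel)
       \<le> ennreal (C * h powr (q + 2 - \<gamma>))"
proof -
  let ?D = "1 / (q + 2 - \<gamma>)" and ?E = "2 / (q + 2 - \<gamma>) + \<gamma> * (\<gamma> + 1) / (\<gamma> - q)"
  define C where "C = 2 / (q + 1) * (?D + ?E)"
  have "C \<ge> 0" using assms by (auto simp: C_def intro!: mult_nonneg_nonneg add_nonneg_nonneg divide_nonneg_nonneg)
  moreover have "(\<integral>\<^sup>+a. \<integral>\<^sup>+b. ennreal (\<bar>a - b\<bar> powr q) * ennreal (incr_weight \<gamma> h a b) \<partial>lborel \<partial>lborel)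
       \<le> ennreal (C * h powr (q + 2 - \<gamma>))" if h: "h > 0" for h
  proof -
    let ?K = "\<lambda>g a b. ennreal (\<bar>a - b\<bar> powr q) * ennreal (g (max a b)) * indicator {0<..} a * indicator {0<..} b"
    have main: "(\<integral>\<^sup>+a. \<integral>\<^sup>+b. ?K g a b \<partial>lborel \<partial>lborel) \<le> ennreal (2 / (q + 1) * D)"
      if [measurable]: "g \<in> borel_measurable borel" and "D \<ge> 0"
        and m: "(\<integral>\<^sup>+x. ennreal (g x) * ennreal (x powr (q + 1)) * indicator {0<..} x \<partial>lborel) \<le> ennreal D" for g D
    proof -
      have "(\<integral>\<^sup>+a. \<integral>\<^sup>+b. ?K g a b \<partial>lborel \<partial>lborel) \<le>
         2 * (\<integral>\<^sup>+x. ennreal (g x) * ennreal (x powr (q + 1) / (q + 1)) * indicator {0<..} x \<partial>lborel)"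
        using assms by (intro nn_integral_kernel_max_le)
          (auto simp: abs_minus_commute nn_integral_riesz_below)
      also have "(\<integral>\<^sup>+x. ennreal (g x) * ennreal (x powr (q + 1) / (q + 1)) * indicator {0<..} x \<partial>lborel)
         = ennreal (1 / (q + 1)) * (\<integral>\<^sup>+x. ennreal (g x) * ennreal (x powr (q + 1)) * indicator {0<..} x \<partial>lborel)"
      proof (subst nn_integral_cmult[symmetric])
        have "ennreal (x powr (q + 1) / (q + 1)) = ennreal (1 / (q + 1)) * ennreal (x powr (q + 1))" for x
          using assms by (simp add: ennreal_mult'[symmetric])
        then show "(\<integral>\<^sup>+x. ennreal (g x) * ennreal (x powr (q + 1) / (q + 1)) * indicator {0<..} x \<partial>lborel)
           = (\<integral>\<^sup>+x. ennreal (1 / (q + 1)) * (ennreal (g x) * ennreal (x powr (q + 1)) * indicator {0<..} x) \<partial>lborel)"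
          by (simp add: mult_ac)
      qed measurable
      also have "2 * (ennreal (1 / (q + 1)) * (\<integral>\<^sup>+x. ennreal (g x) * ennreal (x powr (q + 1)) * indicator {0<..} x \<partial>lborel))
         \<le> 2 * (ennreal (1 / (q + 1)) * ennreal D)"
        using m by (intro mult_left_mono) auto
      also have "\<dots> = ennreal (2 / (q + 1) * D)"
        using assms \<open>D \<ge> 0\<close>
        by (simp only: ennreal_numeral[symmetric]) (simp add: ennreal_mult'[symmetric] del: ennreal_numeral)
      finally show ?thesis .
    qed
    have "(\<integral>\<^sup>+a. \<integral>\<^sup>+b. ennreal (\<bar>a - b\<bar> powr q) * ennreal (incr_weight \<gamma> h a b) \<partial>lborel \<partial>lborel) \<le>
      (\<integral>\<^sup>+a. \<integral>\<^sup>+b. ?K (corner_bound \<gamma> h) a b + ?K (bulk_bound \<gamma> h) (a - h) (b - h) \<partial>lborel \<partial>lborel)"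
    proof (intro nn_integral_mono)
      fix a b
      have "ennreal (incr_weight \<gamma> h a b) \<le> 
        ennreal (if 0 < a \<and> 0 < b then corner_bound \<gamma> h (max a b) else 0) +
        ennreal (if 0 < a - h \<and> 0 < b - h then bulk_bound \<gamma> h (max (a - h) (b - h)) else 0)"
        using incr_weight_le[of \<gamma> h a b] assms h
        by (subst ennreal_plus[symmetric])
          (auto intro!: ennreal_leI simp: corner_bound_nonneg bulk_bound_nonneg simp del: ennreal_plus)
      then have "ennreal (\<bar>a - b\<bar> powr q) * ennreal (incr_weight \<gamma> h a b) \<le> ennreal (\<bar>a - b\<bar> powr q) *
        (ennreal (if 0 < a \<and> 0 < b then corner_bound \<gamma> h (max a b) else 0) +
        ennreal (if 0 < a - h \<and> 0 < b - h then bulk_bound \<gamma> h (max (a - h) (b - h)) else 0))"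
        by (rule mult_left_mono) simp
      also have "\<dots> = ?K (corner_bound \<gamma> h) a b + ?K (bulk_bound \<gamma> h) (a - h) (b - h)"
        unfolding distrib_left by (intro arg_cong2[of _ _ _ _ "(+)"]) (auto simp: indicator_def)
      finally show "ennreal (\<bar>a - b\<bar> powr q) * ennreal (incr_weight \<gamma> h a b) \<le>
         ?K (corner_bound \<gamma> h) a b + ?K (bulk_bound \<gamma> h) (a - h) (b - h)" .
    qed
    also have "\<dots> = (\<integral>\<^sup>+a. \<integral>\<^sup>+b. ?K (corner_bound \<gamma> h) a b \<partial>lborel \<partial>lborel) +
        (\<integral>\<^sup>+a. \<integral>\<^sup>+b. ?K (bulk_bound \<gamma> h) (a - h) (b - h) \<partial>lborel \<partial>lborel)"
      by (rule nn_integral_double_add) measurable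
    also have "(\<integral>\<^sup>+a. \<integral>\<^sup>+b. ?K (bulk_bound \<gamma> h) (a - h) (b - h) \<partial>lborel \<partial>lborel) =
        (\<integral>\<^sup>+a. \<integral>\<^sup>+b. ?K (bulk_bound \<gamma> h) a b \<partial>lborel \<partial>lborel)"
      by (rule nn_integral_kernel_diff_shift[where f="?K (bulk_bound \<gamma> h)"]) measurable
    also have "(\<integral>\<^sup>+a. \<integral>\<^sup>+b. ?K (corner_bound \<gamma> h) a b \<partial>lborel \<partial>lborel) + \<dots> \<le>
        ennreal (2 / (q + 1) * (?D * h powr (q + 2 - \<gamma>))) + ennreal (2 / (q + 1) * (?E * h powr (q + 2 - \<gamma>)))"
    proof (intro add_mono main)
      show "(\<integral>\<^sup>+x. ennreal (corner_bound \<gamma> h x) * ennreal (x powr (q + 1)) * indicator {0<..} x \<partial>lborel) \<le> ennreal (?D * h powr (q + 2 - \<gamma>))"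
        using nn_integral_corner_moment[of "q + 1" \<gamma> h] assms h by (simp add: add.commute algebra_simps)
      show "(\<integral>\<^sup>+x. ennreal (bulk_bound \<gamma> h x) * ennreal (x powr (q + 1)) * indicator {0<..} x \<partial>lborel) \<le> ennreal (?E * h powr (q + 2 - \<gamma>))"
        using nn_integral_bulk_moment[of \<gamma> "q + 1" h] assms h by (simp add: add.commute add.assoc)
    qed (use assms in auto)
    also have "\<dots> = ennreal (2 / (q + 1) * (?D * h powr (q + 2 - \<gamma>)) + 2 / (q + 1) * (?E * h powr (q + 2 - \<gamma>)))"
    proof (rule ennreal_plus[symmetric])
      have "0 \<le> 2 / (q + 1)" "0 \<le> ?D" "0 \<le> ?E" using assms by (auto intro!: add_nonneg_nonneg)
      then show "0 \<le> 2 / (q + 1) * (?D * h powr (q + 2 - \<gamma>))" "0 \<le> 2 / (q + 1) * (?E * h powr (q + 2 - \<gamma>))"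
        by (auto simp del: times_divide_eq_left times_divide_eq_right)
    qed
    also have "\<dots> = ennreal (C * h powr (q + 2 - \<gamma>))"
      by (simp only: C_def distrib_left distrib_right mult.assoc)
    finally show ?thesis .
  qed
  ultimately show ?thesis by (rule that)
qed

text \<open>The total mass of the weight, which yields the decorrelation of the increments. Here the
  edges contribute, and there is no kernel: the kernel is integrated out first, over the
  positions of the two increments.\<close>
lemma abs_incr_weight_integral_bound:
  assumes "\<gamma> > 0" "\<gamma> < 2"
  obtains C where "C \<ge> 0" "\<And>h. h > 0 \<Longrightarrow>
     (\<integral>\<^sup>+a. \<integral>\<^sup>+b. ennreal \<bar>incr_weight \<gamma> h a b\<bar> \<partial>lborel \<partial>lborel) \<le> ennreal (C * h powr (2 - \<gamma>))"
proof -
  let ?D = "1 / (2 - \<gamma>)" and ?E = "2 / (2 - \<gamma>) + (\<gamma> + 1)"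
  define C where "C = 2 * ?D + 2 * ?E + 2 * (2 * ?D + 1)"
  have "C \<ge> 0" using assms by (auto simp: C_def intro!: mult_nonneg_nonneg add_nonneg_nonneg divide_nonneg_nonneg)
  moreover have "(\<integral>\<^sup>+a. \<integral>\<^sup>+b. ennreal \<bar>incr_weight \<gamma> h a b\<bar> \<partial>lborel \<partial>lborel) \<le> ennreal (C * h powr (2 - \<gamma>))"
    if h: "h > 0" for h
  proof -
    let ?K = "\<lambda>g a b. ennreal (g (max a b)) * indicator {0<..} a * indicator {0<..} b"
    let ?e = "\<lambda>a b. ennreal (edge_bound \<gamma> h a b)"
    let ?R = "h powr (2 - \<gamma>)"
    have main: "(\<integral>\<^sup>+a. \<integral>\<^sup>+b. ?K g a b \<partial>lborel \<partial>lborel) \<le> ennreal (2 * D)"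
      if [measurable]: "g \<in> borel_measurable borel" and "D \<ge> 0"
        and m: "(\<integral>\<^sup>+x. ennreal (g x) * ennreal (x powr 1) * indicator {0<..} x \<partial>lborel) \<le> ennreal D" for g D
    proof -
      have "(\<integral>\<^sup>+a. \<integral>\<^sup>+b. 1 * ennreal (g (max a b)) * indicator {0<..} a * indicator {0<..} b \<partial>lborel \<partial>lborel) \<le>
         2 * (\<integral>\<^sup>+x. ennreal (g x) * ennreal (x powr 1) * indicator {0<..} x \<partial>lborel)"
        by (intro nn_integral_kernel_max_le) auto
      also have "\<dots> \<le> 2 * ennreal D" using m by (intro mult_left_mono) auto
      also have "\<dots> = ennreal (2 * D)" using \<open>D \<ge> 0\<close> by (simp add: ennreal_mult)
      finally show ?thesis by simp
    qed
    have corner: "(\<integral>\<^sup>+a. \<integral>\<^sup>+b. ?K (corner_bound \<gamma> h) a b \<partial>lborel \<partial>lborel) \<le> ennreal (2 * (?D * ?R))"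
      using nn_integral_corner_moment[of 1 \<gamma> h] assms h by (intro main) auto
    have bulk: "(\<integral>\<^sup>+a. \<integral>\<^sup>+b. ?K (bulk_bound \<gamma> h) a b \<partial>lborel \<partial>lborel) \<le> ennreal (2 * (?E * ?R))"
      using nn_integral_bulk_moment[of \<gamma> 1 h] assms h by (intro main) auto
    have far: "(\<integral>\<^sup>+a. \<integral>\<^sup>+b. ennreal (\<gamma> * h * a powr (-\<gamma> - 1)) * indicator {h..} a * indicator {0..h} b \<partial>lborel \<partial>lborel)
       \<le> ennreal ?R"
    proof -
      have "(\<integral>\<^sup>+a. \<integral>\<^sup>+b. ennreal (\<gamma> * h * a powr (-\<gamma> - 1)) * indicator {h..} a * indicator {0..h} b \<partial>lborel \<partial>lborel)
         = (\<integral>\<^sup>+a. ennreal (\<gamma> * h\<^sup>2) * (ennreal (a powr (-\<gamma> - 1)) * indicator {h..} a) \<partial>lborel)"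
        using h assms
        by (intro nn_integral_cong, subst nn_integral_cmult)
          (auto simp: ennreal_mult'[symmetric] power2_eq_square mult_ac split: split_indicator)
      also have "\<dots> = ennreal (\<gamma> * h\<^sup>2) * ennreal (h powr (-\<gamma>) / \<gamma>)"
        using nn_integral_powr_at_top[of "-\<gamma> - 1" h] assms h by (simp add: nn_integral_cmult)
      also have "\<dots> = ennreal ?R"
        using h assms by (simp add: ennreal_mult'[symmetric] powr_diff powr_minus powr_numeral field_simps)
      finally show ?thesis by simp
    qed
    have edge: "(\<integral>\<^sup>+a. \<integral>\<^sup>+b. ?e a b \<partial>lborel \<partial>lborel) \<le> ennreal ((2 * ?D + 1) * ?R)"
    proof -
      have "(\<integral>\<^sup>+a. \<integral>\<^sup>+b. ?e a b \<partial>lborel \<partial>lborel) \<le> (\<integral>\<^sup>+a. \<integral>\<^sup>+b. ?K (corner_bound \<gamma> h) a b +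
         ennreal (\<gamma> * h * a powr (-\<gamma> - 1)) * indicator {h..} a * indicator {0..h} b \<partial>lborel \<partial>lborel)"
        using assms h
        by (intro nn_integral_mono) (auto simp: edge_bound_def indicator_def corner_bound_nonneg ennreal_plus)
      also have "\<dots> = (\<integral>\<^sup>+a. \<integral>\<^sup>+b. ?K (corner_bound \<gamma> h) a b \<partial>lborel \<partial>lborel) +
         (\<integral>\<^sup>+a. \<integral>\<^sup>+b. ennreal (\<gamma> * h * a powr (-\<gamma> - 1)) * indicator {h..} a * indicator {0..h} b \<partial>lborel \<partial>lborel)"
        by (rule nn_integral_double_add) measurable
      also have "\<dots> \<le> ennreal (2 * (?D * ?R)) + ennreal ?R" by (intro add_mono corner far)
      also have "\<dots> = ennreal ((2 * ?D + 1) * ?R)"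
        using assms by (subst ennreal_plus[symmetric]) (auto simp: algebra_simps)
      finally show ?thesis .
    qed
    have edge1: "(\<integral>\<^sup>+a. \<integral>\<^sup>+b. ?e (a - h) b \<partial>lborel \<partial>lborel) \<le> ennreal ((2 * ?D + 1) * ?R)"
      using edge by (subst nn_integral_diff_shift[where f="\<lambda>a. \<integral>\<^sup>+b. ?e a b \<partial>lborel"]) measurable
    have [measurable]: "(\<lambda>x. edge_bound \<gamma> h (fst x - h) (snd x)) \<in> borel_measurable (borel \<Otimes>\<^sub>M borel)"
      using measurable_compose[OF _ measurable_bounds(3), of "\<lambda>x. (fst x - h, snd x)" _ \<gamma> h] by simp
    have [measurable]: "(\<lambda>x. edge_bound \<gamma> h (snd x - h) (fst x)) \<in> borel_measurable (borel \<Otimes>\<^sub>M borel)"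
      using measurable_compose[OF _ measurable_bounds(3), of "\<lambda>x. (snd x - h, fst x)" _ \<gamma> h] by simp
    have edge2: "(\<integral>\<^sup>+a. \<integral>\<^sup>+b. ?e (b - h) a \<partial>lborel \<partial>lborel) \<le> ennreal ((2 * ?D + 1) * ?R)"
      using edge1 by (subst lborel_pair.Fubini') (auto simp: case_prod_beta')
    have "(\<integral>\<^sup>+a. \<integral>\<^sup>+b. ennreal \<bar>incr_weight \<gamma> h a b\<bar> \<partial>lborel \<partial>lborel) \<le>
      (\<integral>\<^sup>+a. \<integral>\<^sup>+b. (?K (corner_bound \<gamma> h) a b + ?K (bulk_bound \<gamma> h) (a - h) (b - h)) +
         (?e (a - h) b + ?e (b - h) a) \<partial>lborel \<partial>lborel)"
    proof (intro nn_integral_mono)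
      fix a b
      have "ennreal \<bar>incr_weight \<gamma> h a b\<bar> \<le> 
        (ennreal (if 0 < a \<and> 0 < b then corner_bound \<gamma> h (max a b) else 0) +
        ennreal (if 0 < a - h \<and> 0 < b - h then bulk_bound \<gamma> h (max (a - h) (b - h)) else 0)) +
        (?e (a - h) b + ?e (b - h) a)"
        using abs_incr_weight_le[of \<gamma> h a b] assms h
        by (subst ennreal_plus[symmetric]; (subst ennreal_plus[symmetric])?; (subst ennreal_plus[symmetric])?)
           (auto intro!: ennreal_leI simp: corner_bound_nonneg bulk_bound_nonneg edge_bound_nonneg simp del: ennreal_plus)
      also have "\<dots> = (?K (corner_bound \<gamma> h) a b + ?K (bulk_bound \<gamma> h) (a - h) (b - h)) +
         (?e (a - h) b + ?e (b - h) a)"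
        by (intro arg_cong2[of _ _ _ _ "(+)"]) (auto simp: indicator_def)
      finally show "ennreal \<bar>incr_weight \<gamma> h a b\<bar> \<le> (?K (corner_bound \<gamma> h) a b + ?K (bulk_bound \<gamma> h) (a - h) (b - h)) +
         (?e (a - h) b + ?e (b - h) a)" .
    qed
    also have "\<dots> = ((\<integral>\<^sup>+a. \<integral>\<^sup>+b. ?K (corner_bound \<gamma> h) a b \<partial>lborel \<partial>lborel) +
        (\<integral>\<^sup>+a. \<integral>\<^sup>+b. ?K (bulk_bound \<gamma> h) (a - h) (b - h) \<partial>lborel \<partial>lborel)) +
        ((\<integral>\<^sup>+a. \<integral>\<^sup>+b. ?e (a - h) b \<partial>lborel \<partial>lborel) + (\<integral>\<^sup>+a. \<integral>\<^sup>+b. ?e (b - h) a \<partial>lborel \<partial>lborel))"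
      by (simp add: nn_integral_double_add)
    also have "(\<integral>\<^sup>+a. \<integral>\<^sup>+b. ?K (bulk_bound \<gamma> h) (a - h) (b - h) \<partial>lborel \<partial>lborel) =
        (\<integral>\<^sup>+a. \<integral>\<^sup>+b. ?K (bulk_bound \<gamma> h) a b \<partial>lborel \<partial>lborel)"
      by (rule nn_integral_kernel_diff_shift[where f="?K (bulk_bound \<gamma> h)"]) measurable
    also have "((\<integral>\<^sup>+a. \<integral>\<^sup>+b. ?K (corner_bound \<gamma> h) a b \<partial>lborel \<partial>lborel) + \<dots>) +
         ((\<integral>\<^sup>+a. \<integral>\<^sup>+b. ?e (a - h) b \<partial>lborel \<partial>lborel) + (\<integral>\<^sup>+a. \<integral>\<^sup>+b. ?e (b - h) a \<partial>lborel \<partial>lborel)) \<le>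
        (ennreal (2 * (?D * ?R)) + ennreal (2 * (?E * ?R))) +
        (ennreal ((2 * ?D + 1) * ?R) + ennreal ((2 * ?D + 1) * ?R))"
      by (intro add_mono corner bulk edge1 edge2)
    also have "\<dots> = ennreal ((2 * (?D * ?R) + 2 * (?E * ?R)) + ((2 * ?D + 1) * ?R + (2 * ?D + 1) * ?R))"
      using assms by (simp only: ennreal_plus[symmetric] mult_nonneg_nonneg add_nonneg_nonneg divide_nonneg_nonneg
         powr_ge_zero diff_ge_0_iff_ge less_imp_le zero_le_numeral zero_le_one)
    also have "\<dots> = ennreal (C * ?R)"
      by (simp add: C_def algebra_simps)
    finally show ?thesis .
  qed
  ultimately show ?thesis by (rule that)
qed

section \<open>Variance and total covariance of increments\<close>

text \<open>The integrand of the covariance of \<open>G\<^sub>t\<close> and \<open>G\<^sub>s\<close>.\<close>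
definition variance_kernel :: "real \<Rightarrow> real \<Rightarrow> real \<Rightarrow> real \<Rightarrow> real \<times> real \<Rightarrow> real" where
  "variance_kernel H \<gamma> t s = (\<lambda>(u, v). \<bar>u - v\<bar> powr (2 * H - 2) *
     (if 0 < u \<and> u < t \<and> 0 < v \<and> v < s then (t + s - u - v) powr (- \<gamma>) else 0))"

lemma measurable_variance_kernel[measurable]:
  "variance_kernel H \<gamma> t s \<in> borel_measurable (lborel \<Otimes>\<^sub>M lborel)"
  unfolding variance_kernel_def by measurable

text \<open>The corresponding integrand for the covariance of two increments of length \<open>h\<close>.\<close>
definition increment_kernel :: "real \<Rightarrow> real \<Rightarrow> real \<Rightarrow> real \<Rightarrow> real \<Rightarrow> real \<times> real \<Rightarrow> real" where
  "increment_kernel H \<gamma> h t s = (\<lambda>(u, v). \<bar>u - v\<bar> powr (2 * H - 2) *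
     (if 0 < u \<and> 0 < v then incr_weight \<gamma> h (t + h - u) (s + h - v) else 0))"

lemma increment_kernel_eq:
  assumes "h > 0"
  shows "increment_kernel H \<gamma> h t s p =
     variance_kernel H \<gamma> (t + h) (s + h) p - variance_kernel H \<gamma> t (s + h) p
     - variance_kernel H \<gamma> (t + h) s p + variance_kernel H \<gamma> t s p"
proof -
  obtain u v where p: "p = (u, v)" by (cases p)
  have "incr_weight \<gamma> h (t + h - u) (s + h - v) =
     (if u < t + h \<and> v < s + h then ((t + h) + (s + h) - u - v) powr (-\<gamma>) else 0)
   - (if u < t \<and> v < s + h then (t + (s + h) - u - v) powr (-\<gamma>) else 0)
   - (if u < t + h \<and> v < s then ((t + h) + s - u - v) powr (-\<gamma>) else 0)
   + (if u < t \<and> v < s then (t + s - u - v) powr (-\<gamma>) else 0)"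
  proof -
    have "t + h - u + (s + h - v) = (t + h) + (s + h) - u - v" "t + h - u + (s + h - v) - h = t + (s + h) - u - v"
      "t + h - u + (s + h - v) - 2 * h = t + s - u - v" "(t + h) + s - u - v = t + (s + h) - u - v" by auto
    moreover have "0 < t + h - u \<longleftrightarrow> u < t + h" "0 < s + h - v \<longleftrightarrow> v < s + h" "h < t + h - u \<longleftrightarrow> u < t" "h < s + h - v \<longleftrightarrow> v < s" by auto
    ultimately show ?thesis unfolding incr_weight_def by (simp only:)
  qed
  then show ?thesis
    unfolding increment_kernel_def variance_kernel_def p
    by (cases "0 < u \<and> 0 < v") (simp_all only: prod.case if_True if_False simp_thms, auto simp: algebra_simps)
qed

lemma increment_covariance:
  assumes cov: "\<And>s t. s \<ge> 0 \<Longrightarrow> t \<ge> 0 \<Longrightarrow>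
      (LINT \<omega>|M. G t \<omega> * G s \<omega>) = c * (LINT p|(lborel \<Otimes>\<^sub>M lborel). variance_kernel H \<gamma> t s p)"
    and int: "\<And>s t. s \<ge> 0 \<Longrightarrow> t \<ge> 0 \<Longrightarrow> integrable (lborel \<Otimes>\<^sub>M lborel) (variance_kernel H \<gamma> t s)"
    and intG: "\<And>s t. s \<ge> 0 \<Longrightarrow> t \<ge> 0 \<Longrightarrow> integrable M (\<lambda>\<omega>. G t \<omega> * G s \<omega>)"
    and "h > 0" "s \<ge> 0" "t \<ge> 0"
  shows "(LINT \<omega>|M. (G (t + h) \<omega> - G t \<omega>) * (G (s + h) \<omega> - G s \<omega>)) =
     c * (LINT p|(lborel \<Otimes>\<^sub>M lborel). increment_kernel H \<gamma> h t s p)"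
proof -
  have eq: "(\<lambda>\<omega>. (G (t + h) \<omega> - G t \<omega>) * (G (s + h) \<omega> - G s \<omega>)) =
     (\<lambda>\<omega>. G (t + h) \<omega> * G (s + h) \<omega> - G t \<omega> * G (s + h) \<omega> - G (t + h) \<omega> * G s \<omega> + G t \<omega> * G s \<omega>)"
    by (auto simp: algebra_simps)
  show "(LINT \<omega>|M. (G (t + h) \<omega> - G t \<omega>) * (G (s + h) \<omega> - G s \<omega>)) =
     c * (LINT p|(lborel \<Otimes>\<^sub>M lborel). increment_kernel H \<gamma> h t s p)"
    unfolding eq increment_kernel_eq[OF \<open>h > 0\<close>] using assms by (simp add: right_diff_distrib distrib_left)
qed

lemma measurable_incr_weight_compose[measurable (raw)]:
  assumes [measurable]: "f \<in> borel_measurable M" "g \<in> borel_measurable M"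
  shows "(\<lambda>x. incr_weight \<gamma> h (f x) (g x)) \<in> borel_measurable M"
  unfolding incr_weight_def by measurable

lemma measurable_increment_kernel[measurable]:
  "increment_kernel H \<gamma> h t s \<in> borel_measurable (lborel \<Otimes>\<^sub>M lborel)"
  unfolding increment_kernel_def by measurable

lemma increment_variance_bound:
  assumes H: "1 / 2 < H" "H < 1" and \<gamma>: "0 < \<gamma>" "\<gamma> < 2 * H"
  obtains C where "C \<ge> 0" "\<And>h t. h > 0 \<Longrightarrow> (LINT p|(lborel \<Otimes>\<^sub>M lborel). increment_kernel H \<gamma> h t t p) \<le> C * h powr (2 * H - \<gamma>)"
proof -
  let ?q = "2 * H - 2"
  obtain C where C: "C \<ge> 0" and bd: "\<And>h. h > 0 \<Longrightarrow>
     (\<integral>\<^sup>+a. \<integral>\<^sup>+b. ennreal (\<bar>a - b\<bar> powr ?q) * ennreal (incr_weight \<gamma> h a b) \<partial>lborel \<partial>lborel)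
       \<le> ennreal (C * h powr (?q + 2 - \<gamma>))"
    using riesz_incr_weight_bound[of \<gamma> ?q] H \<gamma> by auto
  have "(LINT p|(lborel \<Otimes>\<^sub>M lborel). increment_kernel H \<gamma> h t t p) \<le> C * h powr (2 * H - \<gamma>)" if h: "h > 0" for h t
  proof (rule integral_real_bounded)
    let ?f = "\<lambda>a b. ennreal (\<bar>a - b\<bar> powr ?q) * ennreal (incr_weight \<gamma> h a b)"
    have "(\<integral>\<^sup>+p. ennreal (increment_kernel H \<gamma> h t t p) \<partial>(lborel \<Otimes>\<^sub>M lborel)) =
       (\<integral>\<^sup>+u. \<integral>\<^sup>+v. ennreal (increment_kernel H \<gamma> h t t (u, v)) \<partial>lborel \<partial>lborel)"
      by (rule lborel.nn_integral_fst[symmetric]) measurable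
    also have "\<dots> \<le> (\<integral>\<^sup>+u. \<integral>\<^sup>+v. ?f (t + h - u) (t + h - v) \<partial>lborel \<partial>lborel)"
      by (intro nn_integral_mono) (auto simp: increment_kernel_def ennreal_mult' abs_minus_commute)
    also have "\<dots> = (\<integral>\<^sup>+u. \<integral>\<^sup>+b. ?f (t + h - u) b \<partial>lborel \<partial>lborel)"
      by (intro nn_integral_cong nn_integral_reflect[symmetric]) measurable
    also have "\<dots> = (\<integral>\<^sup>+a. \<integral>\<^sup>+b. ?f a b \<partial>lborel \<partial>lborel)"
      by (rule nn_integral_reflect[symmetric]) measurable
    also have "\<dots> \<le> ennreal (C * h powr (?q + 2 - \<gamma>))" by (rule bd[OF h])
    finally show "(\<integral>\<^sup>+p. ennreal (increment_kernel H \<gamma> h t t p) \<partial>(lborel \<Otimes>\<^sub>M lborel)) \<le> ennreal (C * h powr (2 * H - \<gamma>))"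
      by simp
  qed (use C in simp)
  with C show ?thesis by (rule that)
qed

lemma nn_integral_quadruple_swap:
  fixes f :: "real \<Rightarrow> real \<Rightarrow> real \<Rightarrow> real \<Rightarrow> ennreal"
  assumes [measurable]: "(\<lambda>x. f (fst x) (fst (snd x)) (fst (snd (snd x))) (snd (snd (snd x)))) \<in> borel_measurable (borel \<Otimes>\<^sub>M borel \<Otimes>\<^sub>M borel \<Otimes>\<^sub>M borel)"
  shows "(\<integral>\<^sup>+t. \<integral>\<^sup>+s. \<integral>\<^sup>+u. \<integral>\<^sup>+v. f t s u v \<partial>lborel \<partial>lborel \<partial>lborel \<partial>lborel) =
    (\<integral>\<^sup>+u. \<integral>\<^sup>+v. \<integral>\<^sup>+t. \<integral>\<^sup>+s. f t s u v \<partial>lborel \<partial>lborel \<partial>lborel \<partial>lborel)"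
proof -
  have [measurable (raw)]: "(\<lambda>x. f (a x) (b x) (c x) (d x)) \<in> borel_measurable M"
    if [measurable]: "a \<in> borel_measurable M" "b \<in> borel_measurable M" "c \<in> borel_measurable M" "d \<in> borel_measurable M"
    for a b c d :: "'z \<Rightarrow> real" and M
    using measurable_compose[OF _ assms, of "\<lambda>x. (a x, b x, c x, d x)" M] by simp
  have "(\<integral>\<^sup>+t. \<integral>\<^sup>+s. \<integral>\<^sup>+u. \<integral>\<^sup>+v. f t s u v \<partial>lborel \<partial>lborel \<partial>lborel \<partial>lborel) =
     (\<integral>\<^sup>+t. \<integral>\<^sup>+u. \<integral>\<^sup>+s. \<integral>\<^sup>+v. f t s u v \<partial>lborel \<partial>lborel \<partial>lborel \<partial>lborel)"
    by (intro nn_integral_cong lborel_pair.Fubini') measurable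
  also have "\<dots> = (\<integral>\<^sup>+u. \<integral>\<^sup>+t. \<integral>\<^sup>+s. \<integral>\<^sup>+v. f t s u v \<partial>lborel \<partial>lborel \<partial>lborel \<partial>lborel)"
    by (intro lborel_pair.Fubini') measurable
  also have "\<dots> = (\<integral>\<^sup>+u. \<integral>\<^sup>+t. \<integral>\<^sup>+v. \<integral>\<^sup>+s. f t s u v \<partial>lborel \<partial>lborel \<partial>lborel \<partial>lborel)"
    by (intro nn_integral_cong lborel_pair.Fubini') measurable
  also have "\<dots> = (\<integral>\<^sup>+u. \<integral>\<^sup>+v. \<integral>\<^sup>+t. \<integral>\<^sup>+s. f t s u v \<partial>lborel \<partial>lborel \<partial>lborel \<partial>lborel)"
    by (intro nn_integral_cong lborel_pair.Fubini') measurable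
  finally show ?thesis .
qed

text \<open>Exchanging the order of integration, one integrates first over the positions \<open>t, s\<close> of the
  two increments for fixed \<open>u, v\<close>. By translation invariance this yields the total mass of the
  weight, independently of \<open>u, v\<close>; the kernel is integrable over the unit square. The power
  \<open>h powr (2 - \<gamma>)\<close> beats the square \<open>h powr (2 H - \<gamma>)\<close> of the normalisation because \<open>H < 1\<close>.\<close>
lemma increment_covariance_bound:
  assumes H: "1 / 2 < H" "H < 1" and \<gamma>: "0 < \<gamma>" "\<gamma> < 2 * H"
  obtains C where "C \<ge> 0" "\<And>h. h > 0 \<Longrightarrow>
    (\<integral>\<^sup>+t. \<integral>\<^sup>+s. ennreal \<bar>LINT p|(lborel \<Otimes>\<^sub>M lborel). increment_kernel H \<gamma> h t s p\<bar>
        * (indicator {0<..<1 - h} t * indicator {0<..<1 - h} s) \<partial>lborel \<partial>lborel)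
       \<le> ennreal (C * h powr (2 - \<gamma>))"
proof -
  let ?q = "2 * H - 2"
  obtain C where C: "C \<ge> 0" and bd: "\<And>h. h > 0 \<Longrightarrow>
     (\<integral>\<^sup>+a. \<integral>\<^sup>+b. ennreal \<bar>incr_weight \<gamma> h a b\<bar> \<partial>lborel \<partial>lborel) \<le> ennreal (C * h powr (2 - \<gamma>))"
    using abs_incr_weight_integral_bound[of \<gamma>] H \<gamma> by auto
  define C' where "C' = 2 / (2 * H - 1) * C"
  have C': "C' \<ge> 0" using C H by (simp add: C'_def)
  have "(\<integral>\<^sup>+t. \<integral>\<^sup>+s. ennreal \<bar>LINT p|(lborel \<Otimes>\<^sub>M lborel). increment_kernel H \<gamma> h t s p\<bar>
        * (indicator {0<..<1 - h} t * indicator {0<..<1 - h} s) \<partial>lborel \<partial>lborel) \<le> ennreal (C' * h powr (2 - \<gamma>))"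
    if h: "h > 0" for h
  proof -
    let ?k = "\<lambda>u v. ennreal (\<bar>u - v\<bar> powr ?q) * indicator {0..1} u * indicator {0..1} v"
    let ?w = "\<lambda>a b. ennreal \<bar>incr_weight \<gamma> h a b\<bar>"
    have "(\<integral>\<^sup>+t. \<integral>\<^sup>+s. ennreal \<bar>LINT p|(lborel \<Otimes>\<^sub>M lborel). increment_kernel H \<gamma> h t s p\<bar>
        * (indicator {0<..<1 - h} t * indicator {0<..<1 - h} s) \<partial>lborel \<partial>lborel)
      \<le> (\<integral>\<^sup>+t. \<integral>\<^sup>+s. \<integral>\<^sup>+u. \<integral>\<^sup>+v. ?k u v * ?w (t + h - u) (s + h - v) \<partial>lborel \<partial>lborel \<partial>lborel \<partial>lborel)"
    proof (intro nn_integral_mono)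
      fix t s :: real
      show "ennreal \<bar>LINT p|(lborel \<Otimes>\<^sub>M lborel). increment_kernel H \<gamma> h t s p\<bar>
        * (indicator {0<..<1 - h} t * indicator {0<..<1 - h} s) \<le> (\<integral>\<^sup>+u. \<integral>\<^sup>+v. ?k u v * ?w (t + h - u) (s + h - v) \<partial>lborel \<partial>lborel)"
      proof (cases "t \<in> {0<..<1 - h} \<and> s \<in> {0<..<1 - h}")
        case True
        have "ennreal \<bar>LINT p|(lborel \<Otimes>\<^sub>M lborel). increment_kernel H \<gamma> h t s p\<bar> \<le>
          (\<integral>\<^sup>+p. ennreal \<bar>increment_kernel H \<gamma> h t s p\<bar> \<partial>(lborel \<Otimes>\<^sub>M lborel))"
        proof (cases "integrable (lborel \<Otimes>\<^sub>M lborel) (increment_kernel H \<gamma> h t s)")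
          case True
          then show ?thesis using integral_norm_bound_ennreal[OF True] by simp
        qed (simp add: not_integrable_integral_eq)
        also have "\<dots> = (\<integral>\<^sup>+u. \<integral>\<^sup>+v. ennreal \<bar>increment_kernel H \<gamma> h t s (u, v)\<bar> \<partial>lborel \<partial>lborel)"
          by (rule lborel.nn_integral_fst[symmetric]) measurable
        also have "\<dots> \<le> (\<integral>\<^sup>+u. \<integral>\<^sup>+v. ?k u v * ?w (t + h - u) (s + h - v) \<partial>lborel \<partial>lborel)"
        proof (intro nn_integral_mono)
          fix u v :: real
          show "ennreal \<bar>increment_kernel H \<gamma> h t s (u, v)\<bar> \<le> ?k u v * ?w (t + h - u) (s + h - v)"
          proof (cases "0 < u \<and> 0 < v \<and> u < t + h \<and> v < s + h")
            case inside: True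
            then have "u \<in> {0..1}" "v \<in> {0..1}" using True by auto
            then show ?thesis using inside by (simp add: increment_kernel_def abs_mult ennreal_mult')
          next
            case False
            then have "increment_kernel H \<gamma> h t s (u, v) = 0"
              using h by (auto simp: increment_kernel_def incr_weight_outside)
            then show ?thesis by simp
          qed
        qed
        finally show ?thesis using True by simp
      qed auto
    qed
    also have "\<dots> = (\<integral>\<^sup>+u. \<integral>\<^sup>+v. \<integral>\<^sup>+t. \<integral>\<^sup>+s. ?k u v * ?w (t + h - u) (s + h - v) \<partial>lborel \<partial>lborel \<partial>lborel \<partial>lborel)"
      by (rule nn_integral_quadruple_swap) measurable
    also have "\<dots> = (\<integral>\<^sup>+u. \<integral>\<^sup>+v. ?k u v * (\<integral>\<^sup>+a. \<integral>\<^sup>+b. ?w a b \<partial>lborel \<partial>lborel) \<partial>lborel \<partial>lborel)"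
    proof (intro nn_integral_cong)
      fix u v :: real
      have "(\<integral>\<^sup>+s. ?w a (s + h - v) \<partial>lborel) = (\<integral>\<^sup>+b. ?w a b \<partial>lborel)" for a
        using nn_integral_diff_shift[of "?w a" "v - h"] by (simp add: algebra_simps)
      then have "(\<integral>\<^sup>+t. \<integral>\<^sup>+s. ?w (t + h - u) (s + h - v) \<partial>lborel \<partial>lborel) = (\<integral>\<^sup>+t. \<integral>\<^sup>+b. ?w (t + h - u) b \<partial>lborel \<partial>lborel)"
        by simp
      also have "\<dots> = (\<integral>\<^sup>+a. \<integral>\<^sup>+b. ?w a b \<partial>lborel \<partial>lborel)"
        using nn_integral_diff_shift[of "\<lambda>a. \<integral>\<^sup>+b. ?w a b \<partial>lborel" "u - h"] by (simp add: algebra_simps)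
      finally show "(\<integral>\<^sup>+t. \<integral>\<^sup>+s. ?k u v * ?w (t + h - u) (s + h - v) \<partial>lborel \<partial>lborel) = ?k u v * (\<integral>\<^sup>+a. \<integral>\<^sup>+b. ?w a b \<partial>lborel \<partial>lborel)"
        by (simp add: nn_integral_cmult)
    qed
    also have "\<dots> = (\<integral>\<^sup>+u. \<integral>\<^sup>+v. ?k u v \<partial>lborel \<partial>lborel) * (\<integral>\<^sup>+a. \<integral>\<^sup>+b. ?w a b \<partial>lborel \<partial>lborel)"
      by (simp add: nn_integral_multc)
    also have "\<dots> \<le> ennreal (2 / (2 * H - 1)) * ennreal (C * h powr (2 - \<gamma>))"
    proof (intro mult_mono bd[OF h])
      have "(\<integral>\<^sup>+u. \<integral>\<^sup>+v. ?k u v \<partial>lborel \<partial>lborel) = (\<integral>\<^sup>+u. (\<integral>\<^sup>+v. ennreal (\<bar>u - v\<bar> powr ?q) * indicator {0..1} v \<partial>lborel) * indicator {0..1} u \<partial>lborel)"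
        by (intro nn_integral_cong, subst nn_integral_multc[symmetric]) (auto simp: mult_ac)
      also have "\<dots> \<le> (\<integral>\<^sup>+u. ennreal (2 / (2 * H - 1)) * indicator {0..1::real} u \<partial>lborel)"
      proof (intro nn_integral_mono)
        fix u :: real
        show "(\<integral>\<^sup>+v. ennreal (\<bar>u - v\<bar> powr ?q) * indicator {0..1} v \<partial>lborel) * indicator {0..1} u \<le> ennreal (2 / (2 * H - 1)) * indicator {0..1} u"
          using nn_integral_riesz_unit[of ?q u] H by (cases "u \<in> {0..1}") auto
      qed
      also have "\<dots> = ennreal (2 / (2 * H - 1))" by (simp add: nn_integral_cmult_indicator)
      finally show "(\<integral>\<^sup>+u. \<integral>\<^sup>+v. ?k u v \<partial>lborel \<partial>lborel) \<le> ennreal (2 / (2 * H - 1))" .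
    qed auto
    also have "\<dots> = ennreal (C' * h powr (2 - \<gamma>))" using C H by (simp add: C'_def ennreal_mult'[symmetric])
    finally show ?thesis .
  qed
  with C' show ?thesis by (rule that)
qed

lemma measurable_increment_kernel_integral:
  "(\<lambda>x. LINT p|(lborel \<Otimes>\<^sub>M lborel). increment_kernel H \<gamma> h (fst x) (snd x) p) \<in> borel_measurable (borel \<Otimes>\<^sub>M borel)"
proof -
  have "sigma_finite_measure ((lborel :: real measure) \<Otimes>\<^sub>M (lborel :: real measure))"
    by (intro sigma_finite_pair_measure lborel.sigma_finite_measure_axioms)
  then show ?thesis
    by (rule sigma_finite_measure.borel_measurable_lebesgue_integral)
      (unfold increment_kernel_def case_prod_beta', measurable)
qed

section \<open>Gaussian variables and exponentials of squares\<close>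

lemma normal_density_exp_tilt:
  assumes "s > 0"
  shows "normal_density 0 s x * exp (l * x) = exp (l\<^sup>2 * s\<^sup>2 / 2) * normal_density (l * s\<^sup>2) s x"
proof -
  have "- (x - 0)\<^sup>2 / (2 * s\<^sup>2) + l * x = l\<^sup>2 * s\<^sup>2 / 2 - (x - l * s\<^sup>2)\<^sup>2 / (2 * s\<^sup>2)"
    using assms by (simp add: field_simps power2_eq_square)
  then show ?thesis
    by (simp add: normal_density_def exp_add[symmetric] mult_ac)
qed

lemma nn_integral_normal_density:
  assumes "s > 0" shows "(\<integral>\<^sup>+x. ennreal (normal_density m s x) \<partial>lborel) = 1"
  using assms by (simp add: nn_integral_eq_integral)

lemma nn_integral_normal_mgf:
  assumes "s > 0"
  shows "(\<integral>\<^sup>+x. ennreal (normal_density 0 s x) * ennreal (exp (l * x)) \<partial>lborel) = ennreal (exp (l\<^sup>2 * s\<^sup>2 / 2))"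
proof -
  have "(\<integral>\<^sup>+x. ennreal (normal_density 0 s x) * ennreal (exp (l * x)) \<partial>lborel) =
     (\<integral>\<^sup>+x. ennreal (exp (l\<^sup>2 * s\<^sup>2 / 2)) * ennreal (normal_density (l * s\<^sup>2) s x) \<partial>lborel)"
    using normal_density_exp_tilt[OF assms]
    by (intro nn_integral_cong) (simp add: ennreal_mult'[symmetric])
  also have "\<dots> = ennreal (exp (l\<^sup>2 * s\<^sup>2 / 2))"
    using assms by (simp add: nn_integral_cmult nn_integral_normal_density)
  finally show ?thesis .
qed

lemma nn_integral_std_normal_exp_square:
  "(\<integral>\<^sup>+x. ennreal (std_normal_density x) * ennreal (exp (x\<^sup>2 / 4)) \<partial>lborel) = ennreal (sqrt 2)"
proof -
  have "std_normal_density x * exp (x\<^sup>2 / 4) = sqrt 2 * normal_density 0 (sqrt 2) x" for x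
  proof -
    have "- x\<^sup>2 / 2 + x\<^sup>2 / 4 = - x\<^sup>2 / 4" by simp
    then show ?thesis
      by (simp add: normal_density_def std_normal_density_def exp_add[symmetric] real_sqrt_mult)
        (simp add: field_simps)
  qed
  then have "(\<integral>\<^sup>+x. ennreal (std_normal_density x) * ennreal (exp (x\<^sup>2 / 4)) \<partial>lborel)
     = (\<integral>\<^sup>+x. ennreal (sqrt 2) * ennreal (normal_density 0 (sqrt 2) x) \<partial>lborel)"
    by (intro nn_integral_cong) (simp add: ennreal_mult'[symmetric])
  then show ?thesis by (simp add: nn_integral_cmult nn_integral_normal_density)
qed

lemma gaussian_rv_centered_cases:
  assumes "prob_space M" "gaussian_rv M X" "(LINT \<omega>|M. X \<omega>) = 0"
  obtains "AE \<omega> in M. X \<omega> = 0"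
    | s where "s > 0" "distributed M lborel X (\<lambda>x. ennreal (normal_density 0 s x))"
proof -
  interpret prob_space M by fact
  from assms(2) consider m where "AE \<omega> in M. X \<omega> = m"
    | m s where "s > 0" "distributed M lborel X (\<lambda>x. ennreal (normal_density m s x))"
    by (auto simp: gaussian_rv_def)
  then show ?thesis
  proof cases
    case (1 m)
    have X[measurable]: "X \<in> borel_measurable M" using assms(2) by (simp add: gaussian_rv_def)
    have "(LINT \<omega>|M. X \<omega>) = (LINT \<omega>|M. m)"
      using 1 by (intro integral_cong_AE) auto
    then have "m = 0" using assms(3) by (simp add: prob_space)
    with 1 that(1) show ?thesis by simp
  next
    case (2 m s)
    have "m = 0" using normal_distributed_expectation[OF 2(1), of X m] 2(2) assms(3) by simp
    with 2 that(2) show ?thesis by simp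
  qed
qed

lemma gaussian_rv_square_integrable:
  assumes "prob_space M" "gaussian_rv M X" "(LINT \<omega>|M. X \<omega>) = 0"
  shows "integrable M (\<lambda>\<omega>. (X \<omega>)\<^sup>2)" "integrable M X"
proof -
  interpret prob_space M by fact
  have X[measurable]: "X \<in> borel_measurable M" using assms(2) by (simp add: gaussian_rv_def)
  show *: "integrable M (\<lambda>\<omega>. (X \<omega>)\<^sup>2)"
  proof (cases rule: gaussian_rv_centered_cases[OF assms])
    case 1 
    then have "integrable M (\<lambda>\<omega>. (X \<omega>)\<^sup>2) \<longleftrightarrow> integrable M (\<lambda>\<omega>. 0::real)"
      by (intro integrable_cong_AE) auto
    then show ?thesis by simp
  next
    case (2 s)
    have "integrable lborel (\<lambda>x. normal_density 0 s x * (x - 0)\<^sup>2)"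
      using 2 by (intro integrable_normal_moment)
    then have "integrable lborel (\<lambda>x. normal_density 0 s x * x\<^sup>2)" by simp
    then show ?thesis using distributed_integrable[OF 2(2), of "\<lambda>x. x\<^sup>2"] by simp
  qed
  show "integrable M X" by (rule square_integrable_imp_integrable[OF X *])
qed

lemma gaussian_rv_mgf:
  assumes "prob_space M" "gaussian_rv M X" "(LINT \<omega>|M. X \<omega>) = 0"
  shows "(\<integral>\<^sup>+\<omega>. ennreal (exp (l * X \<omega>)) \<partial>M) = ennreal (exp (l\<^sup>2 * (LINT \<omega>|M. (X \<omega>)\<^sup>2) / 2))"
proof -
  interpret prob_space M by fact
  have X[measurable]: "X \<in> borel_measurable M" using assms(2) by (simp add: gaussian_rv_def)
  show ?thesis
  proof (cases rule: gaussian_rv_centered_cases[OF assms])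
    case 1 
    have "(\<integral>\<^sup>+\<omega>. ennreal (exp (l * X \<omega>)) \<partial>M) = (\<integral>\<^sup>+\<omega>. 1 \<partial>M)"
      using 1 by (intro nn_integral_cong_AE) auto
    moreover have "(LINT \<omega>|M. (X \<omega>)\<^sup>2) = (LINT \<omega>|M. 0)"
      using 1 by (intro integral_cong_AE) auto
    ultimately show ?thesis by (simp add: emeasure_space_1)
  next
    case (2 s)
    have "(LINT \<omega>|M. (X \<omega>)\<^sup>2) = s\<^sup>2"
      using normal_distributed_variance[OF 2] assms(3) by simp
    moreover have "(\<integral>\<^sup>+\<omega>. ennreal (exp (l * X \<omega>)) \<partial>M) =
      (\<integral>\<^sup>+x. ennreal (normal_density 0 s x) * ennreal (exp (l * x)) \<partial>lborel)"
      by (rule distributed_nn_integral[OF 2(2), symmetric]) simp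
    ultimately show ?thesis using nn_integral_normal_mgf[OF 2(1), of l] by simp
  qed
qed

lemma integrable_mult_of_squares:
  fixes f g :: "'b \<Rightarrow> real"
  assumes [measurable]: "f \<in> borel_measurable N" "g \<in> borel_measurable N"
    and "integrable N (\<lambda>\<omega>. (f \<omega>)\<^sup>2)" "integrable N (\<lambda>\<omega>. (g \<omega>)\<^sup>2)"
  shows "integrable N (\<lambda>\<omega>. f \<omega> * g \<omega>)"
proof (rule Bochner_Integration.integrable_bound)
  show "integrable N (\<lambda>\<omega>. (f \<omega>)\<^sup>2 + (g \<omega>)\<^sup>2)" using assms by simp
  show "AE \<omega> in N. norm (f \<omega> * g \<omega>) \<le> norm ((f \<omega>)\<^sup>2 + (g \<omega>)\<^sup>2)"
  proof (intro AE_I2)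
    fix \<omega>
    have "0 \<le> \<bar>f \<omega>\<bar> * \<bar>g \<omega>\<bar>" by simp
    then have "\<bar>f \<omega>\<bar> * \<bar>g \<omega>\<bar> \<le> (f \<omega>)\<^sup>2 + (g \<omega>)\<^sup>2"
      using sum_squares_bound[of "\<bar>f \<omega>\<bar>" "\<bar>g \<omega>\<bar>"] unfolding power2_abs by linarith
    then show "norm (f \<omega> * g \<omega>) \<le> norm ((f \<omega>)\<^sup>2 + (g \<omega>)\<^sup>2)" by (simp add: abs_mult)
  qed
qed measurable

lemma abs_exp_mult_diff_1_le:
  fixes c x :: real assumes "\<bar>c\<bar> \<le> 1"
  shows "\<bar>exp (c * x) - 1\<bar> \<le> \<bar>c\<bar> * exp \<bar>x\<bar>"
proof -
  have "\<bar>exp (c * x) - 1\<bar> \<le> exp \<bar>c * x\<bar> - 1"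
  proof (cases "c * x \<ge> 0")
    case False
    have "1 - exp (c * x) \<le> exp (- (c * x)) - 1"
      using exp_ge_add_one_self[of "c * x"] exp_ge_add_one_self[of "- (c * x)"] by linarith
    then show ?thesis using False by auto
  qed auto
  also have "exp \<bar>c * x\<bar> = exp ((1 - \<bar>c\<bar>) *\<^sub>R 0 + \<bar>c\<bar> *\<^sub>R \<bar>x\<bar>)" by (simp add: abs_mult)
  also have "\<dots> \<le> (1 - \<bar>c\<bar>) * exp 0 + \<bar>c\<bar> * exp \<bar>x\<bar>"
    using assms by (intro convex_onD[OF exp_convex]) auto
  finally show ?thesis by (simp add: algebra_simps)
qed

text \<open>The exponent on the left is that of the moment generating function of \<open>w X + v Y\<close> at \<open>1 / 2\<close>.
  Comparing with the independent case \<open>c = 0\<close> costs a term linear in \<open>\<bar>c\<bar>\<close>.\<close>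
lemma exp_bilinear_le:
  fixes a b c w v :: real
  assumes "a \<le> 1" "b \<le> 1" "\<bar>c\<bar> \<le> 1"
  shows "exp ((w\<^sup>2 * a + 2 * w * v * c + v\<^sup>2 * b) / 8) \<le>
     exp (w\<^sup>2 * a / 8) * exp (v\<^sup>2 * b / 8) + \<bar>c\<bar> * (exp (w\<^sup>2 / 4) * exp (v\<^sup>2 / 4))"
proof -
  have "exp ((w\<^sup>2 * a + 2 * w * v * c + v\<^sup>2 * b) / 8) = exp (w\<^sup>2 * a / 8) * exp (v\<^sup>2 * b / 8) * exp (c * (w * v / 4))"
    by (simp add: exp_add[symmetric] field_simps)
  also have "\<dots> = exp (w\<^sup>2 * a / 8) * exp (v\<^sup>2 * b / 8) +
     exp (w\<^sup>2 * a / 8) * exp (v\<^sup>2 * b / 8) * (exp (c * (w * v / 4)) - 1)"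
    by (simp add: algebra_simps)
  also have "exp (w\<^sup>2 * a / 8) * exp (v\<^sup>2 * b / 8) * (exp (c * (w * v / 4)) - 1) \<le>
     exp (w\<^sup>2 / 8) * exp (v\<^sup>2 / 8) * (\<bar>c\<bar> * exp (w\<^sup>2 / 8 + v\<^sup>2 / 8))"
  proof (rule order_trans[OF mult_left_mono mult_right_mono])
    have "\<bar>w * v / 4\<bar> \<le> w\<^sup>2 / 8 + v\<^sup>2 / 8"
      using sum_squares_bound[of w v] sum_squares_bound[of w "-v"] by (simp add: abs_if power2_eq_square)
    then have "\<bar>c\<bar> * exp \<bar>w * v / 4\<bar> \<le> \<bar>c\<bar> * exp (w\<^sup>2 / 8 + v\<^sup>2 / 8)"
      by (intro mult_left_mono) auto
    then show "exp (c * (w * v / 4)) - 1 \<le> \<bar>c\<bar> * exp (w\<^sup>2 / 8 + v\<^sup>2 / 8)"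
      using abs_exp_mult_diff_1_le[OF assms(3), of "w * v / 4"] by linarith
    have "w\<^sup>2 * a \<le> w\<^sup>2 * 1" "v\<^sup>2 * b \<le> v\<^sup>2 * 1" using assms by (auto intro!: mult_left_mono simp del: mult_1_right)
    then show "exp (w\<^sup>2 * a / 8) * exp (v\<^sup>2 * b / 8) \<le> exp (w\<^sup>2 / 8) * exp (v\<^sup>2 / 8)"
      by (simp add: exp_add[symmetric])
  qed auto
  also have "exp (w\<^sup>2 / 8) * exp (v\<^sup>2 / 8) * (\<bar>c\<bar> * exp (w\<^sup>2 / 8 + v\<^sup>2 / 8)) = \<bar>c\<bar> * (exp (w\<^sup>2 / 4) * exp (v\<^sup>2 / 4))"
    by (simp add: exp_add[symmetric] field_simps)
  finally show ?thesis by simp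
qed

text \<open>Writing the exponential of a square as a Gaussian average of exponentials of linear functions
  reduces expectations of \<open>exp (X\<^sup>2 / 8)\<close> to moment generating functions. These only involve the
  laws of linear combinations, by which Gaussian processes are defined.\<close>
lemma exp_square_eq_normal_mixture:
  "ennreal (exp (x\<^sup>2 / 8)) = (\<integral>\<^sup>+w. ennreal (std_normal_density w) * ennreal (exp (x / 2 * w)) \<partial>lborel)"
  using nn_integral_normal_mgf[of 1 "x / 2"] by (simp add: power_divide)

text \<open>The covariance of \<open>exp (X\<^sup>2 / 8)\<close> and \<open>exp (Y\<^sup>2 / 8)\<close> is controlled by that of \<open>X\<close> and \<open>Y\<close>. The
  factor \<open>1 / 8\<close> is small enough for the error term to be integrable: it is bounded by the
  square of the Gaussian mean of \<open>exp (w\<^sup>2 / 4)\<close>, and this mean is \<open>sqrt 2\<close>.\<close>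
lemma gaussian_pair_exp_square:
  assumes "prob_space M"
    and gauss: "\<And>w v. gaussian_rv M (\<lambda>\<omega>. w * X \<omega> + v * Y \<omega>)"
    and centered: "(LINT \<omega>|M. X \<omega>) = 0" "(LINT \<omega>|M. Y \<omega>) = 0"
    and var: "(LINT \<omega>|M. (X \<omega>)\<^sup>2) \<le> 1" "(LINT \<omega>|M. (Y \<omega>)\<^sup>2) \<le> 1"
  shows "(\<integral>\<^sup>+\<omega>. ennreal (exp ((X \<omega>)\<^sup>2 / 8)) * ennreal (exp ((Y \<omega>)\<^sup>2 / 8)) \<partial>M) \<le>
      (\<integral>\<^sup>+\<omega>. ennreal (exp ((X \<omega>)\<^sup>2 / 8)) \<partial>M) * (\<integral>\<^sup>+\<omega>. ennreal (exp ((Y \<omega>)\<^sup>2 / 8)) \<partial>M)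
      + 2 * ennreal \<bar>LINT \<omega>|M. X \<omega> * Y \<omega>\<bar>" (is ?cov)
    and "(\<integral>\<^sup>+\<omega>. ennreal (exp ((X \<omega>)\<^sup>2 / 8)) \<partial>M) \<le> ennreal (sqrt 2)" (is ?mean)
proof -
  interpret prob_space M by fact
  define a b c where "a = (LINT \<omega>|M. (X \<omega>)\<^sup>2)" and "b = (LINT \<omega>|M. (Y \<omega>)\<^sup>2)"
    and "c = (LINT \<omega>|M. X \<omega> * Y \<omega>)"
  have gX: "gaussian_rv M X" and gY: "gaussian_rv M Y" using gauss[of 1 0] gauss[of 0 1] by simp_all
  then have [measurable]: "X \<in> borel_measurable M" "Y \<in> borel_measurable M" by (auto simp: gaussian_rv_def)
  have sq: "integrable M (\<lambda>\<omega>. (X \<omega>)\<^sup>2)" "integrable M (\<lambda>\<omega>. (Y \<omega>)\<^sup>2)" "integrable M X" "integrable M Y"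
    using gaussian_rv_square_integrable[OF \<open>prob_space M\<close>] gX gY centered by auto
  have iXY: "integrable M (\<lambda>\<omega>. X \<omega> * Y \<omega>)"
    using sq by (intro integrable_mult_of_squares) auto
  have mean0: "(LINT \<omega>|M. w * X \<omega> + v * Y \<omega>) = 0" for w v
    using sq centered by simp
  have var_lin: "(LINT \<omega>|M. (w * X \<omega> + v * Y \<omega>)\<^sup>2) = w\<^sup>2 * a + 2 * w * v * c + v\<^sup>2 * b" for w v
  proof -
    have "(LINT \<omega>|M. (w * X \<omega> + v * Y \<omega>)\<^sup>2) =
       (LINT \<omega>|M. w\<^sup>2 * (X \<omega>)\<^sup>2 + 2 * w * v * (X \<omega> * Y \<omega>) + v\<^sup>2 * (Y \<omega>)\<^sup>2)"
      by (intro Bochner_Integration.integral_cong) (auto simp: power2_eq_square algebra_simps)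
    also have "\<dots> = w\<^sup>2 * a + 2 * w * v * c + v\<^sup>2 * b"
      using sq iXY by (simp add: a_def b_def c_def)
    finally show ?thesis .
  qed
  have mgf: "(\<integral>\<^sup>+\<omega>. ennreal (exp ((w * X \<omega> + v * Y \<omega>) / 2)) \<partial>M) =
      ennreal (exp ((w\<^sup>2 * a + 2 * w * v * c + v\<^sup>2 * b) / 8))" for w v
    using gaussian_rv_mgf[OF \<open>prob_space M\<close> gauss mean0, of "1/2" w v] by (simp add: var_lin power_divide)
  have ab: "a \<le> 1" "b \<le> 1" using var by (auto simp: a_def b_def)
  have c: "\<bar>c\<bar> \<le> 1"
  proof -
    have "0 \<le> (LINT \<omega>|M. (1 * X \<omega> + 1 * Y \<omega>)\<^sup>2)" "0 \<le> (LINT \<omega>|M. (1 * X \<omega> + (-1) * Y \<omega>)\<^sup>2)"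
      by (auto intro!: integral_nonneg_AE)
    then show ?thesis unfolding var_lin using ab by auto
  qed
  interpret pair_sigma_finite lborel M ..
  interpret L: pair_sigma_finite M "lborel :: real measure" ..
  let ?n = "\<lambda>w. ennreal (std_normal_density w)"
  have one: "(\<integral>\<^sup>+\<omega>. ennreal (exp ((X \<omega>)\<^sup>2 / 8)) \<partial>M) = (\<integral>\<^sup>+w. ?n w * ennreal (exp (w\<^sup>2 * a / 8)) \<partial>lborel)"
    "(\<integral>\<^sup>+\<omega>. ennreal (exp ((Y \<omega>)\<^sup>2 / 8)) \<partial>M) = (\<integral>\<^sup>+w. ?n w * ennreal (exp (w\<^sup>2 * b / 8)) \<partial>lborel)"
  proof -
    have "(\<integral>\<^sup>+\<omega>. ennreal (exp ((X \<omega>)\<^sup>2 / 8)) \<partial>M) = (\<integral>\<^sup>+w. \<integral>\<^sup>+\<omega>. ?n w * ennreal (exp (X \<omega> / 2 * w)) \<partial>M \<partial>lborel)"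
      unfolding exp_square_eq_normal_mixture by (rule Fubini') measurable
    also have "\<dots> = (\<integral>\<^sup>+w. ?n w * ennreal (exp (w\<^sup>2 * a / 8)) \<partial>lborel)"
      using mgf[of _ 0] by (simp add: nn_integral_cmult mult.commute)
    finally show "(\<integral>\<^sup>+\<omega>. ennreal (exp ((X \<omega>)\<^sup>2 / 8)) \<partial>M) = (\<integral>\<^sup>+w. ?n w * ennreal (exp (w\<^sup>2 * a / 8)) \<partial>lborel)" .
    have "(\<integral>\<^sup>+\<omega>. ennreal (exp ((Y \<omega>)\<^sup>2 / 8)) \<partial>M) = (\<integral>\<^sup>+w. \<integral>\<^sup>+\<omega>. ?n w * ennreal (exp (Y \<omega> / 2 * w)) \<partial>M \<partial>lborel)"
      unfolding exp_square_eq_normal_mixture by (rule Fubini') measurable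
    also have "\<dots> = (\<integral>\<^sup>+w. ?n w * ennreal (exp (w\<^sup>2 * b / 8)) \<partial>lborel)"
      using mgf[of 0] by (simp add: nn_integral_cmult mult.commute)
    finally show "(\<integral>\<^sup>+\<omega>. ennreal (exp ((Y \<omega>)\<^sup>2 / 8)) \<partial>M) = (\<integral>\<^sup>+w. ?n w * ennreal (exp (w\<^sup>2 * b / 8)) \<partial>lborel)" .
  qed
  show ?mean
  proof -
    have "w\<^sup>2 * a / 8 \<le> w\<^sup>2 / 4" for w :: real
      using mult_left_mono[OF ab(1) zero_le_power2[of w]] zero_le_power2[of w] by linarith
    then have "(\<integral>\<^sup>+w. ?n w * ennreal (exp (w\<^sup>2 * a / 8)) \<partial>lborel) \<le> (\<integral>\<^sup>+w. ?n w * ennreal (exp (w\<^sup>2 / 4)) \<partial>lborel)"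
      by (intro nn_integral_mono mult_left_mono ennreal_leI) auto
    then show ?thesis by (simp add: one nn_integral_std_normal_exp_square)
  qed
  have "(\<integral>\<^sup>+\<omega>. ennreal (exp ((X \<omega>)\<^sup>2 / 8)) * ennreal (exp ((Y \<omega>)\<^sup>2 / 8)) \<partial>M) =
     (\<integral>\<^sup>+\<omega>. \<integral>\<^sup>+w. ?n w * ennreal (exp (X \<omega> / 2 * w)) * ennreal (exp ((Y \<omega>)\<^sup>2 / 8)) \<partial>lborel \<partial>M)"
  proof (intro nn_integral_cong)
    fix \<omega>
    have "(\<integral>\<^sup>+w. ?n w * ennreal (exp (X \<omega> / 2 * w)) * ennreal (exp ((Y \<omega>)\<^sup>2 / 8)) \<partial>lborel) =
       (\<integral>\<^sup>+w. ?n w * ennreal (exp (X \<omega> / 2 * w)) \<partial>lborel) * ennreal (exp ((Y \<omega>)\<^sup>2 / 8))"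
      by (rule nn_integral_multc) measurable
    then show "ennreal (exp ((X \<omega>)\<^sup>2 / 8)) * ennreal (exp ((Y \<omega>)\<^sup>2 / 8)) =
       (\<integral>\<^sup>+w. ?n w * ennreal (exp (X \<omega> / 2 * w)) * ennreal (exp ((Y \<omega>)\<^sup>2 / 8)) \<partial>lborel)"
      by (simp only: exp_square_eq_normal_mixture[symmetric])
  qed
  also have "\<dots> = (\<integral>\<^sup>+w. \<integral>\<^sup>+\<omega>. ?n w * ennreal (exp (X \<omega> / 2 * w)) * ennreal (exp ((Y \<omega>)\<^sup>2 / 8)) \<partial>M \<partial>lborel)"
    by (rule Fubini') measurable
  also have "\<dots> = (\<integral>\<^sup>+w. \<integral>\<^sup>+\<omega>. \<integral>\<^sup>+v. ?n w * (?n v * ennreal (exp ((w * X \<omega> + v * Y \<omega>) / 2))) \<partial>lborel \<partial>M \<partial>lborel)"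
  proof (intro nn_integral_cong)
    fix w \<omega>
    have "?n w * ennreal (exp (X \<omega> / 2 * w)) * ennreal (exp ((Y \<omega>)\<^sup>2 / 8)) =
      (\<integral>\<^sup>+v. ?n w * ennreal (exp (X \<omega> / 2 * w)) * (?n v * ennreal (exp (Y \<omega> / 2 * v))) \<partial>lborel)"
      by (subst nn_integral_cmult, measurable) (simp only: exp_square_eq_normal_mixture[symmetric])
    also have "\<dots> = (\<integral>\<^sup>+v. ?n w * (?n v * ennreal (exp ((w * X \<omega> + v * Y \<omega>) / 2))) \<partial>lborel)"
      by (intro nn_integral_cong) (simp add: ennreal_mult'[symmetric] exp_add[symmetric] algebra_simps add_divide_distrib)
    finally show "?n w * ennreal (exp (X \<omega> / 2 * w)) * ennreal (exp ((Y \<omega>)\<^sup>2 / 8)) = \<dots>" .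
  qed
  also have "\<dots> = (\<integral>\<^sup>+w. \<integral>\<^sup>+v. \<integral>\<^sup>+\<omega>. ?n w * (?n v * ennreal (exp ((w * X \<omega> + v * Y \<omega>) / 2))) \<partial>M \<partial>lborel \<partial>lborel)"
    by (intro nn_integral_cong Fubini') measurable
  also have "\<dots> = (\<integral>\<^sup>+w. \<integral>\<^sup>+v. ?n w * (?n v * ennreal (exp ((w\<^sup>2 * a + 2 * w * v * c + v\<^sup>2 * b) / 8))) \<partial>lborel \<partial>lborel)"
    by (simp add: nn_integral_cmult mgf)
  also have "\<dots> \<le> (\<integral>\<^sup>+w. \<integral>\<^sup>+v. (?n w * ennreal (exp (w\<^sup>2 * a / 8))) * (?n v * ennreal (exp (v\<^sup>2 * b / 8))) +
     ennreal \<bar>c\<bar> * ((?n w * ennreal (exp (w\<^sup>2 / 4))) * (?n v * ennreal (exp (v\<^sup>2 / 4)))) \<partial>lborel \<partial>lborel)"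
  proof (intro nn_integral_mono)
    fix w v :: real
    have "?n w * (?n v * ennreal (exp ((w\<^sup>2 * a + 2 * w * v * c + v\<^sup>2 * b) / 8))) \<le>
       ?n w * (?n v * ennreal (exp (w\<^sup>2 * a / 8) * exp (v\<^sup>2 * b / 8) + \<bar>c\<bar> * (exp (w\<^sup>2 / 4) * exp (v\<^sup>2 / 4))))"
      using exp_bilinear_le[OF ab c] by (intro mult_left_mono ennreal_leI) auto
    also have "\<dots> = (?n w * ennreal (exp (w\<^sup>2 * a / 8))) * (?n v * ennreal (exp (v\<^sup>2 * b / 8))) +
       ennreal \<bar>c\<bar> * ((?n w * ennreal (exp (w\<^sup>2 / 4))) * (?n v * ennreal (exp (v\<^sup>2 / 4))))"
      by (simp add: ennreal_plus ennreal_mult distrib_left mult_ac)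
    finally show "?n w * (?n v * ennreal (exp ((w\<^sup>2 * a + 2 * w * v * c + v\<^sup>2 * b) / 8))) \<le> \<dots>" .
  qed
  also have "\<dots> = (\<integral>\<^sup>+w. ?n w * ennreal (exp (w\<^sup>2 * a / 8)) \<partial>lborel) * (\<integral>\<^sup>+v. ?n v * ennreal (exp (v\<^sup>2 * b / 8)) \<partial>lborel) +
     ennreal \<bar>c\<bar> * ((\<integral>\<^sup>+w. ?n w * ennreal (exp (w\<^sup>2 / 4)) \<partial>lborel) * (\<integral>\<^sup>+v. ?n v * ennreal (exp (v\<^sup>2 / 4)) \<partial>lborel))"
    by (simp add: nn_integral_add nn_integral_cmult nn_integral_multc)
  also have "\<dots> = (\<integral>\<^sup>+\<omega>. ennreal (exp ((X \<omega>)\<^sup>2 / 8)) \<partial>M) * (\<integral>\<^sup>+\<omega>. ennreal (exp ((Y \<omega>)\<^sup>2 / 8)) \<partial>M)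
      + 2 * ennreal \<bar>c\<bar>"
    unfolding one nn_integral_std_normal_exp_square
    by (simp add: ennreal_mult'[symmetric] mult.commute)
  finally show ?cov by (simp add: c_def)
qed

text \<open>The points \<open>t i\<close> may coincide, as happens for the end points of two increments.\<close>
lemma centered_gaussian_process_linear_combination:
  assumes "centered_gaussian_process M T X" "finite I" "\<And>i. i \<in> I \<Longrightarrow> t i \<in> T"
  shows "gaussian_rv M (\<lambda>\<omega>. \<Sum>i\<in>I. a i * X (t i) \<omega>)"
proof -
  have "(\<Sum>i\<in>I. a i * X (t i) \<omega>) = (\<Sum>s\<in>t ` I. (\<Sum>i\<in>{i\<in>I. t i = s}. a i) * X s \<omega>)" for \<omega>
  proof -
    have "(\<Sum>i\<in>I. a i * X (t i) \<omega>) = (\<Sum>s\<in>t ` I. \<Sum>i\<in>{i\<in>I. t i = s}. a i * X (t i) \<omega>)"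
      by (rule sum.image_gen[OF assms(2)])
    also have "\<dots> = (\<Sum>s\<in>t ` I. (\<Sum>i\<in>{i\<in>I. t i = s}. a i) * X s \<omega>)"
      by (intro sum.cong refl) (simp add: sum_distrib_right)
    finally show ?thesis .
  qed
  moreover have "gaussian_rv M (\<lambda>\<omega>. \<Sum>s\<in>t ` I. (\<Sum>i\<in>{i\<in>I. t i = s}. a i) * X s \<omega>)"
    using assms unfolding centered_gaussian_process_def
    by (elim conjE allE[of _ "t ` I"] allE[of _ "\<lambda>s. \<Sum>i\<in>{i\<in>I. t i = s}. a i"]) auto
  ultimately show ?thesis by simp
qed

lemma centered_gaussian_process_square_integrable:
  assumes "prob_space N" "centered_gaussian_process N T X" "t \<in> T"
  shows "X t \<in> borel_measurable N" "integrable N (\<lambda>\<omega>. (X t \<omega>)\<^sup>2)" "integrable N (X t)"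
proof -
  have g: "gaussian_rv N (X t)"
    using centered_gaussian_process_linear_combination[OF assms(2), of "{t}" "\<lambda>t. t" "\<lambda>_. 1"] assms by simp
  moreover have "(LINT \<omega>|N. X t \<omega>) = 0" using assms by (simp add: centered_gaussian_process_def)
  ultimately show "X t \<in> borel_measurable N" "integrable N (\<lambda>\<omega>. (X t \<omega>)\<^sup>2)" "integrable N (X t)"
    using gaussian_rv_square_integrable[OF assms(1) g] by (auto simp: gaussian_rv_def)
qed

lemma gaussian_rv_cong_AE:
  assumes X: "gaussian_rv M X" and [measurable]: "Y \<in> borel_measurable M" and eq: "AE \<omega> in M. X \<omega> = Y \<omega>"
  shows "gaussian_rv M Y"
proof -
  have [measurable]: "X \<in> borel_measurable M" using X by (simp add: gaussian_rv_def)
  have const: "AE \<omega> in M. Y \<omega> = m" if "AE \<omega> in M. X \<omega> = m" for m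
    using that eq by eventually_elim simp
  have "distr M lborel X = distr M lborel Y"
    using eq by (intro distr_cong_AE) auto
  then have "distributed M lborel Y f" if "distributed M lborel X f" for f :: "real \<Rightarrow> ennreal"
    using that by (simp add: distributed_def)
  then show ?thesis using X const unfolding gaussian_rv_def by (blast intro: assms(2))
qed

section \<open>The exponential functional of a Gaussian process\<close>

text \<open>The second moment of \<open>\<Phi>\<close> is a double integral of \<open>E (exp (X\<^sub>s\<^sup>2 / 8) exp (X\<^sub>t\<^sup>2 / 8))\<close>, so the
  variance of \<open>\<Phi>\<close> is at most twice the integral of the absolute covariances.\<close>
lemma gaussian_exp_square_functional_moments:
  fixes X :: "real \<Rightarrow> 'a \<Rightarrow> real"
  assumes M: "prob_space M"
    and Xm[measurable]: "case_prod X \<in> borel_measurable (borel \<Otimes>\<^sub>M M)"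
    and J[measurable]: "J \<in> sets borel" "emeasure lborel J \<le> 1"
    and gauss: "\<And>s t w v. s \<in> J \<Longrightarrow> t \<in> J \<Longrightarrow> gaussian_rv M (\<lambda>\<omega>. w * X s \<omega> + v * X t \<omega>)"
    and centered: "\<And>s. s \<in> J \<Longrightarrow> (LINT \<omega>|M. X s \<omega>) = 0"
    and var: "\<And>s. s \<in> J \<Longrightarrow> (LINT \<omega>|M. (X s \<omega>)\<^sup>2) \<le> 1"
    and cov: "(\<integral>\<^sup>+s. \<integral>\<^sup>+t. ennreal \<bar>LINT \<omega>|M. X s \<omega> * X t \<omega>\<bar> * (indicator J s * indicator J t) \<partial>lborel \<partial>lborel) \<le> ennreal b"
    and b: "b \<ge> 0"
  defines "\<Phi> \<equiv> \<lambda>\<omega>. \<integral>\<^sup>+s. ennreal (exp ((X s \<omega>)\<^sup>2 / 8)) * indicator J s \<partial>lborel"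
  shows "\<Phi> \<in> borel_measurable M" "(\<integral>\<^sup>+\<omega>. \<Phi> \<omega> \<partial>M) \<le> ennreal (sqrt 2)"
    "(\<integral>\<^sup>+\<omega>. (\<Phi> \<omega>)\<^sup>2 \<partial>M) \<le> (\<integral>\<^sup>+\<omega>. \<Phi> \<omega> \<partial>M)\<^sup>2 + ennreal (2 * b)"
proof -
  interpret prob_space M by fact
  interpret pair_sigma_finite lborel M ..
  let ?e = "\<lambda>s \<omega>. ennreal (exp ((X s \<omega>)\<^sup>2 / 8))"
  let ?I = "\<lambda>s. indicator J s :: ennreal"
  define E where "E s = (\<integral>\<^sup>+\<omega>. ?e s \<omega> \<partial>M)" for s
  have [measurable]: "E \<in> borel_measurable borel"
  proof -
    have "(\<lambda>s. \<integral>\<^sup>+\<omega>. ?e s \<omega> \<partial>M) \<in> borel_measurable borel" by measurable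
    then show ?thesis by (simp add: E_def[abs_def])
  qed
  show [measurable]: "\<Phi> \<in> borel_measurable M" unfolding \<Phi>_def by measurable
  have mean: "(\<integral>\<^sup>+\<omega>. \<Phi> \<omega> \<partial>M) = (\<integral>\<^sup>+s. E s * ?I s \<partial>lborel)"
  proof -
    have "(\<integral>\<^sup>+\<omega>. \<Phi> \<omega> \<partial>M) = (\<integral>\<^sup>+s. \<integral>\<^sup>+\<omega>. ?e s \<omega> * ?I s \<partial>M \<partial>lborel)"
      unfolding \<Phi>_def by (rule Fubini') measurable
    then show ?thesis by (simp add: nn_integral_multc E_def)
  qed
  note pair = gaussian_pair_exp_square[OF M gauss centered centered var var]
  have "(\<integral>\<^sup>+s. E s * ?I s \<partial>lborel) \<le> (\<integral>\<^sup>+s. ennreal (sqrt 2) * ?I s \<partial>lborel)"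
    using pair(2) by (intro nn_integral_mono) (auto simp: indicator_def E_def)
  also have "\<dots> = ennreal (sqrt 2) * emeasure lborel J" by (simp add: nn_integral_cmult_indicator)
  also have "\<dots> \<le> ennreal (sqrt 2) * 1" using J(2) by (rule mult_left_mono) simp
  finally show "(\<integral>\<^sup>+\<omega>. \<Phi> \<omega> \<partial>M) \<le> ennreal (sqrt 2)" unfolding mean by simp
  define c where "c s t = ennreal \<bar>LINT \<omega>|M. X s \<omega> * X t \<omega>\<bar> * (?I s * ?I t)" for s t
  have cm[measurable]: "(\<lambda>x. c (fst x) (snd x)) \<in> borel_measurable (borel \<Otimes>\<^sub>M borel)"
    unfolding c_def by measurable
  have "(\<integral>\<^sup>+\<omega>. (\<Phi> \<omega>)\<^sup>2 \<partial>M) = (\<integral>\<^sup>+\<omega>. \<integral>\<^sup>+s. \<integral>\<^sup>+t. (?e s \<omega> * ?e t \<omega>) * (?I s * ?I t) \<partial>lborel \<partial>lborel \<partial>M)"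
  proof (intro nn_integral_cong)
    fix \<omega> assume [measurable]: "\<omega> \<in> space M"
    have "(\<Phi> \<omega>)\<^sup>2 = (\<integral>\<^sup>+s. (?e s \<omega> * ?I s) * (\<integral>\<^sup>+t. ?e t \<omega> * ?I t \<partial>lborel) \<partial>lborel)"
      unfolding \<Phi>_def power2_eq_square by (rule nn_integral_multc[symmetric]) measurable
    also have "\<dots> = (\<integral>\<^sup>+s. \<integral>\<^sup>+t. (?e s \<omega> * ?I s) * (?e t \<omega> * ?I t) \<partial>lborel \<partial>lborel)"
      by (intro nn_integral_cong nn_integral_cmult[symmetric]) measurable
    finally show "(\<Phi> \<omega>)\<^sup>2 = (\<integral>\<^sup>+s. \<integral>\<^sup>+t. (?e s \<omega> * ?e t \<omega>) * (?I s * ?I t) \<partial>lborel \<partial>lborel)"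
      by (simp add: mult_ac)
  qed
  also have "\<dots> = (\<integral>\<^sup>+s. \<integral>\<^sup>+\<omega>. \<integral>\<^sup>+t. (?e s \<omega> * ?e t \<omega>) * (?I s * ?I t) \<partial>lborel \<partial>M \<partial>lborel)"
    by (rule Fubini') measurable
  also have "\<dots> = (\<integral>\<^sup>+s. \<integral>\<^sup>+t. \<integral>\<^sup>+\<omega>. (?e s \<omega> * ?e t \<omega>) * (?I s * ?I t) \<partial>M \<partial>lborel \<partial>lborel)"
    by (intro nn_integral_cong Fubini') measurable
  also have "\<dots> \<le> (\<integral>\<^sup>+s. \<integral>\<^sup>+t. (E s * ?I s) * (E t * ?I t) + 2 * c s t \<partial>lborel \<partial>lborel)"
  proof (intro nn_integral_mono)
    fix s t
    show "(\<integral>\<^sup>+\<omega>. (?e s \<omega> * ?e t \<omega>) * (?I s * ?I t) \<partial>M) \<le> (E s * ?I s) * (E t * ?I t) + 2 * c s t"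
    proof (cases "s \<in> J \<and> t \<in> J")
      case True
      then show ?thesis using pair(1)[of s t] by (simp add: E_def c_def)
    qed auto
  qed
  also have "\<dots> = (\<integral>\<^sup>+s. \<integral>\<^sup>+t. (E s * ?I s) * (E t * ?I t) \<partial>lborel \<partial>lborel) + (\<integral>\<^sup>+s. \<integral>\<^sup>+t. 2 * c s t \<partial>lborel \<partial>lborel)"
    by (rule nn_integral_double_add) measurable
  also have "(\<integral>\<^sup>+s. \<integral>\<^sup>+t. (E s * ?I s) * (E t * ?I t) \<partial>lborel \<partial>lborel) = (\<integral>\<^sup>+\<omega>. \<Phi> \<omega> \<partial>M)\<^sup>2"
    unfolding mean by (simp add: nn_integral_cmult nn_integral_multc power2_eq_square)
  also have "(\<integral>\<^sup>+s. \<integral>\<^sup>+t. 2 * c s t \<partial>lborel \<partial>lborel) = 2 * (\<integral>\<^sup>+s. \<integral>\<^sup>+t. c s t \<partial>lborel \<partial>lborel)"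
  proof -
    have "c s \<in> borel_measurable borel" for s
      using measurable_compose[OF measurable_Pair1' cm, of s] by simp
    moreover have "(\<lambda>s. \<integral>\<^sup>+t. c s t \<partial>lborel) \<in> borel_measurable borel"
      using lborel.borel_measurable_nn_integral[of c borel] cm by (simp add: case_prod_beta')
    ultimately show ?thesis by (simp add: nn_integral_cmult)
  qed
  also have "\<dots> \<le> 2 * ennreal b" using cov unfolding c_def by (intro mult_left_mono) auto
  also have "2 * ennreal b = ennreal (2 * b)" using b by (simp add: ennreal_mult)
  finally show "(\<integral>\<^sup>+\<omega>. (\<Phi> \<omega>)\<^sup>2 \<partial>M) \<le> (\<integral>\<^sup>+\<omega>. \<Phi> \<omega> \<partial>M)\<^sup>2 + ennreal (2 * b)" by (simp add: add_left_mono)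
qed

text \<open>If the variances are summable, then the sum of the squared deviations from the mean has a
  finite expectation, hence is almost surely finite, and it dominates each single deviation.\<close>
lemma AE_bounded_of_summable_variance:
  fixes \<Phi> :: "nat \<Rightarrow> 'a \<Rightarrow> ennreal"
  assumes M: "prob_space M" and [measurable]: "\<And>n. \<Phi> n \<in> borel_measurable M"
    and mean: "\<And>n. (\<integral>\<^sup>+\<omega>. \<Phi> n \<omega> \<partial>M) \<le> ennreal a" and a: "a \<ge> 0"
    and second: "\<And>n. (\<integral>\<^sup>+\<omega>. (\<Phi> n \<omega>)\<^sup>2 \<partial>M) \<le> (\<integral>\<^sup>+\<omega>. \<Phi> n \<omega> \<partial>M)\<^sup>2 + ennreal (b n)"
    and b: "summable b" "\<And>n. b n \<ge> 0"
  shows "AE \<omega> in M. \<exists>K. \<forall>n. \<Phi> n \<omega> \<le> ennreal K"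
proof -
  interpret prob_space M by fact
  define \<phi> where "\<phi> n \<omega> = enn2real (\<Phi> n \<omega>)" for n \<omega>
  have [measurable]: "\<phi> n \<in> borel_measurable M" for n unfolding \<phi>_def[abs_def] by measurable
  have fin: "AE \<omega> in M. \<Phi> n \<omega> \<noteq> \<infinity>" for n
    using mean[of n] by (intro nn_integral_noteq_infinite) (auto simp: top_unique)
  have AE_eq: "AE \<omega> in M. \<Phi> n \<omega> = ennreal (\<phi> n \<omega>)" for n
    by (rule eventually_mono[OF fin[of n]]) (auto simp: \<phi>_def less_top)
  have nn: "\<phi> n \<omega> \<ge> 0" for n \<omega> by (simp add: \<phi>_def)
  define m where "m n = expectation (\<phi> n)" for n
  have mean_eq: "(\<integral>\<^sup>+\<omega>. \<Phi> n \<omega> \<partial>M) = (\<integral>\<^sup>+\<omega>. ennreal (\<phi> n \<omega>) \<partial>M)" for n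
    using AE_eq by (rule nn_integral_cong_AE)
  have "(\<integral>\<^sup>+\<omega>. ennreal (\<phi> n \<omega>) \<partial>M) < \<infinity>" for n
    using mean[of n] unfolding mean_eq by (rule le_less_trans) simp
  then have int: "integrable M (\<phi> n)" for n using nn by (intro integrableI_nonneg) auto
  have m: "(\<integral>\<^sup>+\<omega>. \<Phi> n \<omega> \<partial>M) = ennreal (m n)" "0 \<le> m n" "m n \<le> a" for n
  proof -
    show eq: "(\<integral>\<^sup>+\<omega>. \<Phi> n \<omega> \<partial>M) = ennreal (m n)"
      unfolding mean_eq m_def using int nn by (intro nn_integral_eq_integral) auto
    show "0 \<le> m n" unfolding m_def using nn by (intro Bochner_Integration.integral_nonneg) auto
    show "m n \<le> a" using mean[of n] a unfolding eq by (simp add: ennreal_le_iff)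
  qed
  have sec: "(\<integral>\<^sup>+\<omega>. ennreal ((\<phi> n \<omega>)\<^sup>2) \<partial>M) \<le> ennreal ((m n)\<^sup>2 + b n)" for n
  proof -
    have "(\<integral>\<^sup>+\<omega>. ennreal ((\<phi> n \<omega>)\<^sup>2) \<partial>M) = (\<integral>\<^sup>+\<omega>. (\<Phi> n \<omega>)\<^sup>2 \<partial>M)"
      by (rule nn_integral_cong_AE, rule eventually_mono[OF AE_eq[of n]]) (simp add: nn ennreal_power)
    also have "\<dots> \<le> ennreal (m n)^2 + ennreal (b n)" using second[of n] unfolding m(1) .
    also have "\<dots> = ennreal ((m n)\<^sup>2 + b n)" using m(2)[of n] b(2)[of n] by (simp add: ennreal_power ennreal_plus)
    finally show ?thesis .
  qed
  have int2: "integrable M (\<lambda>\<omega>. (\<phi> n \<omega>)\<^sup>2)" for n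
    using sec[of n] by (intro integrableI_nonneg) (auto intro: le_less_trans)
  have var: "(\<integral>\<^sup>+\<omega>. ennreal ((\<phi> n \<omega> - m n)\<^sup>2) \<partial>M) \<le> ennreal (b n)" for n
  proof -
    have iv: "integrable M (\<lambda>\<omega>. (\<phi> n \<omega> - m n)\<^sup>2)" using int int2 by (simp add: power2_diff)
    have "expectation (\<lambda>\<omega>. (\<phi> n \<omega>)\<^sup>2) \<le> (m n)\<^sup>2 + b n"
      by (rule integral_real_bounded) (use sec[of n] b(2)[of n] in auto)
    then have "variance (\<phi> n) \<le> b n" using variance_eq[OF int int2] by (simp add: m_def)
    then show ?thesis using iv by (subst nn_integral_eq_integral) (auto simp: m_def intro: ennreal_leI)
  qed
  have "(\<integral>\<^sup>+\<omega>. (\<Sum>n. ennreal ((\<phi> n \<omega> - m n)\<^sup>2)) \<partial>M) = (\<Sum>n. \<integral>\<^sup>+\<omega>. ennreal ((\<phi> n \<omega> - m n)\<^sup>2) \<partial>M)"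
    by (intro nn_integral_suminf) measurable
  also have "\<dots> \<le> (\<Sum>n. ennreal (b n))" by (intro suminf_le var) auto
  also have "\<dots> = ennreal (\<Sum>n. b n)" using b by (intro suminf_ennreal2)
  also have "\<dots> < \<infinity>" by simp
  finally have "AE \<omega> in M. (\<Sum>n. ennreal ((\<phi> n \<omega> - m n)\<^sup>2)) \<noteq> \<infinity>"
    by (intro nn_integral_noteq_infinite) auto
  moreover have "AE \<omega> in M. \<forall>n. \<Phi> n \<omega> = ennreal (\<phi> n \<omega>)" using AE_eq by (simp add: AE_all_countable)
  ultimately show ?thesis
  proof eventually_elim
    case (elim \<omega>)
    then have s: "summable (\<lambda>n. (\<phi> n \<omega> - m n)\<^sup>2)" by (intro summable_suminf_not_top) auto
    have "\<phi> n \<omega> \<le> a + (1 + (\<Sum>n. (\<phi> n \<omega> - m n)\<^sup>2))" for n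
    proof -
      have "(\<phi> n \<omega> - m n)\<^sup>2 \<le> (\<Sum>n. (\<phi> n \<omega> - m n)\<^sup>2)"
        using sum_le_suminf[OF s, of "{n}"] by simp
      moreover have "\<phi> n \<omega> - m n \<le> 1 + (\<phi> n \<omega> - m n)\<^sup>2"
      proof -
        have "0 \<le> (\<phi> n \<omega> - m n - 1/2)\<^sup>2" by simp
        then show ?thesis by (simp add: power2_eq_square algebra_simps)
      qed
      ultimately show ?thesis using m(3)[of n] by linarith
    qed
    then show ?case using elim by (auto intro!: exI[of _ "a + (1 + (\<Sum>n. (\<phi> n \<omega> - m n)\<^sup>2))"] ennreal_leI)
  qed
qed

section \<open>From dyadic shifts to the Besov-Orlicz space\<close>

lemma nn_integral_lebesgue_on_interval:
  fixes g :: "real \<Rightarrow> ennreal"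
  assumes [measurable]: "g \<in> borel_measurable borel" "J \<in> sets borel"
  shows "(\<integral>\<^sup>+x. g x \<partial>lebesgue_on J) = (\<integral>\<^sup>+x. g x * indicator J x \<partial>lborel)"
  by (simp add: nn_integral_restrict_space nn_integral_completion)

lemma powr_le_exp_square:
  fixes y p :: real
  assumes "p > 0"
  shows "\<bar>y\<bar> powr p \<le> p powr (p / 2) * exp (y\<^sup>2)"
proof (cases "y = 0")
  case False
  define z where "z = y\<^sup>2 / p"
  have z: "z > 0" using False assms by (simp add: z_def)
  have "ln z \<le> z - 1" using z by (rule ln_le_minus_one)
  then have "p / 2 * ln z \<le> p / 2 * (z - 1)" using assms by (intro mult_left_mono) auto
  also have "\<dots> \<le> y\<^sup>2" using assms by (simp add: z_def field_simps)
  finally have "z powr (p / 2) \<le> exp (y\<^sup>2)" using z by (simp add: powr_def)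
  then have "p powr (p / 2) * z powr (p / 2) \<le> p powr (p / 2) * exp (y\<^sup>2)"
    by (intro mult_left_mono) auto
  also have "p powr (p / 2) * z powr (p / 2) = (y\<^sup>2) powr (p / 2)"
    using assms z by (simp add: powr_mult[symmetric] z_def)
  also have "\<dots> = \<bar>y\<bar> powr p"
  proof -
    have "ln (y\<^sup>2) = 2 * ln \<bar>y\<bar>" using False ln_realpow[of "\<bar>y\<bar>" 2] by simp
    then show ?thesis using False by (simp add: powr_def)
  qed
  finally show ?thesis .
qed (use assms in simp)

text \<open>The growth \<open>p powr (1 / 2)\<close> of the \<open>L\<^sup>p\<close> norms is that of \<open>p powr (p / 2)\<close> in
  \<open>powr_le_exp_square\<close>, after taking the \<open>p\<close>-th root.\<close>
lemma orlicz_norm_le_of_exp_square: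
  fixes f :: "real \<Rightarrow> real"
  assumes [measurable]: "f \<in> borel_measurable borel" "J \<in> sets borel"
    and "L > 0" "K \<ge> 1"
    and bd: "(\<integral>\<^sup>+x. ennreal (exp ((f x / L)\<^sup>2 / 8)) * indicator J x \<partial>lborel) \<le> ennreal K"
  shows "orlicz_norm J f \<le> ennreal (sqrt 8 * L * K)"
  unfolding orlicz_norm_def
proof (rule SUP_least)
  fix p :: real assume "p \<in> {1..}"
  then have p: "p \<ge> 1" by simp
  define c where "c = sqrt 8 * L"
  have c: "c > 0" using assms by (simp add: c_def)
  have pw: "\<bar>f x\<bar> powr p \<le> c powr p * p powr (p / 2) * exp ((f x / L)\<^sup>2 / 8)" for x
  proof -
    have "\<bar>f x / c\<bar> powr p \<le> p powr (p / 2) * exp ((f x / c)\<^sup>2)"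
      using p by (intro powr_le_exp_square) auto
    also have "(f x / c)\<^sup>2 = (f x / L)\<^sup>2 / 8"
      by (simp add: c_def power_divide power_mult_distrib)
    finally have "c powr p * \<bar>f x / c\<bar> powr p \<le> c powr p * (p powr (p / 2) * exp ((f x / L)\<^sup>2 / 8))"
      by (intro mult_left_mono) auto
    moreover have "c powr p * \<bar>f x / c\<bar> powr p = \<bar>f x\<bar> powr p"
      using c by (simp add: powr_mult[symmetric] abs_divide)
    ultimately show ?thesis by (simp add: mult.assoc)
  qed
  let ?A = "\<integral>\<^sup>+x. ennreal (\<bar>f x\<bar> powr p) \<partial>lebesgue_on J"
  have "?A = (\<integral>\<^sup>+x. ennreal (\<bar>f x\<bar> powr p) * indicator J x \<partial>lborel)"
    by (rule nn_integral_lebesgue_on_interval) measurable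
  also have "\<dots> \<le> (\<integral>\<^sup>+x. ennreal (c powr p * p powr (p / 2)) * (ennreal (exp ((f x / L)\<^sup>2 / 8)) * indicator J x) \<partial>lborel)"
    using pw by (intro nn_integral_mono) (auto simp: indicator_def ennreal_mult'[symmetric] intro!: ennreal_leI)
  also have "\<dots> = ennreal (c powr p * p powr (p / 2)) * (\<integral>\<^sup>+x. ennreal (exp ((f x / L)\<^sup>2 / 8)) * indicator J x \<partial>lborel)"
    by (intro nn_integral_cmult) measurable
  also have "\<dots> \<le> ennreal (c powr p * p powr (p / 2)) * ennreal K"
    by (intro mult_left_mono bd) auto
  also have "\<dots> = ennreal (c powr p * p powr (p / 2) * K)" by (simp add: ennreal_mult'[symmetric])
  finally have A: "?A \<le> ennreal (c powr p * p powr (p / 2) * K)" .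
  then have fin: "?A \<noteq> \<infinity>" using neq_top_trans by force
  have "enn2real ?A \<le> c powr p * p powr (p / 2) * K"
    using A \<open>K \<ge> 1\<close> by (intro enn2real_leI) auto
  then have "enn2real ?A powr (1 / p) \<le> (c powr p * p powr (p / 2) * K) powr (1 / p)"
    using p by (intro powr_mono2) auto
  also have "\<dots> = c * p powr (1 / 2) * K powr (1 / p)"
    using p c \<open>K \<ge> 1\<close> by (simp add: powr_mult powr_powr)
  also have "K powr (1 / p) \<le> K powr 1" using p \<open>K \<ge> 1\<close> by (intro powr_mono) auto
  finally have "enn2real ?A powr (1 / p) \<le> c * p powr (1 / 2) * K"
    using c \<open>K \<ge> 1\<close> by (simp add: mult_left_mono)
  then have "p powr (- 1 / 2) * enn2real ?A powr (1 / p) \<le> p powr (- 1 / 2) * (c * p powr (1 / 2) * K)"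
    by (intro mult_left_mono) auto
  also have "\<dots> = c * K" using p by (simp add: powr_minus field_simps)
  finally show "ennreal (p powr (- 1 / 2)) * Lp_norm p J f \<le> ennreal (sqrt 8 * L * K)"
    using fin by (simp add: Lp_norm_def c_def ennreal_mult'[symmetric] ennreal_leI)
qed

text \<open>Jensen's inequality for \<open>x \<mapsto> exp (x\<^sup>2 / 8)\<close>, with the missing mass placed at 0. It plays the
  part of Minkowski's inequality for the Orlicz norm when several increments are added.\<close>
lemma exp_square_subconvex:
  fixes w x :: "'i \<Rightarrow> real"
  assumes "finite I" "\<And>i. i \<in> I \<Longrightarrow> w i \<ge> 0" "sum w I \<le> 1"
  shows "exp ((\<Sum>i\<in>I. w i * x i)\<^sup>2 / 8) \<le> (\<Sum>i\<in>I. w i * exp ((x i)\<^sup>2 / 8)) + (1 - sum w I)"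
proof -
  define \<mu> where "\<mu> = (\<Sum>i\<in>I. w i * x i)"
  define m where "m = (\<Sum>i\<in>I. w i * ((x i)\<^sup>2 / 8))"
  have "0 \<le> (\<Sum>i\<in>I. w i * (x i - \<mu>)\<^sup>2)" using assms by (intro sum_nonneg) auto
  also have "\<dots> = (\<Sum>i\<in>I. w i * (x i)\<^sup>2 - 2 * \<mu> * (w i * x i) + \<mu>\<^sup>2 * w i)"
    by (intro sum.cong refl) (simp add: power2_eq_square algebra_simps)
  also have "\<dots> = (\<Sum>i\<in>I. w i * (x i)\<^sup>2) - 2 * \<mu> * \<mu> + \<mu>\<^sup>2 * sum w I"
    by (simp only: sum.distrib sum_subtractf sum_distrib_left[symmetric] \<mu>_def[symmetric])
  also have "\<dots> \<le> (\<Sum>i\<in>I. w i * (x i)\<^sup>2) - 2 * \<mu> * \<mu> + \<mu>\<^sup>2 * 1"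
    using assms by (intro add_mono mult_left_mono) auto
  finally have "\<mu>\<^sup>2 \<le> (\<Sum>i\<in>I. w i * (x i)\<^sup>2)" by (simp add: power2_eq_square)
  moreover have "m = (\<Sum>i\<in>I. w i * (x i)\<^sup>2) / 8"
    by (simp only: m_def sum_divide_distrib times_divide_eq_right)
  ultimately have "\<mu>\<^sup>2 / 8 \<le> m" by simp
  then have "exp (\<mu>\<^sup>2 / 8) \<le> exp m" by simp
  also have "exp m = (\<Sum>i\<in>I. w i * (exp m * (1 + (x i)\<^sup>2 / 8 - m))) + (1 - sum w I) * (exp m * (1 - m))"
  proof -
    have "(\<Sum>i\<in>I. w i * (exp m * (1 + (x i)\<^sup>2 / 8 - m))) =
        (\<Sum>i\<in>I. exp m * (1 - m) * w i + exp m * (w i * ((x i)\<^sup>2 / 8)))"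
      by (intro sum.cong refl) (simp add: algebra_simps)
    also have "\<dots> = exp m * (1 - m) * sum w I + exp m * m"
      by (simp only: sum.distrib sum_distrib_left[symmetric] m_def[symmetric])
    finally show ?thesis by (simp add: algebra_simps)
  qed
  also have "\<dots> \<le> (\<Sum>i\<in>I. w i * exp ((x i)\<^sup>2 / 8)) + (1 - sum w I) * 1"
  proof (intro add_mono sum_mono mult_left_mono)
    have tangent: "exp m * (1 + y - m) \<le> exp y" for y
    proof -
      have "exp m * (1 + (y - m)) \<le> exp m * exp (y - m)"
        by (intro mult_left_mono exp_ge_add_one_self) auto
      then show ?thesis by (simp add: exp_add[symmetric] add_diff_eq)
    qed
    show "exp m * (1 + (x i)\<^sup>2 / 8 - m) \<le> exp ((x i)\<^sup>2 / 8)" for i by (rule tangent)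
    show "exp m * (1 - m) \<le> 1" using tangent[of 0] by simp
  qed (use assms in auto)
  finally show ?thesis by (simp add: \<mu>_def)
qed

lemma dyadic_floor_step:
  fixes h :: real
  shows "\<lfloor>2 ^ Suc j * h\<rfloor> / 2 ^ Suc j = \<lfloor>2 ^ j * h\<rfloor> / 2 ^ j \<or>
         \<lfloor>2 ^ Suc j * h\<rfloor> / 2 ^ Suc j = \<lfloor>2 ^ j * h\<rfloor> / 2 ^ j + 1 / 2 ^ Suc j"
proof -
  define k where "k = \<lfloor>2 ^ j * h\<rfloor>"
  have k: "of_int k \<le> 2 ^ j * h" "2 ^ j * h < of_int k + 1" by (auto simp: k_def)
  have "2 ^ Suc j * h = 2 * (2 ^ j * h)" by simp
  then have "\<lfloor>2 ^ Suc j * h\<rfloor> = 2 * k \<or> \<lfloor>2 ^ Suc j * h\<rfloor> = 2 * k + 1"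
    using k by linarith
  then show ?thesis unfolding k_def[symmetric] by (auto simp: add_divide_distrib)
qed

lemma dyadic_floor_tendsto:
  fixes h :: real
  shows "(\<lambda>j. \<lfloor>2 ^ j * h\<rfloor> / 2 ^ j) \<longlonglongrightarrow> h"
proof (rule LIMSEQ_I)
  fix e :: real assume "e > 0"
  then obtain n where n: "(1 / 2 :: real) ^ n < e" using real_arch_pow_inv[of e "1/2"] by auto
  have "norm (\<lfloor>2 ^ j * h\<rfloor> / 2 ^ j - h) < e" if "j \<ge> n" for j
  proof -
    have "\<bar>\<lfloor>2 ^ j * h\<rfloor> - 2 ^ j * h\<bar> \<le> 1" by linarith
    then have "\<bar>\<lfloor>2 ^ j * h\<rfloor> - 2 ^ j * h\<bar> / 2 ^ j \<le> 1 / 2 ^ j" by (intro divide_right_mono) auto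
    also have "\<bar>\<lfloor>2 ^ j * h\<rfloor> - 2 ^ j * h\<bar> / 2 ^ j = \<bar>\<lfloor>2 ^ j * h\<rfloor> / 2 ^ j - h\<bar>"
    proof -
      have "\<lfloor>2 ^ j * h\<rfloor> / 2 ^ j - h = (\<lfloor>2 ^ j * h\<rfloor> - 2 ^ j * h) / 2 ^ j" by (simp add: field_simps)
      then show ?thesis by (simp only: abs_divide) simp
    qed
    also have "1 / 2 ^ j \<le> (1 / 2 :: real) ^ n"
      using that by (simp add: power_one_over power_decreasing frac_le)
    finally show ?thesis using n by simp
  qed
  then show "\<exists>no. \<forall>n\<ge>no. norm (\<lfloor>2 ^ n * h\<rfloor> / 2 ^ n - h) < e" by blast
qed

lemma powr_dyadic: "(1 / 2 ^ n :: real) powr x = ((1 / 2) powr x) ^ n"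
proof (induction n)
  case (Suc n)
  have "(1 / 2 ^ Suc n :: real) = (1 / 2) * (1 / 2 ^ n)" by simp
  then have "(1 / 2 ^ Suc n :: real) powr x = (1 / 2) powr x * (1 / 2 ^ n) powr x" by (simp only: powr_mult)
  then show ?case using Suc by simp
qed simp

text \<open>An increment over \<open>h\<close> is the sum, along the binary expansion of \<open>h\<close>, of increments over
  \<open>2 powr (- j)\<close>. These are of size \<open>2 powr (- j \<alpha>)\<close>, a geometric sequence dominated by its first
  term, which is comparable with \<open>h powr \<alpha>\<close>. Dividing by the sum of the sequence turns the
  increment into a convex combination of the normalised dyadic increments.\<close>
lemma exp_square_increment_all_shifts:
  fixes f :: "real \<Rightarrow> real"
  assumes cont: "continuous_on UNIV f" and \<alpha>: "0 < \<alpha>" and L: "L > 0" and K: "K \<ge> 1"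
    and dyadic: "\<And>n. n \<ge> 1 \<Longrightarrow>
      (\<integral>\<^sup>+s. ennreal (exp (((f (s + 1 / 2 ^ n) - f s) / (L * (1 / 2 ^ n) powr \<alpha>))\<^sup>2 / 8))
           * indicator {0<..<1 - 1 / 2 ^ n} s \<partial>lborel) \<le> ennreal K"
    and h: "0 < h" "h < 1"
  shows "(\<integral>\<^sup>+s. ennreal (exp (((f (s + h) - f s) / (L * (2 powr \<alpha> / (2 powr \<alpha> - 1)) * h powr \<alpha>))\<^sup>2 / 8))
           * indicator {0<..<1 - h} s \<partial>lborel) \<le> ennreal K"
proof -
  have [measurable]: "f \<in> borel_measurable borel" using cont by (rule borel_measurable_continuous_onI)
  define r where "r = (1 / 2) powr \<alpha>"
  have r: "0 < r" "r < 1"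
    using \<alpha> powr_less_mono2[of \<alpha> "1/2" 1] by (auto simp: r_def)
  have pow: "(1 / 2 ^ n) powr \<alpha> = r ^ n" for n
    unfolding r_def by (rule powr_dyadic)
  define hj where "hj j = \<lfloor>2 ^ j * h\<rfloor> / 2 ^ j" for j
  \<comment> \<open>\<open>n0 + 1\<close> is the position of the first nonzero binary digit of \<open>h\<close>.\<close>
  obtain n0 where n0: "h < 1 / 2 ^ n0" "1 / 2 ^ Suc n0 \<le> h"
  proof -
    obtain n where n: "(1 / 2 :: real) ^ n < h" using real_arch_pow_inv[of h "1/2"] h by auto
    let ?P = "\<lambda>k. 1 / 2 ^ k \<le> h"
    have "?P n" using n by (simp add: power_one_over)
    then have P: "?P (LEAST k. ?P k)" by (rule LeastI)
    have "(LEAST k. ?P k) \<noteq> 0" using P h by (intro notI) simp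
    then obtain k where k: "(LEAST k. ?P k) = Suc k" using not0_implies_Suc by blast
    have "\<not> ?P k" using not_less_Least[of k ?P] k by simp
    with P k that show ?thesis by (simp add: not_le)
  qed
  have hn0: "hj n0 = 0"
  proof -
    have "2 ^ n0 * h < 1" "0 \<le> 2 ^ n0 * h" using n0(1) h by (auto simp: field_simps)
    then have "\<lfloor>2 ^ n0 * h\<rfloor> = 0" by linarith
    then show ?thesis by (simp add: hj_def)
  qed
  have hj_le: "0 \<le> hj j" "hj j \<le> h" for j
    using h of_int_floor_le[of "2 ^ j * h"] by (auto simp: hj_def field_simps)
  \<comment> \<open>The sum of \<open>r ^ j\<close> over \<open>j > n0\<close>.\<close>
  define W where "W = r ^ n0 * (r / (1 - r))"
  have W: "W > 0" using r by (simp add: W_def)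
  have sumW: "(\<Sum>j\<in>{n0..<m}. r ^ Suc j / W) \<le> 1" if "m \<ge> n0" for m
  proof -
    have "(\<Sum>j\<in>{n0..<m}. r ^ Suc j) = r * (\<Sum>j\<in>{n0..<m}. r ^ j)" by (simp add: sum_distrib_left)
    also have "(\<Sum>j\<in>{n0..<m}. r ^ j) = (r ^ n0 - r ^ m) / (1 - r)"
      using that
    proof (induction m rule: dec_induct)
      case (step k)
      have "(r ^ n0 - r ^ k) / (1 - r) + r ^ k = (r ^ n0 - r ^ Suc k) / (1 - r)"
        using r by (simp add: field_simps)
      then show ?case using step by (simp add: sum.atLeastLessThan_Suc)
    qed simp
    also have "r * \<dots> \<le> W" using r by (simp add: W_def divide_right_mono mult_left_mono field_simps)
    finally show ?thesis using W by (simp add: sum_divide_distrib[symmetric])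
  qed
  have W_le: "L * W \<le> L * (2 powr \<alpha> / (2 powr \<alpha> - 1)) * h powr \<alpha>" (is "_ \<le> ?N")
  proof -
    have two: "2 powr \<alpha> = 1 / r" by (simp add: r_def powr_divide)
    have "r ^ Suc n0 \<le> h powr \<alpha>" unfolding pow[symmetric] using n0 \<alpha> by (intro powr_mono2) auto
    then have "r ^ Suc n0 / (1 - r) \<le> h powr \<alpha> / (1 - r)" using r by (intro divide_right_mono) auto
    moreover have "2 powr \<alpha> / (2 powr \<alpha> - 1) = 1 / (1 - r)" unfolding two using r by (simp add: field_simps)
    ultimately have "W \<le> (2 powr \<alpha> / (2 powr \<alpha> - 1)) * h powr \<alpha>" by (simp add: W_def mult.commute)
    then show ?thesis using L unfolding mult.assoc by (intro mult_left_mono) auto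
  qed
  let ?I = "\<lambda>s. indicator {0<..<1 - h} s :: ennreal"
  define x where "x j s = (f (s + hj (Suc j)) - f (s + hj j)) / (L * r ^ Suc j)" for j s
  have [measurable]: "x j \<in> borel_measurable borel" for j unfolding x_def[abs_def] by measurable
  have step: "(\<integral>\<^sup>+s. ennreal (exp ((x j s)\<^sup>2 / 8)) * ?I s \<partial>lborel) \<le> ennreal K" for j
  proof -
    have "hj (Suc j) = hj j \<or> hj (Suc j) = hj j + 1 / 2 ^ Suc j"
      unfolding hj_def by (rule dyadic_floor_step)
    then show ?thesis
    proof
      assume "hj (Suc j) = hj j"
      then have "(\<integral>\<^sup>+s. ennreal (exp ((x j s)\<^sup>2 / 8)) * ?I s \<partial>lborel) = ennreal (1 - h)"
        using h by (simp add: x_def)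
      also have "\<dots> \<le> ennreal K" using h K by (intro ennreal_leI) auto
      finally show ?thesis .
    next
      assume e: "hj (Suc j) = hj j + 1 / 2 ^ Suc j"
      let ?g = "\<lambda>s. ennreal (exp (((f (s + 1 / 2 ^ Suc j) - f s) / (L * r ^ Suc j))\<^sup>2 / 8)) * indicator {0<..<1 - 1 / 2 ^ Suc j} s"
      have "(\<integral>\<^sup>+s. ennreal (exp ((x j s)\<^sup>2 / 8)) * ?I s \<partial>lborel) \<le> (\<integral>\<^sup>+s. ?g (hj j + 1 * s) \<partial>lborel)"
        using hj_le[of j] hj_le(2)[of "Suc j"] e
        by (intro nn_integral_mono) (auto simp: x_def indicator_def algebra_simps)
      also have "\<dots> = (\<integral>\<^sup>+s. ?g s \<partial>lborel)"
        by (subst nn_integral_real_affine[of ?g 1 "hj j"]) auto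
      also have "\<dots> \<le> ennreal K" using dyadic[of "Suc j"] unfolding pow by simp
      finally show ?thesis .
    qed
  qed
  have fin: "(\<integral>\<^sup>+s. ennreal (exp (((f (s + hj m) - f s) / ?N)\<^sup>2 / 8)) * ?I s \<partial>lborel) \<le> ennreal K"
    if "m \<ge> n0" for m
  proof -
    let ?w = "\<lambda>j. r ^ Suc j / W"
    let ?S = "sum ?w {n0..<m}"
    have S: "?S \<le> 1" using sumW[OF that] .
    have pos: "?w j \<ge> 0" for j using r W by simp
    have tele: "(f (s + hj m) - f s) / (L * W) = (\<Sum>j\<in>{n0..<m}. ?w j * x j s)" for s
    proof -
      have "(\<Sum>j\<in>{n0..<m}. ?w j * x j s) = (\<Sum>j\<in>{n0..<m}. (f (s + hj (Suc j)) - f (s + hj j)) / (L * W))"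
        using r L W by (intro sum.cong refl) (simp add: x_def)
      also have "\<dots> = (f (s + hj m) - f (s + hj n0)) / (L * W)"
        using sum_Suc_diff'[OF that, of "\<lambda>j. f (s + hj j)"] by (simp add: sum_divide_distrib[symmetric])
      finally show ?thesis by (simp add: hn0)
    qed
    have pt: "exp (((f (s + hj m) - f s) / ?N)\<^sup>2 / 8) \<le> (\<Sum>j\<in>{n0..<m}. ?w j * exp ((x j s)\<^sup>2 / 8)) + (1 - ?S)" for s
    proof -
      have "\<bar>x / N\<bar> \<le> \<bar>x / D\<bar>" if "0 < D" "D \<le> N" for x D N :: real
        using that by (simp add: abs_divide divide_left_mono)
      from this[OF _ W_le] have "\<bar>(f (s + hj m) - f s) / ?N\<bar> \<le> \<bar>(f (s + hj m) - f s) / (L * W)\<bar>"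
        using W L by simp
      then have "exp (((f (s + hj m) - f s) / ?N)\<^sup>2 / 8) \<le> exp (((f (s + hj m) - f s) / (L * W))\<^sup>2 / 8)"
        by (simp only: exp_le_cancel_iff abs_le_square_iff divide_le_cancel) simp
      also have "\<dots> \<le> (\<Sum>j\<in>{n0..<m}. ?w j * exp ((x j s)\<^sup>2 / 8)) + (1 - ?S)"
        unfolding tele by (rule exp_square_subconvex) (use pos S in auto)
      finally show ?thesis .
    qed
    have "(\<integral>\<^sup>+s. ennreal (exp (((f (s + hj m) - f s) / ?N)\<^sup>2 / 8)) * ?I s \<partial>lborel) \<le>
      (\<integral>\<^sup>+s. (\<Sum>j\<in>{n0..<m}. ennreal (?w j) * (ennreal (exp ((x j s)\<^sup>2 / 8)) * ?I s)) + ennreal (1 - ?S) * ?I s \<partial>lborel)"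
    proof (intro nn_integral_mono)
      fix s
      have "ennreal (exp (((f (s + hj m) - f s) / ?N)\<^sup>2 / 8)) \<le>
         ennreal ((\<Sum>j\<in>{n0..<m}. ?w j * exp ((x j s)\<^sup>2 / 8)) + (1 - ?S))"
        using pt by (rule ennreal_leI)
      also have "\<dots> = (\<Sum>j\<in>{n0..<m}. ennreal (?w j) * ennreal (exp ((x j s)\<^sup>2 / 8))) + ennreal (1 - ?S)"
        using pos S by (simp only: ennreal_plus sum_nonneg mult_nonneg_nonneg exp_ge_zero diff_ge_0_iff_ge
            sum_ennreal[symmetric] ennreal_mult)
      finally show "ennreal (exp (((f (s + hj m) - f s) / ?N)\<^sup>2 / 8)) * ?I s \<le>
         (\<Sum>j\<in>{n0..<m}. ennreal (?w j) * (ennreal (exp ((x j s)\<^sup>2 / 8)) * ?I s)) + ennreal (1 - ?S) * ?I s"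
        by (auto simp: indicator_def)
    qed
    also have "\<dots> = (\<Sum>j\<in>{n0..<m}. ennreal (?w j) * (\<integral>\<^sup>+s. ennreal (exp ((x j s)\<^sup>2 / 8)) * ?I s \<partial>lborel)) +
        ennreal (1 - ?S) * ennreal (1 - h)"
      using h by (simp add: nn_integral_add nn_integral_sum nn_integral_cmult nn_integral_cmult_indicator)
    also have "\<dots> \<le> (\<Sum>j\<in>{n0..<m}. ennreal (?w j) * ennreal K) + ennreal (1 - ?S) * ennreal K"
      using h K by (intro add_mono sum_mono mult_left_mono step ennreal_leI) auto
    also have "\<dots> = ennreal (?S * K + (1 - ?S) * K)"
    proof -
      have "(\<Sum>j\<in>{n0..<m}. ennreal (?w j) * ennreal K) = ennreal ?S * ennreal K"
        using pos by (simp only: sum_distrib_right[symmetric] sum_ennreal)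
      moreover have "0 \<le> ?S" using pos by (rule sum_nonneg)
      ultimately show ?thesis using S K
        by (simp only: ennreal_plus ennreal_mult mult_nonneg_nonneg diff_ge_0_iff_ge)
    qed
    also have "?S * K + (1 - ?S) * K = K" by (simp only: distrib_right[symmetric]) simp
    finally show ?thesis .
  qed
  have lim: "(\<lambda>m. ennreal (exp (((f (s + hj (m + n0)) - f s) / ?N)\<^sup>2 / 8)) * ?I s)
     \<longlonglongrightarrow> ennreal (exp (((f (s + h) - f s) / ?N)\<^sup>2 / 8)) * ?I s" for s
  proof -
    have "(\<lambda>m. hj (m + n0)) \<longlonglongrightarrow> h"
      unfolding hj_def using dyadic_floor_tendsto by (rule LIMSEQ_ignore_initial_segment)
    then have "(\<lambda>m. s + hj (m + n0)) \<longlonglongrightarrow> s + h" by (intro tendsto_intros)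
    then have "(\<lambda>m. f (s + hj (m + n0))) \<longlonglongrightarrow> f (s + h)"
      using cont by (intro isCont_tendsto_compose[of _ f]) (auto simp: continuous_on_eq_continuous_at)
    then have l: "(\<lambda>m. ennreal (exp (((f (s + hj (m + n0)) - f s) / ?N)\<^sup>2 / 8)))
       \<longlonglongrightarrow> ennreal (exp (((f (s + h) - f s) / ?N)\<^sup>2 / 8))"
      unfolding divide_inverse by (intro tendsto_intros tendsto_ennrealI)
    then show ?thesis by (cases "s \<in> {0<..<1 - h}") auto
  qed
  have "(\<integral>\<^sup>+s. ennreal (exp (((f (s + h) - f s) / ?N)\<^sup>2 / 8)) * ?I s \<partial>lborel) =
     (\<integral>\<^sup>+s. liminf (\<lambda>m. ennreal (exp (((f (s + hj (m + n0)) - f s) / ?N)\<^sup>2 / 8)) * ?I s) \<partial>lborel)"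
    by (intro nn_integral_cong lim_imp_Liminf[symmetric] lim) auto
  also have "\<dots> \<le> liminf (\<lambda>m. \<integral>\<^sup>+s. ennreal (exp (((f (s + hj (m + n0)) - f s) / ?N)\<^sup>2 / 8)) * ?I s \<partial>lborel)"
    by (rule nn_integral_liminf) measurable
  also have "\<dots> \<le> ennreal K"
    using fin by (intro Liminf_le always_eventually) (auto intro!: fin)
  finally show ?thesis .
qed

lemma shift_dom_unit_interval:
  "shift_dom {0<..<1} h = {max 0 (-h)<..<min 1 (1 - h)}"
  by (auto simp: shift_dom_def)

lemma orlicz_norm_cong:
  assumes "\<And>s. s \<in> J \<Longrightarrow> f s = g s" "J \<in> sets lebesgue"
  shows "orlicz_norm J f = orlicz_norm J g"
proof -
  have "Lp_norm p J f = Lp_norm p J g" for p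
  proof -
    have "(\<integral>\<^sup>+x. ennreal (\<bar>f x\<bar> powr p) \<partial>lebesgue_on J) = (\<integral>\<^sup>+x. ennreal (\<bar>g x\<bar> powr p) \<partial>lebesgue_on J)"
      using assms by (intro nn_integral_cong) (auto simp: space_restrict_space)
    then show ?thesis by (simp add: Lp_norm_def)
  qed
  then show ?thesis by (simp add: orlicz_norm_def)
qed

lemma besov_orlicz_space_cong:
  assumes "\<And>s. s \<in> {0<..<1} \<Longrightarrow> f s = g s" "f \<in> besov_orlicz_space \<alpha> {0<..<1}"
  shows "g \<in> besov_orlicz_space \<alpha> {0<..<1}"
proof -
  have "f \<in> borel_measurable (lebesgue_on {0<..<1}) \<longleftrightarrow> g \<in> borel_measurable (lebesgue_on {0<..<1})"
    using assms(1) by (intro measurable_cong) (auto simp: space_restrict_space)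
  moreover have "orlicz_norm {0<..<1} f = orlicz_norm {0<..<1} g"
    using assms(1) by (intro orlicz_norm_cong) auto
  moreover have "besov_orlicz_seminorm \<alpha> {0<..<1} f = besov_orlicz_seminorm \<alpha> {0<..<1} g"
  proof -
    have "orlicz_norm (shift_dom {0<..<1} h) (\<lambda>s. f (s + h) - f s) =
        orlicz_norm (shift_dom {0<..<1} h) (\<lambda>s. g (s + h) - g s)" for h :: real
    proof (rule orlicz_norm_cong)
      show "f (s + h) - f s = g (s + h) - g s" if "s \<in> shift_dom {0<..<1} h" for s
        using assms(1) that by (simp add: shift_dom_def)
      show "shift_dom {0<..<1} h \<in> sets lebesgue" unfolding shift_dom_unit_interval by simp
    qed
    then show ?thesis by (simp add: besov_orlicz_seminorm_def)
  qed
  ultimately show ?thesis using assms(2) by (simp add: besov_orlicz_space_def)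
qed

text \<open>A negative shift is reduced to a positive one by translating the domain of integration;
  for \<open>\<bar>h\<bar> = 1\<close> the domain is empty.\<close>
lemma besov_orlicz_spaceI_dyadic:
  fixes f :: "real \<Rightarrow> real"
  assumes cont: "continuous_on UNIV f" and \<alpha>: "0 < \<alpha>" and L: "L > 0" and K: "K \<ge> 1"
    and dyadic: "\<And>n. n \<ge> 1 \<Longrightarrow>
      (\<integral>\<^sup>+s. ennreal (exp (((f (s + 1 / 2 ^ n) - f s) / (L * (1 / 2 ^ n) powr \<alpha>))\<^sup>2 / 8))
           * indicator {0<..<1 - 1 / 2 ^ n} s \<partial>lborel) \<le> ennreal K"
  shows "f \<in> besov_orlicz_space \<alpha> {0<..<1}"
proof -
  have [measurable]: "f \<in> borel_measurable borel" using cont by (rule borel_measurable_continuous_onI)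
  define L' where "L' = L * (2 powr \<alpha> / (2 powr \<alpha> - 1))"
  have "2 powr \<alpha> > 1" using \<alpha> by simp
  then have L': "L' > 0" using L by (simp add: L'_def)
  have pos: "orlicz_norm {0<..<1 - h} (\<lambda>s. f (s + h) - f s) \<le> ennreal (sqrt 8 * (L' * h powr \<alpha>) * K)"
    if h: "0 < h" "h < 1" for h
    using exp_square_increment_all_shifts[OF cont \<alpha> L K dyadic h, folded L'_def] h L' K
    by (intro orlicz_norm_le_of_exp_square) auto
  have neg: "orlicz_norm {h<..<1} (\<lambda>s. f (s - h) - f s) \<le> ennreal (sqrt 8 * (L' * h powr \<alpha>) * K)"
    if h: "0 < h" "h < 1" for h
  proof (intro orlicz_norm_le_of_exp_square)
    let ?g = "\<lambda>s. ennreal (exp (((f (s + h) - f s) / (L' * h powr \<alpha>))\<^sup>2 / 8)) * indicator {0<..<1 - h} s"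
    have "(\<integral>\<^sup>+s. ennreal (exp (((f (s - h) - f s) / (L' * h powr \<alpha>))\<^sup>2 / 8)) * indicator {h<..<1} s \<partial>lborel)
       = (\<integral>\<^sup>+s. ?g (-h + 1 * s) \<partial>lborel)"
    proof (intro nn_integral_cong)
      fix s
      have "((f (s - h) - f s) / (L' * h powr \<alpha>))\<^sup>2 = ((f s - f (s - h)) / (L' * h powr \<alpha>))\<^sup>2"
        by (simp add: power_divide power2_commute)
      then show "ennreal (exp (((f (s - h) - f s) / (L' * h powr \<alpha>))\<^sup>2 / 8)) * indicator {h<..<1} s = ?g (-h + 1 * s)"
        by (auto simp: indicator_def)
    qed
    also have "\<dots> = (\<integral>\<^sup>+s. ?g s \<partial>lborel)"
      by (subst nn_integral_real_affine[of ?g 1 "-h"]) auto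
    also have "\<dots> \<le> ennreal K"
      using exp_square_increment_all_shifts[OF cont \<alpha> L K dyadic h, folded L'_def] by simp
    finally show "(\<integral>\<^sup>+s. ennreal (exp (((f (s - h) - f s) / (L' * h powr \<alpha>))\<^sup>2 / 8)) * indicator {h<..<1} s \<partial>lborel) \<le> ennreal K" .
  qed (use L' K h in auto)
  define C where "C = sqrt 8 * L' * K"
  have C: "C \<ge> 0" using L' K by (simp add: C_def)
  have zero: "orlicz_norm J (\<lambda>s. 0) = 0" for J
    by (simp add: orlicz_norm_def Lp_norm_def)
  have empty: "orlicz_norm {} g = 0" for g
    using orlicz_norm_cong[of "{}" g "\<lambda>s. 0"] zero by simp
  have all: "orlicz_norm (shift_dom {0<..<1} h) (\<lambda>s. f (s + h) - f s) \<le> ennreal (C * \<bar>h\<bar> powr \<alpha>)"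
    if h: "\<bar>h\<bar> \<le> 1" for h :: real
  proof -
    consider "h = 0" | "\<bar>h\<bar> = 1" | "0 < h" "h < 1" | "0 < - h" "- h < 1" using h by linarith
    then show ?thesis
    proof cases
      case 1 then show ?thesis by (simp add: zero)
    next
      case 2
      then have "shift_dom {0<..<1} h = {}" by (auto simp: shift_dom_unit_interval)
      then show ?thesis by (simp add: empty)
    next
      case 3
      then have "shift_dom {0<..<1} h = {0<..<1 - h}" by (auto simp: shift_dom_unit_interval)
      then show ?thesis using pos[OF 3] 3 by (simp add: C_def mult_ac)
    next
      case 4
      then have "shift_dom {0<..<1} h = {-h<..<1}" by (auto simp: shift_dom_unit_interval)
      then show ?thesis using neg[OF 4] 4 by (simp add: C_def mult_ac)
    qed
  qed
  have "besov_orlicz_seminorm \<alpha> {0<..<1} f \<le> ennreal C"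
    unfolding besov_orlicz_seminorm_def
  proof (rule SUP_least)
    fix t :: real assume t: "t \<in> {0<..1}"
    have "(SUP h\<in>{h. \<bar>h\<bar> \<le> t}. orlicz_norm (shift_dom {0<..<1} h) (\<lambda>s. f (s + h) - f s)) \<le> ennreal (C * t powr \<alpha>)"
    proof (rule SUP_least)
      fix h :: real assume "h \<in> {h. \<bar>h\<bar> \<le> t}"
      then have "\<bar>h\<bar> \<le> 1" "\<bar>h\<bar> powr \<alpha> \<le> t powr \<alpha>" using t \<alpha> by (auto intro: powr_mono2)
      then show "orlicz_norm (shift_dom {0<..<1} h) (\<lambda>s. f (s + h) - f s) \<le> ennreal (C * t powr \<alpha>)"
        using all C by (intro order_trans[OF all] ennreal_leI mult_left_mono) auto
    qed
    then have "ennreal (t powr - \<alpha>) * (SUP h\<in>{h. \<bar>h\<bar> \<le> t}. orlicz_norm (shift_dom {0<..<1} h) (\<lambda>s. f (s + h) - f s))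
       \<le> ennreal (t powr - \<alpha>) * ennreal (C * t powr \<alpha>)"
      by (rule mult_left_mono) simp
    also have "\<dots> = ennreal C"
    proof -
      have "ennreal (t powr - \<alpha>) * ennreal (C * t powr \<alpha>) = ennreal (t powr - \<alpha> * (C * t powr \<alpha>))"
        by (simp add: ennreal_mult')
      also have "t powr - \<alpha> * (C * t powr \<alpha>) = C" using t by (simp add: powr_minus field_simps)
      finally show ?thesis .
    qed
    finally show "ennreal (t powr - \<alpha>) * (SUP h\<in>{h. \<bar>h\<bar> \<le> t}. orlicz_norm (shift_dom {0<..<1} h) (\<lambda>s. f (s + h) - f s)) \<le> ennreal C" .
  qed
  moreover have "orlicz_norm {0<..<1} f < \<infinity>"
  proof -
    have "bounded (f ` {0..1})"
      using cont by (intro compact_imp_bounded compact_continuous_image) (auto intro: continuous_on_subset)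
    then obtain B where B: "B > 0" "\<And>x. x \<in> {0..1} \<Longrightarrow> \<bar>f x\<bar> \<le> B" by (auto simp: bounded_pos)
    have "(f x / B)\<^sup>2 / 8 \<le> 1" if "x \<in> {0..1}" for x
    proof -
      have "\<bar>f x / B\<bar> \<le> 1" using B that by simp
      then have "(f x / B)\<^sup>2 \<le> 1" by (simp add: abs_square_le_1)
      then show ?thesis by simp
    qed
    then have "ennreal (exp ((f x / B)\<^sup>2 / 8)) * indicator {0<..<1} x \<le> ennreal (exp 1) * indicator {0<..<1} x" for x :: real
      by (auto simp: indicator_def intro!: ennreal_leI)
    then have "(\<integral>\<^sup>+x. ennreal (exp ((f x / B)\<^sup>2 / 8)) * indicator {0<..<1} x \<partial>lborel) \<le>
       (\<integral>\<^sup>+x. ennreal (exp 1) * indicator {0<..<1} (x::real) \<partial>lborel)"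
      by (rule nn_integral_mono)
    also have "\<dots> = ennreal (exp 1)" by (simp add: nn_integral_cmult_indicator)
    finally have "orlicz_norm {0<..<1} f \<le> ennreal (sqrt 8 * B * exp 1)"
      using B by (intro orlicz_norm_le_of_exp_square) auto
    then show ?thesis by (simp add: le_less_trans)
  qed
  moreover have "f \<in> borel_measurable (lebesgue_on {0<..<1})"
    by (intro measurable_restrict_space1 measurable_completion) simp
  ultimately show ?thesis
    by (auto simp: besov_orlicz_space_def intro: le_less_trans)
qed

section \<open>The kernel as a square\<close>

text \<open>The bilinear form behind the norm in the definition of the integral, for nonnegative random
  functions.\<close>
definition riesz_form :: "'b measure \<Rightarrow> real \<Rightarrow> (real \<Rightarrow> 'b \<Rightarrow> ennreal) \<Rightarrow> (real \<Rightarrow> 'b \<Rightarrow> ennreal) \<Rightarrow> ennreal" where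
  "riesz_form N q a b =
     (\<integral>\<^sup>+u. \<integral>\<^sup>+v. \<integral>\<^sup>+\<omega>. ennreal (\<bar>u - v\<bar> powr q) * (a u \<omega> * b v \<omega>) \<partial>N \<partial>lborel \<partial>lborel)"

text \<open>The kernel of the one-sided fractional integral whose composition with its adjoint has the
  kernel \<open>\<bar>u - v\<bar> powr q\<close>, up to a constant.\<close>
definition riesz_factor :: "real \<Rightarrow> real \<Rightarrow> ennreal" where
  "riesz_factor q x = ennreal (if 0 < x then x powr ((q - 1) / 2) else 0)"

lemma measurable_riesz_factor[measurable]: "riesz_factor q \<in> borel_measurable borel"
  unfolding riesz_factor_def[abs_def] by measurable

text \<open>For \<open>u < v\<close> the substitution \<open>r = u - (v - u) x\<close> extracts the factor \<open>(v - u) powr q\<close>. What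
  remains is a beta integral, which converges at 0 because \<open>q > -1\<close> and at infinity because \<open>q < 0\<close>.\<close>
lemma riesz_factor_convolution:
  assumes q: "-1 < q" "q < 0"
  obtains C where "0 < C" "C < \<infinity>"
    "\<And>u v. u \<noteq> v \<Longrightarrow> (\<integral>\<^sup>+r. riesz_factor q (u - r) * riesz_factor q (v - r) \<partial>lborel) = ennreal C * ennreal (\<bar>u - v\<bar> powr q)"
proof -
  define p where "p = (q - 1) / 2"
  have p: "-1 < p" "2 * p < -1" "2 * p + 1 = q" using q by (auto simp: p_def field_simps)
  define C where "C = (\<integral>\<^sup>+x. riesz_factor q x * riesz_factor q (1 + x) \<partial>lborel)"
  have "C \<le> (\<integral>\<^sup>+x. ennreal (x powr p) * indicator {0..1} x + ennreal (x powr (2 * p)) * indicator {1..} x \<partial>lborel)"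
    unfolding C_def
  proof (intro nn_integral_mono)
    fix x :: real
    consider "x \<le> 0" | "0 < x" "x \<le> 1" | "1 < x" by linarith
    then show "riesz_factor q x * riesz_factor q (1 + x) \<le>
        ennreal (x powr p) * indicator {0..1} x + ennreal (x powr (2 * p)) * indicator {1..} x"
    proof cases
      case 2
      have "(1 + x) powr p \<le> 1 powr p" using 2 p by (intro powr_mono2') auto
      then have "x powr p * (1 + x) powr p \<le> x powr p * 1" by (intro mult_left_mono) auto
      then have "riesz_factor q x * riesz_factor q (1 + x) \<le> ennreal (x powr p) * indicator {0..1} x"
        using 2 by (simp add: riesz_factor_def p_def[symmetric] ennreal_mult'[symmetric] ennreal_leI)
      also have "\<dots> \<le> ennreal (x powr p) * indicator {0..1} x + ennreal (x powr (2 * p)) * indicator {1..} x"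
        by simp
      finally show ?thesis .
    next
      case 3
      have "(1 + x) powr p \<le> x powr p" using 3 p by (intro powr_mono2') auto
      then have "x powr p * (1 + x) powr p \<le> x powr p * x powr p" by (intro mult_left_mono) auto
      also have "x powr p * x powr p = x powr (2 * p)" by (simp add: powr_add[symmetric])
      finally show ?thesis using 3
        by (auto simp: riesz_factor_def p_def[symmetric] ennreal_mult'[symmetric] indicator_def intro!: ennreal_leI)
    qed (simp add: riesz_factor_def)
  qed
  also have "\<dots> = ennreal (1 powr (p + 1) / (p + 1)) + ennreal (1 powr (2 * p + 1) / (- (2 * p) - 1))"
    using p by (subst nn_integral_add; (measurable)?) (simp only: nn_integral_powr_near_0 nn_integral_powr_at_top zero_le_one zero_less_one)
  also have "\<dots> < \<infinity>" by simp
  finally have fin: "C < \<infinity>" .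
  have "ennreal (2 powr p) = (\<integral>\<^sup>+x. ennreal (2 powr p) * indicator {0<..1::real} x \<partial>lborel)"
    by (simp add: nn_integral_cmult_indicator)
  also have "\<dots> \<le> C"
    unfolding C_def
  proof (intro nn_integral_mono)
    fix x :: real
    show "ennreal (2 powr p) * indicator {0<..1} x \<le> riesz_factor q x * riesz_factor q (1 + x)"
    proof (cases "x \<in> {0<..1}")
      case True
      then have "1 \<le> x powr p" using p powr_mono2'[of p x 1] by simp
      moreover have "2 powr p \<le> (1 + x) powr p" using True p by (intro powr_mono2') auto
      ultimately have "1 * 2 powr p \<le> x powr p * (1 + x) powr p" by (intro mult_mono) auto
      then show ?thesis using True by (simp add: riesz_factor_def p_def[symmetric] ennreal_mult'[symmetric] ennreal_leI)
    qed simp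
  qed
  finally have pos: "0 < C" by (rule less_le_trans[rotated]) simp
  obtain c where c: "C = ennreal c" "c > 0" using pos fin by (cases C) auto
  have less: "(\<integral>\<^sup>+r. riesz_factor q (u - r) * riesz_factor q (v - r) \<partial>lborel) = C * ennreal (\<bar>u - v\<bar> powr q)"
    if "u < v" for u v
  proof -
    define d where "d = v - u"
    have d: "d > 0" using that by (simp add: d_def)
    have scale: "riesz_factor q (d * x) = ennreal (d powr p) * riesz_factor q x" for x
      using d by (auto simp: riesz_factor_def p_def[symmetric] powr_mult ennreal_mult'[symmetric] zero_less_mult_iff)
    have "(\<integral>\<^sup>+r. riesz_factor q (u - r) * riesz_factor q (v - r) \<partial>lborel) =
       ennreal \<bar>- d\<bar> * (\<integral>\<^sup>+x. riesz_factor q (u - (u + (- d) * x)) * riesz_factor q (v - (u + (- d) * x)) \<partial>lborel)"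
      using d by (subst nn_integral_real_affine[of _ "-d" u]) auto
    also have "(\<integral>\<^sup>+x. riesz_factor q (u - (u + (- d) * x)) * riesz_factor q (v - (u + (- d) * x)) \<partial>lborel) =
       (\<integral>\<^sup>+x. (ennreal (d powr p) * ennreal (d powr p)) * (riesz_factor q x * riesz_factor q (1 + x)) \<partial>lborel)"
    proof (intro nn_integral_cong)
      fix x
      have "u - (u + (- d) * x) = d * x" "v - (u + (- d) * x) = d * (1 + x)" by (auto simp: d_def algebra_simps)
      then show "riesz_factor q (u - (u + (- d) * x)) * riesz_factor q (v - (u + (- d) * x)) =
         (ennreal (d powr p) * ennreal (d powr p)) * (riesz_factor q x * riesz_factor q (1 + x))"
        by (simp only: scale mult_ac)
    qed
    also have "\<dots> = ennreal (d powr (2 * p)) * C"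
      by (subst nn_integral_cmult) (auto simp: C_def ennreal_mult'[symmetric] powr_add[symmetric])
    also have "ennreal \<bar>- d\<bar> * (ennreal (d powr (2 * p)) * C) = C * ennreal (d powr (2 * p + 1))"
      using d by (simp add: powr_add ennreal_mult' mult_ac)
    finally show ?thesis using that p by (simp add: d_def)
  qed
  have "(\<integral>\<^sup>+r. riesz_factor q (u - r) * riesz_factor q (v - r) \<partial>lborel) = ennreal c * ennreal (\<bar>u - v\<bar> powr q)"
    if "u \<noteq> v" for u v
    using that less[of u v] less[of v u] c(1) by (cases "u < v") (auto simp: mult.commute abs_minus_commute)
  with c show ?thesis by (intro that[of c]) auto
qed

text \<open>With this factorisation the form becomes an inner product of the fractional integrals of \<open>a\<close>
  and \<open>b\<close> with respect to \<open>lborel\<close> and \<open>N\<close>, so that the \<open>L\<^sup>2\<close> inequalities apply to it.\<close>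
lemma riesz_form_eq_square:
  assumes N: "prob_space N" and q: "-1 < q" "q < 0"
    and [measurable]: "case_prod a \<in> borel_measurable (borel \<Otimes>\<^sub>M N)" "case_prod b \<in> borel_measurable (borel \<Otimes>\<^sub>M N)"
    and C: "\<And>u v. u \<noteq> v \<Longrightarrow> (\<integral>\<^sup>+r. riesz_factor q (u - r) * riesz_factor q (v - r) \<partial>lborel) = ennreal C * ennreal (\<bar>u - v\<bar> powr q)"
  shows "ennreal C * riesz_form N q a b =
     (\<integral>\<^sup>+r. \<integral>\<^sup>+\<omega>. (\<integral>\<^sup>+u. riesz_factor q (u - r) * a u \<omega> \<partial>lborel) * (\<integral>\<^sup>+v. riesz_factor q (v - r) * b v \<omega> \<partial>lborel) \<partial>N \<partial>lborel)"
proof -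
  interpret prob_space N by fact
  interpret LN: pair_sigma_finite lborel N ..
  interpret NL: pair_sigma_finite N lborel ..
  have "ennreal C * riesz_form N q a b =
    (\<integral>\<^sup>+u. \<integral>\<^sup>+v. \<integral>\<^sup>+\<omega>. ennreal C * ennreal (\<bar>u - v\<bar> powr q) * (a u \<omega> * b v \<omega>) \<partial>N \<partial>lborel \<partial>lborel)"
    unfolding riesz_form_def by (simp add: nn_integral_cmult[symmetric] mult.assoc)
  also have "\<dots> = (\<integral>\<^sup>+u. \<integral>\<^sup>+v. \<integral>\<^sup>+\<omega>. (\<integral>\<^sup>+r. riesz_factor q (u - r) * riesz_factor q (v - r) * (a u \<omega> * b v \<omega>) \<partial>lborel) \<partial>N \<partial>lborel \<partial>lborel)"
  proof (rule nn_integral_cong)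
    fix u :: real
    show "(\<integral>\<^sup>+v. \<integral>\<^sup>+\<omega>. ennreal C * ennreal (\<bar>u - v\<bar> powr q) * (a u \<omega> * b v \<omega>) \<partial>N \<partial>lborel) =
       (\<integral>\<^sup>+v. \<integral>\<^sup>+\<omega>. (\<integral>\<^sup>+r. riesz_factor q (u - r) * riesz_factor q (v - r) * (a u \<omega> * b v \<omega>) \<partial>lborel) \<partial>N \<partial>lborel)"
    proof (rule nn_integral_cong_AE, rule eventually_mono[OF AE_lborel_singleton[of u]])
      fix v assume "v \<noteq> u"
      then show "(\<integral>\<^sup>+\<omega>. ennreal C * ennreal (\<bar>u - v\<bar> powr q) * (a u \<omega> * b v \<omega>) \<partial>N) =
        (\<integral>\<^sup>+\<omega>. (\<integral>\<^sup>+r. riesz_factor q (u - r) * riesz_factor q (v - r) * (a u \<omega> * b v \<omega>) \<partial>lborel) \<partial>N)"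
        using C[of u v] by (simp add: nn_integral_multc)
    qed
  qed
  also have "\<dots> = (\<integral>\<^sup>+u. \<integral>\<^sup>+v. \<integral>\<^sup>+r. \<integral>\<^sup>+\<omega>. riesz_factor q (u - r) * riesz_factor q (v - r) * (a u \<omega> * b v \<omega>) \<partial>N \<partial>lborel \<partial>lborel \<partial>lborel)"
    by (intro nn_integral_cong LN.Fubini') measurable
  also have "\<dots> = (\<integral>\<^sup>+u. \<integral>\<^sup>+r. \<integral>\<^sup>+v. \<integral>\<^sup>+\<omega>. riesz_factor q (u - r) * riesz_factor q (v - r) * (a u \<omega> * b v \<omega>) \<partial>N \<partial>lborel \<partial>lborel \<partial>lborel)"
    by (intro nn_integral_cong lborel_pair.Fubini') measurable
  also have "\<dots> = (\<integral>\<^sup>+r. \<integral>\<^sup>+u. \<integral>\<^sup>+v. \<integral>\<^sup>+\<omega>. riesz_factor q (u - r) * riesz_factor q (v - r) * (a u \<omega> * b v \<omega>) \<partial>N \<partial>lborel \<partial>lborel \<partial>lborel)"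
    by (intro lborel_pair.Fubini') measurable
  also have "\<dots> = (\<integral>\<^sup>+r. \<integral>\<^sup>+u. \<integral>\<^sup>+\<omega>. \<integral>\<^sup>+v. riesz_factor q (u - r) * riesz_factor q (v - r) * (a u \<omega> * b v \<omega>) \<partial>lborel \<partial>N \<partial>lborel \<partial>lborel)"
    by (intro nn_integral_cong NL.Fubini') measurable
  also have "\<dots> = (\<integral>\<^sup>+r. \<integral>\<^sup>+\<omega>. \<integral>\<^sup>+u. \<integral>\<^sup>+v. riesz_factor q (u - r) * riesz_factor q (v - r) * (a u \<omega> * b v \<omega>) \<partial>lborel \<partial>lborel \<partial>N \<partial>lborel)"
    by (intro nn_integral_cong NL.Fubini') measurable
  also have "\<dots> = (\<integral>\<^sup>+r. \<integral>\<^sup>+\<omega>. (\<integral>\<^sup>+u. riesz_factor q (u - r) * a u \<omega> \<partial>lborel) * (\<integral>\<^sup>+v. riesz_factor q (v - r) * b v \<omega> \<partial>lborel) \<partial>N \<partial>lborel)"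
  proof (intro nn_integral_cong)
    fix r :: real and \<omega> assume [measurable]: "\<omega> \<in> space N"
    have "(\<integral>\<^sup>+u. \<integral>\<^sup>+v. riesz_factor q (u - r) * riesz_factor q (v - r) * (a u \<omega> * b v \<omega>) \<partial>lborel \<partial>lborel) =
      (\<integral>\<^sup>+u. \<integral>\<^sup>+v. (riesz_factor q (u - r) * a u \<omega>) * (riesz_factor q (v - r) * b v \<omega>) \<partial>lborel \<partial>lborel)"
      by (simp add: mult_ac)
    also have "\<dots> = (\<integral>\<^sup>+u. riesz_factor q (u - r) * a u \<omega> \<partial>lborel) * (\<integral>\<^sup>+v. riesz_factor q (v - r) * b v \<omega> \<partial>lborel)"
      by (subst nn_integral_cmult, measurable, subst nn_integral_multc, measurable)
    finally show "(\<integral>\<^sup>+u. \<integral>\<^sup>+v. riesz_factor q (u - r) * riesz_factor q (v - r) * (a u \<omega> * b v \<omega>) \<partial>lborel \<partial>lborel) = \<dots>" .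
  qed
  finally show ?thesis .
qed

lemma riesz_form_Cauchy_Schwarz:
  assumes N: "prob_space N" and q: "-1 < q" "q < 0"
    and [measurable]: "case_prod a \<in> borel_measurable (borel \<Otimes>\<^sub>M N)" "case_prod b \<in> borel_measurable (borel \<Otimes>\<^sub>M N)"
  shows "(riesz_form N q a b)\<^sup>2 \<le> riesz_form N q a a * riesz_form N q b b"
proof -
  interpret prob_space N by fact
  obtain C where C: "0 < C" and conv:
    "\<And>u v. u \<noteq> v \<Longrightarrow> (\<integral>\<^sup>+r. riesz_factor q (u - r) * riesz_factor q (v - r) \<partial>lborel) = ennreal C * ennreal (\<bar>u - v\<bar> powr q)"
    using riesz_factor_convolution[OF q] by metis
  let ?A = "\<lambda>a z. \<integral>\<^sup>+u. riesz_factor q (u - fst z) * a u (snd z) \<partial>lborel"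
  have eq: "ennreal C * riesz_form N q a b = (\<integral>\<^sup>+z. ?A a z * ?A b z \<partial>(lborel \<Otimes>\<^sub>M N))"
    if [measurable]: "case_prod a \<in> borel_measurable (borel \<Otimes>\<^sub>M N)" "case_prod b \<in> borel_measurable (borel \<Otimes>\<^sub>M N)" for a b
    using riesz_form_eq_square[OF N q that conv] by (subst nn_integral_fst[symmetric]) simp_all
  have "(ennreal C * riesz_form N q a b)\<^sup>2 \<le> (ennreal C * riesz_form N q a a) * (ennreal C * riesz_form N q b b)"
    using Cauchy_Schwarz_nn_integral[of "?A a" "lborel \<Otimes>\<^sub>M N" "?A b"] by (simp add: eq power2_eq_square)
  then have "(ennreal C)\<^sup>2 * (riesz_form N q a b)\<^sup>2 \<le> (ennreal C)\<^sup>2 * (riesz_form N q a a * riesz_form N q b b)"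
    by (simp add: power_mult_distrib power2_eq_square mult_ac)
  then show ?thesis
    using C by (subst (asm) ennreal_mult_le_mult_iff) (auto simp: power2_eq_square ennreal_mult'[symmetric])
qed

lemma ennreal_square_add_le: "(x + y)\<^sup>2 \<le> 2 * x\<^sup>2 + 2 * (y::ennreal)\<^sup>2"
proof (cases "x = \<infinity> \<or> y = \<infinity>")
  case False
  then obtain a b where ab: "x = ennreal a" "y = ennreal b" "a \<ge> 0" "b \<ge> 0"
    by (cases x; cases y) auto
  have "(a + b)\<^sup>2 \<le> 2 * a\<^sup>2 + 2 * b\<^sup>2"
    using sum_squares_bound[of a b] by (simp add: power2_sum)
  then have "ennreal ((a + b)\<^sup>2) \<le> ennreal (2 * a\<^sup>2 + 2 * b\<^sup>2)" by (rule ennreal_leI)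
  then show ?thesis using ab by (simp add: ennreal_power[symmetric] ennreal_plus[symmetric] ennreal_mult del: ennreal_plus)
     (simp add: ennreal_power ennreal_plus ennreal_mult)
qed (auto simp: power2_eq_square)

text \<open>A triangle inequality for the seminorm of the form, with the constant lost by
  \<open>(x + y)\<^sup>2 \<le> 2 x\<^sup>2 + 2 y\<^sup>2\<close>; boundedness of norms is all it is used for.\<close>
lemma riesz_form_quasi_triangle:
  assumes N: "prob_space N" and q: "-1 < q" "q < 0"
    and [measurable]: "case_prod a \<in> borel_measurable (borel \<Otimes>\<^sub>M N)" "case_prod b \<in> borel_measurable (borel \<Otimes>\<^sub>M N)"
      "case_prod c \<in> borel_measurable (borel \<Otimes>\<^sub>M N)"
    and le: "\<And>u \<omega>. c u \<omega> \<le> a u \<omega> + b u \<omega>"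
  shows "riesz_form N q c c \<le> 2 * riesz_form N q a a + 2 * riesz_form N q b b"
proof -
  interpret prob_space N by fact
  obtain C where C: "0 < C" and conv:
    "\<And>u v. u \<noteq> v \<Longrightarrow> (\<integral>\<^sup>+r. riesz_factor q (u - r) * riesz_factor q (v - r) \<partial>lborel) = ennreal C * ennreal (\<bar>u - v\<bar> powr q)"
    using riesz_factor_convolution[OF q] by metis
  let ?A = "\<lambda>a r \<omega>. \<integral>\<^sup>+u. riesz_factor q (u - r) * a u \<omega> \<partial>lborel"
  have eq: "ennreal C * riesz_form N q a a = (\<integral>\<^sup>+r. \<integral>\<^sup>+\<omega>. (?A a r \<omega>)\<^sup>2 \<partial>N \<partial>lborel)"
    if [measurable]: "case_prod a \<in> borel_measurable (borel \<Otimes>\<^sub>M N)" for a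
    using riesz_form_eq_square[OF N q that that conv] by (simp add: power2_eq_square)
  have "ennreal C * riesz_form N q c c \<le> (\<integral>\<^sup>+r. \<integral>\<^sup>+\<omega>. 2 * (?A a r \<omega>)\<^sup>2 + 2 * (?A b r \<omega>)\<^sup>2 \<partial>N \<partial>lborel)"
    unfolding eq[OF assms(6)]
  proof (intro nn_integral_mono)
    fix r :: real and \<omega> assume [measurable]: "\<omega> \<in> space N"
    have "?A c r \<omega> \<le> (\<integral>\<^sup>+u. riesz_factor q (u - r) * a u \<omega> + riesz_factor q (u - r) * b u \<omega> \<partial>lborel)"
      using le by (intro nn_integral_mono) (simp add: distrib_left[symmetric] mult_left_mono)
    also have "\<dots> = ?A a r \<omega> + ?A b r \<omega>" by (rule nn_integral_add) measurable
    finally have "(?A c r \<omega>)\<^sup>2 \<le> (?A a r \<omega> + ?A b r \<omega>)\<^sup>2" by (rule power_mono) simp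
    also have "\<dots> \<le> 2 * (?A a r \<omega>)\<^sup>2 + 2 * (?A b r \<omega>)\<^sup>2" by (rule ennreal_square_add_le)
    finally show "(?A c r \<omega>)\<^sup>2 \<le> 2 * (?A a r \<omega>)\<^sup>2 + 2 * (?A b r \<omega>)\<^sup>2" .
  qed
  also have "\<dots> = 2 * (ennreal C * riesz_form N q a a) + 2 * (ennreal C * riesz_form N q b b)"
    by (simp add: nn_integral_add nn_integral_cmult eq)
  also have "\<dots> = ennreal C * (2 * riesz_form N q a a + 2 * riesz_form N q b b)"
    by (simp add: distrib_left mult_ac)
  finally show ?thesis
    using C by (subst (asm) ennreal_mult_le_mult_iff) auto
qed

section \<open>Increments of fractional Brownian motion\<close>

lemma nn_integral_indicator_half_open:
  fixes f :: "real \<Rightarrow> ennreal"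
  shows "(\<integral>\<^sup>+x. f x * indicator {a<..b} x \<partial>lborel) = (\<integral>\<^sup>+x. f x * indicator {a..b} x \<partial>lborel)"
  by (rule nn_integral_cong_AE, rule eventually_mono[OF AE_lborel_singleton[of a]]) (auto simp: indicator_def)

lemma DERIV_signed_powr:
  fixes x p :: real
  assumes "x \<noteq> 0" 
  shows "((\<lambda>x. sgn x * \<bar>x\<bar> powr p) has_real_derivative p * \<bar>x\<bar> powr (p - 1)) (at x)"
    and "((\<lambda>x. \<bar>x\<bar> powr p) has_real_derivative p * (sgn x * \<bar>x\<bar> powr (p - 1))) (at x)"
proof -
  consider "x > 0" | "x < 0" using assms by linarith
  then have "((\<lambda>x. sgn x * \<bar>x\<bar> powr p) has_real_derivative p * \<bar>x\<bar> powr (p - 1)) (at x) \<and>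
    ((\<lambda>x. \<bar>x\<bar> powr p) has_real_derivative p * (sgn x * \<bar>x\<bar> powr (p - 1))) (at x)"
  proof cases
    case 1
    have "((\<lambda>x. x powr p) has_real_derivative p * x powr (p - 1)) (at x)"
      using 1 by (auto intro!: derivative_eq_intros)
    then show ?thesis using 1
      by (auto elim!: has_field_derivative_transform_within_open[where S="{0<..}"])
  next
    case 2
    have "((\<lambda>x. - ((- x) powr p)) has_real_derivative p * (- x) powr (p - 1)) (at x)"
      "((\<lambda>x. (- x) powr p) has_real_derivative p * (- ((- x) powr (p - 1)))) (at x)"
      using 2 by (auto intro!: derivative_eq_intros)
    then show ?thesis using 2
      by (intro conjI; (elim has_field_derivative_transform_within_open[where S="{..<0}"])?)
         (auto elim!: has_field_derivative_transform_within_open[where S="{..<0}"])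
  qed
  then show "((\<lambda>x. sgn x * \<bar>x\<bar> powr p) has_real_derivative p * \<bar>x\<bar> powr (p - 1)) (at x)"
    "((\<lambda>x. \<bar>x\<bar> powr p) has_real_derivative p * (sgn x * \<bar>x\<bar> powr (p - 1))) (at x)" by blast+
qed

lemma continuous_on_signed_powr:
  fixes p :: real assumes "p > 0"
  shows "continuous_on UNIV (\<lambda>x::real. sgn x * \<bar>x\<bar> powr p)" "continuous_on UNIV (\<lambda>x::real. \<bar>x\<bar> powr p)"
proof -
  show c: "continuous_on UNIV (\<lambda>x::real. \<bar>x\<bar> powr p)"
    using assms by (intro continuous_on_powr' continuous_intros) auto
  have "isCont (\<lambda>x::real. sgn x * \<bar>x\<bar> powr p) x" for x
  proof (cases "x = 0")
    case False then show ?thesis by (rule DERIV_isCont[OF DERIV_signed_powr(1)])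
  next
    case True
    have "((\<lambda>x::real. \<bar>x\<bar> powr p) \<longlongrightarrow> 0) (at 0)"
      using c assms by (auto simp: continuous_on_eq_continuous_at isCont_def dest!: spec[of _ 0])
    then have "((\<lambda>x::real. sgn x * \<bar>x\<bar> powr p) \<longlongrightarrow> 0) (at 0)"
      by (rule Lim_null_comparison[rotated]) (auto simp: abs_mult abs_sgn_eq intro!: always_eventually)
    then show ?thesis using True by (simp add: isCont_def)
  qed
  then show "continuous_on UNIV (\<lambda>x::real. sgn x * \<bar>x\<bar> powr p)" by (simp add: continuous_on_eq_continuous_at)
qed

lemma signed_powr_mono:
  fixes x y p :: real assumes "p > 0" "x \<le> y"
  shows "sgn x * \<bar>x\<bar> powr p \<le> sgn y * \<bar>y\<bar> powr p"
proof (cases "x \<ge> 0 \<or> y \<le> 0")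
  case True
  then show ?thesis using assms powr_mono2[of p x y] powr_mono2[of p "-y" "-x"]
    by (auto simp: sgn_if)
next
  case False
  then have "sgn x * \<bar>x\<bar> powr p \<le> 0" "0 \<le> sgn y * \<bar>y\<bar> powr p" by (auto simp: sgn_if)
  then show ?thesis by linarith
qed

text \<open>The mixed second difference of \<open>\<bar>x - y\<bar> powr (2 H)\<close> as a double integral. The signed power
  \<open>sgn x * \<bar>x\<bar> powr p\<close> is the antiderivative across the singularity at 0.\<close>
lemma
  fixes H :: real
  assumes H: "1 / 2 < H" and le: "a \<le> b" "c \<le> d"
  shows nn_integral_riesz_rectangle: "(\<integral>\<^sup>+u. \<integral>\<^sup>+v. ennreal (\<bar>u - v\<bar> powr (2 * H - 2)) * (indicator {a<..b} u * indicator {c<..d} v) \<partial>lborel \<partial>lborel)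
    = ennreal ((\<bar>d - a\<bar> powr (2 * H) + \<bar>c - b\<bar> powr (2 * H) - \<bar>c - a\<bar> powr (2 * H) - \<bar>d - b\<bar> powr (2 * H)) / (2 * H * (2 * H - 1)))" (is ?eq)
    and riesz_rectangle_nonneg: "0 \<le> \<bar>d - a\<bar> powr (2 * H) + \<bar>c - b\<bar> powr (2 * H) - \<bar>c - a\<bar> powr (2 * H) - \<bar>d - b\<bar> powr (2 * H)" (is "0 \<le> ?r")
proof -
  let ?s = "\<lambda>x::real. sgn x * \<bar>x\<bar> powr (2 * H - 1)"
  have inner: "(\<integral>\<^sup>+v. ennreal (\<bar>u - v\<bar> powr (2 * H - 2)) * indicator {c<..d} v \<partial>lborel) =
     ennreal ((?s (d - u) - ?s (c - u)) / (2 * H - 1))" for u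
  proof -
    have "(\<integral>\<^sup>+v. ennreal (\<bar>u - v\<bar> powr (2 * H - 2)) * indicator {c<..d} v \<partial>lborel) =
      ennreal (?s (d - u) / (2 * H - 1) - ?s (c - u) / (2 * H - 1))"
      unfolding nn_integral_indicator_half_open
    proof (rule nn_integral_FTC_exceptional[where S="{u}"])
      show "continuous_on {c..d} (\<lambda>v. ?s (v - u) / (2 * H - 1))"
        using H by (intro continuous_intros continuous_on_compose2[OF continuous_on_signed_powr(1)]) auto
      fix v assume "v \<in> {c<..<d} - {u}"
      then have "((\<lambda>v. ?s (v - u)) has_real_derivative ((2 * H - 1) * \<bar>v - u\<bar> powr (2 * H - 1 - 1)) * 1) (at v)"
        by (intro DERIV_chain2[OF DERIV_signed_powr(1)]) (auto intro!: derivative_eq_intros)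
      then show "((\<lambda>v. ?s (v - u) / (2 * H - 1)) has_real_derivative \<bar>u - v\<bar> powr (2 * H - 2)) (at v)"
        using H DERIV_cdivide[of "\<lambda>v. ?s (v - u)" "(2 * H - 1) * \<bar>v - u\<bar> powr (2 * H - 1 - 1) * 1" v UNIV "2 * H - 1"]
        by (simp add: abs_minus_commute)
    qed (use le in auto)
    then show ?thesis by (simp add: diff_divide_distrib)
  qed
  let ?F = "\<lambda>u. (\<bar>c - u\<bar> powr (2 * H) - \<bar>d - u\<bar> powr (2 * H)) / (2 * H * (2 * H - 1))"
  have cont: "continuous_on {a..b} ?F"
      using H by (intro continuous_intros continuous_on_compose2[OF continuous_on_signed_powr(2)]) auto
  have nonneg: "0 \<le> (?s (d - u) - ?s (c - u)) / (2 * H - 1)" for u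
      using H le signed_powr_mono[of "2 * H - 1" "c - u" "d - u"] by simp
  have der: "(?F has_real_derivative (?s (d - u) - ?s (c - u)) / (2 * H - 1)) (at u)" if u: "u \<in> {a<..<b} - {c, d}" for u
  proof -
    have "((\<lambda>u. \<bar>e - u\<bar> powr (2 * H)) has_real_derivative (2 * H * ?s (e - u)) * (- 1)) (at u)" if "u \<noteq> e" for e
      using that by (intro DERIV_chain2[OF DERIV_signed_powr(2)[of _ "2 * H"]]) (auto intro!: derivative_eq_intros)
    from DERIV_cdivide[OF DERIV_diff[OF this[of c] this[of d]], of "2 * H * (2 * H - 1)"] u
    have "(?F has_real_derivative ((2 * H * ?s (c - u)) * (- 1) - (2 * H * ?s (d - u)) * (- 1)) / (2 * H * (2 * H - 1))) (at u)" by simp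
    also have "((2 * H * ?s (c - u)) * (- 1) - (2 * H * ?s (d - u)) * (- 1)) / (2 * H * (2 * H - 1)) = (2 * H * (?s (d - u) - ?s (c - u))) / (2 * H * (2 * H - 1))"
      by (simp only: right_diff_distrib) simp
    also have "\<dots> = (?s (d - u) - ?s (c - u)) / (2 * H - 1)" using H by simp
    finally show ?thesis .
  qed
  have "(\<integral>\<^sup>+u. \<integral>\<^sup>+v. ennreal (\<bar>u - v\<bar> powr (2 * H - 2)) * (indicator {a<..b} u * indicator {c<..d} v) \<partial>lborel \<partial>lborel)
    = (\<integral>\<^sup>+u. ennreal ((?s (d - u) - ?s (c - u)) / (2 * H - 1)) * indicator {a<..b} u \<partial>lborel)"
  proof (intro nn_integral_cong)
    fix u
    have "(\<integral>\<^sup>+v. ennreal (\<bar>u - v\<bar> powr (2 * H - 2)) * (indicator {a<..b} u * indicator {c<..d} v) \<partial>lborel) =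
       (\<integral>\<^sup>+v. ennreal (\<bar>u - v\<bar> powr (2 * H - 2)) * indicator {c<..d} v \<partial>lborel) * indicator {a<..b} u"
      by (subst nn_integral_multc[symmetric]) (auto simp: mult_ac)
    then show "(\<integral>\<^sup>+v. ennreal (\<bar>u - v\<bar> powr (2 * H - 2)) * (indicator {a<..b} u * indicator {c<..d} v) \<partial>lborel) =
       ennreal ((?s (d - u) - ?s (c - u)) / (2 * H - 1)) * indicator {a<..b} u" by (simp only: inner)
  qed
  also have "\<dots> = ennreal (?F b - ?F a)"
    unfolding nn_integral_indicator_half_open
    by (rule nn_integral_FTC_exceptional[where S="{c, d}", OF _ nonneg _ le(1) cont der]) auto
  also have F: "?F b - ?F a = (\<bar>d - a\<bar> powr (2 * H) + \<bar>c - b\<bar> powr (2 * H) - \<bar>c - a\<bar> powr (2 * H) - \<bar>d - b\<bar> powr (2 * H)) / (2 * H * (2 * H - 1))"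
    by (simp add: diff_divide_distrib[symmetric])
  finally show ?eq .
  have "0 \<le> ?F b - ?F a"
    by (rule FTC_exceptional_nonneg[where S="{c, d}", OF _ nonneg _ le(1) cont der]) auto
  then have "0 \<le> ?r / (2 * H * (2 * H - 1))" unfolding F .
  moreover have "0 < 2 * H * (2 * H - 1)" using H by (intro mult_pos_pos) auto
  ultimately show "0 \<le> ?r" by (simp only: pos_le_divide_eq mult_zero_left)
qed

lemma fbm_increment_covariance:
  assumes N: "prob_space N" and B: "fractional_brownian_motion N H B" and H: "1 / 2 < H"
    and le: "0 \<le> a" "a \<le> b" "0 \<le> c" "c \<le> d"
  shows "integrable N (\<lambda>\<omega>. (B b \<omega> - B a \<omega>) * (B d \<omega> - B c \<omega>))"
    and "ennreal (LINT \<omega>|N. (B b \<omega> - B a \<omega>) * (B d \<omega> - B c \<omega>)) = ennreal (H * (2 * H - 1)) *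
      (\<integral>\<^sup>+u. \<integral>\<^sup>+v. ennreal (\<bar>u - v\<bar> powr (2 * H - 2)) * (indicator {a<..b} u * indicator {c<..d} v) \<partial>lborel \<partial>lborel)"
    and "0 \<le> (LINT \<omega>|N. (B b \<omega> - B a \<omega>) * (B d \<omega> - B c \<omega>))"
proof -
  have g: "centered_gaussian_process N {0..} B"
    and cov: "\<And>s t. s \<ge> 0 \<Longrightarrow> t \<ge> 0 \<Longrightarrow> (LINT \<omega>|N. B t \<omega> * B s \<omega>) =
        (t powr (2 * H) + s powr (2 * H) - \<bar>t - s\<bar> powr (2 * H)) / 2"
    using B by (auto simp: fractional_brownian_motion_def)
  have int: "integrable N (\<lambda>\<omega>. B x \<omega> * B y \<omega>)" if "x \<ge> 0" "y \<ge> 0" for x y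
    using that centered_gaussian_process_square_integrable[OF N g]
    by (intro integrable_mult_of_squares) auto
  have eq: "(\<lambda>\<omega>. (B b \<omega> - B a \<omega>) * (B d \<omega> - B c \<omega>)) =
     (\<lambda>\<omega>. B b \<omega> * B d \<omega> - B b \<omega> * B c \<omega> - B a \<omega> * B d \<omega> + B a \<omega> * B c \<omega>)"
    by (auto simp: algebra_simps)
  show "integrable N (\<lambda>\<omega>. (B b \<omega> - B a \<omega>) * (B d \<omega> - B c \<omega>))"
    unfolding eq using le int by auto
  let ?r = "\<bar>d - a\<bar> powr (2 * H) + \<bar>c - b\<bar> powr (2 * H) - \<bar>c - a\<bar> powr (2 * H) - \<bar>d - b\<bar> powr (2 * H)"
  have E: "(LINT \<omega>|N. (B b \<omega> - B a \<omega>) * (B d \<omega> - B c \<omega>)) = ?r / 2"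
    unfolding eq using le int cov by (simp add: abs_minus_commute)
  have rect: "ennreal (H * (2 * H - 1)) *
      (\<integral>\<^sup>+u. \<integral>\<^sup>+v. ennreal (\<bar>u - v\<bar> powr (2 * H - 2)) * (indicator {a<..b} u * indicator {c<..d} v) \<partial>lborel \<partial>lborel)
     = ennreal (H * (2 * H - 1) * (?r / (2 * H * (2 * H - 1))))"
    using H le by (subst ennreal_mult') (auto simp only: nn_integral_riesz_rectangle, auto)
  have "H * (2 * H - 1) * (x / (2 * H * (2 * H - 1))) = x / 2" for x
    using H by (simp add: field_simps)
  then show "ennreal (LINT \<omega>|N. (B b \<omega> - B a \<omega>) * (B d \<omega> - B c \<omega>)) = ennreal (H * (2 * H - 1)) *
      (\<integral>\<^sup>+u. \<integral>\<^sup>+v. ennreal (\<bar>u - v\<bar> powr (2 * H - 2)) * (indicator {a<..b} u * indicator {c<..d} v) \<partial>lborel \<partial>lborel)"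
    unfolding rect E by (simp only:)
  show "0 \<le> (LINT \<omega>|N. (B b \<omega> - B a \<omega>) * (B d \<omega> - B c \<omega>))"
    using riesz_rectangle_nonneg[OF H le(2,4)] unfolding E by simp
qed

section \<open>Measurable versions\<close>

text \<open>The smallest multiple of \<open>2 powr (- n)\<close> strictly larger than \<open>u\<close>. Approximating from above
  keeps positive times positive, which matters for processes defined on positive times only.\<close>
definition dyadic_above :: "nat \<Rightarrow> real \<Rightarrow> real" where
  "dyadic_above n u = (real_of_int \<lfloor>2 ^ n * u\<rfloor> + 1) / 2 ^ n"

lemma dyadic_above_bounds:
  fixes u :: real and n :: nat
  shows "u < dyadic_above n u" "dyadic_above n u \<le> u + 1 / 2 ^ n"
proof -
  have "2 ^ n * u < \<lfloor>2 ^ n * u\<rfloor> + 1" "\<lfloor>2 ^ n * u\<rfloor> + 1 \<le> 2 ^ n * u + 1" by linarith+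
  then show "u < dyadic_above n u" "dyadic_above n u \<le> u + 1 / 2 ^ n"
    by (auto simp: dyadic_above_def field_simps)
qed

lemma dyadic_above_tendsto: "(\<lambda>n. dyadic_above n u) \<longlonglongrightarrow> u"
proof (rule tendsto_sandwich[of "\<lambda>_. u" _ _ "\<lambda>n. u + (1 / 2) ^ n"])
  have "(\<lambda>n. u + (1 / 2) ^ n) \<longlonglongrightarrow> u + 0" by (intro tendsto_intros LIMSEQ_power_zero) auto
  then show "(\<lambda>n. u + (1 / 2) ^ n) \<longlonglongrightarrow> u" by simp
qed (use dyadic_above_bounds[where u=u] in \<open>auto simp: power_one_over intro!: always_eventually less_imp_le\<close>)

lemma measurable_dyadic_above:
  fixes X :: "real \<Rightarrow> 'b \<Rightarrow> real"
  assumes "\<And>t. X t \<in> borel_measurable N"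
  shows "(\<lambda>z. X (dyadic_above n (fst z)) (snd z)) \<in> borel_measurable (borel \<Otimes>\<^sub>M N)"
  unfolding dyadic_above_def
proof (rule measurable_compose_countable[of "\<lambda>k z. X ((real_of_int k + 1) / 2 ^ n) (snd z)"])
  show "(\<lambda>z. X ((real_of_int k + 1) / 2 ^ n) (snd z)) \<in> borel_measurable (borel \<Otimes>\<^sub>M N)" for k
    using assms by measurable
  show "(\<lambda>z. \<lfloor>2 ^ n * fst z\<rfloor>) \<in> (borel :: real measure) \<Otimes>\<^sub>M N \<rightarrow>\<^sub>M count_space UNIV" by measurable
qed

text \<open>The second moment of \<open>Z\<^sub>w - Z\<^sub>t\<close> is a second difference of the function \<open>x powr (- \<gamma>)\<close>, hence of order
  \<open>(w - t)\<^sup>2\<close>. Along the dyadic approximations of \<open>t\<close> these moments are summable, so the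
  approximations converge almost surely to \<open>Z\<^sub>t\<close>; their pathwise limit is jointly measurable.\<close>
lemma measurable_modification:
  fixes Z :: "real \<Rightarrow> 'b \<Rightarrow> real"
  assumes N: "prob_space N" and \<gamma>: "\<gamma> > 0"
    and meas: "\<And>t. t > 0 \<Longrightarrow> Z t \<in> borel_measurable N"
    and prod: "\<And>s t. s > 0 \<Longrightarrow> t > 0 \<Longrightarrow> integrable N (\<lambda>\<omega>. Z t \<omega> * Z s \<omega>)"
    and cov: "\<And>s t. s > 0 \<Longrightarrow> t > 0 \<Longrightarrow> (LINT \<omega>|N. Z t \<omega> * Z s \<omega>) = (t + s) powr (- \<gamma>)"
  obtains Z' where "case_prod Z' \<in> borel_measurable (borel \<Otimes>\<^sub>M N)"
    "\<And>t. t > 0 \<Longrightarrow> AE \<omega> in N. Z' t \<omega> = Z t \<omega>"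
proof -
  define X where "X t \<omega> = (if t > 0 then Z t \<omega> else 0)" for t \<omega>
  have X[measurable]: "X t \<in> borel_measurable N" for t
    using meas[of t] unfolding X_def[abs_def] by (cases "t > 0") auto
  define Z' where "Z' u \<omega> = lim (\<lambda>n. X (dyadic_above n u) \<omega>)" for u \<omega>
  have "case_prod Z' \<in> borel_measurable (borel \<Otimes>\<^sub>M N)"
    unfolding Z'_def[abs_def] case_prod_beta'
    by (intro borel_measurable_lim_metric measurable_dyadic_above X)
  moreover have "AE \<omega> in N. Z' t \<omega> = Z t \<omega>" if t: "t > 0" for t
  proof -
    define w where "w n = dyadic_above n t" for n
    have w: "t < w n" "w n \<le> t + 1 / 2 ^ n" for n
      using dyadic_above_bounds[where u=t and n=n] by (auto simp: w_def)
    then have w0: "w n > 0" for n using t by (meson less_trans)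
    let ?c = "\<gamma> * (\<gamma> + 1) * (2 * t) powr (-\<gamma> - 2)"
    have E: "(\<integral>\<^sup>+\<omega>. ennreal ((X (w n) \<omega> - Z t \<omega>)\<^sup>2) \<partial>N) \<le> ennreal (?c * (1 / 4) ^ n)" for n
    proof -
      have eq: "(\<lambda>\<omega>. (X (w n) \<omega> - Z t \<omega>)\<^sup>2) = (\<lambda>\<omega>. Z (w n) \<omega> * Z (w n) \<omega> - 2 * (Z (w n) \<omega> * Z t \<omega>) + Z t \<omega> * Z t \<omega>)"
        using w0[of n] by (auto simp: X_def power2_eq_square algebra_simps)
      have int: "integrable N (\<lambda>\<omega>. (X (w n) \<omega> - Z t \<omega>)\<^sup>2)"
        unfolding eq using prod t w0 by auto
      define h where "h = w n - t"
      have h: "0 < h" "h \<le> 1 / 2 ^ n" using w[of n] by (auto simp: h_def)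
      have "(LINT \<omega>|N. (X (w n) \<omega> - Z t \<omega>)\<^sup>2) = (w n + w n) powr (-\<gamma>) - 2 * (w n + t) powr (-\<gamma>) + (t + t) powr (-\<gamma>)"
        unfolding eq using prod t w0 cov by simp
      also have "\<dots> = (2 * t) powr (-\<gamma>) - 2 * (2 * t + h) powr (-\<gamma>) + (2 * t + 2 * h) powr (-\<gamma>)"
        by (simp add: h_def algebra_simps)
      also have "\<dots> \<le> \<gamma> * (\<gamma> + 1) * h\<^sup>2 * (2 * t) powr (-\<gamma> - 2)"
        using t h \<gamma> by (intro powr_second_diff_bounds) auto
      also have "\<dots> \<le> \<gamma> * (\<gamma> + 1) * (1 / 2 ^ n)\<^sup>2 * (2 * t) powr (-\<gamma> - 2)"
        using \<gamma> h by (intro mult_right_mono mult_left_mono power_mono) auto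
      also have "(1 / 2 ^ n)\<^sup>2 = (1 / 4 :: real) ^ n"
        by (simp add: power_one_over power2_eq_square power_mult_distrib[symmetric])
      finally have "(LINT \<omega>|N. (X (w n) \<omega> - Z t \<omega>)\<^sup>2) \<le> ?c * (1 / 4) ^ n" by (simp add: mult_ac)
      then show ?thesis using int by (subst nn_integral_eq_integral) (auto intro!: ennreal_leI)
    qed
    have "(\<integral>\<^sup>+\<omega>. (\<Sum>n. ennreal ((X (w n) \<omega> - Z t \<omega>)\<^sup>2)) \<partial>N) = (\<Sum>n. \<integral>\<^sup>+\<omega>. ennreal ((X (w n) \<omega> - Z t \<omega>)\<^sup>2) \<partial>N)"
      using meas[OF t] by (intro nn_integral_suminf) measurable
    also have "\<dots> \<le> (\<Sum>n. ennreal (?c * (1 / 4) ^ n))" by (intro suminf_le E) auto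
    also have "\<dots> = ennreal (\<Sum>n. ?c * (1 / 4) ^ n)"
      using \<gamma> by (intro suminf_ennreal2) (auto intro!: summable_mult summable_geometric)
    also have "\<dots> < \<infinity>" by simp
    finally have "(\<integral>\<^sup>+\<omega>. (\<Sum>n. ennreal ((X (w n) \<omega> - Z t \<omega>)\<^sup>2)) \<partial>N) \<noteq> \<infinity>" by simp
    then have "AE \<omega> in N. (\<Sum>n. ennreal ((X (w n) \<omega> - Z t \<omega>)\<^sup>2)) \<noteq> \<infinity>"
      using meas[OF t] by (intro nn_integral_noteq_infinite) measurable
    then show ?thesis
    proof (rule eventually_mono)
      fix \<omega> assume "(\<Sum>n. ennreal ((X (w n) \<omega> - Z t \<omega>)\<^sup>2)) \<noteq> \<infinity>"
      then have "summable (\<lambda>n. (X (w n) \<omega> - Z t \<omega>)\<^sup>2)"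
        by (intro summable_suminf_not_top) auto
      then have "(\<lambda>n. (X (w n) \<omega> - Z t \<omega>)\<^sup>2) \<longlonglongrightarrow> 0" by (rule summable_LIMSEQ_zero)
      then have "(\<lambda>n. sqrt ((X (w n) \<omega> - Z t \<omega>)\<^sup>2)) \<longlonglongrightarrow> sqrt 0" by (rule tendsto_real_sqrt)
      then have "(\<lambda>n. X (w n) \<omega> - Z t \<omega>) \<longlonglongrightarrow> 0" by (simp add: tendsto_rabs_zero_iff)
      then have "(\<lambda>n. X (w n) \<omega>) \<longlonglongrightarrow> Z t \<omega>" by (simp add: LIM_zero_iff)
      then show "Z' t \<omega> = Z t \<omega>" unfolding Z'_def w_def[symmetric] by (rule limI)
    qed
  qed
  ultimately show ?thesis by (rule that)
qed

text \<open>The process is the pointwise limit of its values at dyadic times.\<close>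
lemma measurable_continuous_paths:
  fixes X :: "real \<Rightarrow> 'b \<Rightarrow> real"
  assumes "\<And>t. X t \<in> borel_measurable N" "\<And>\<omega>. \<omega> \<in> space N \<Longrightarrow> continuous_on UNIV (\<lambda>t. X t \<omega>)"
  shows "case_prod X \<in> borel_measurable (borel \<Otimes>\<^sub>M N)"
proof (rule borel_measurable_LIMSEQ_real)
  show "(\<lambda>z. X (dyadic_above n (fst z)) (snd z)) \<in> borel_measurable (borel \<Otimes>\<^sub>M N)" for n
    by (rule measurable_dyadic_above[OF assms(1)])
  fix z :: "real \<times> 'b" assume "z \<in> space (borel \<Otimes>\<^sub>M N)"
  then have "snd z \<in> space N" by (auto simp: space_pair_measure)
  then have "isCont (\<lambda>t. X t (snd z)) (fst z)"
    using assms(2) by (auto simp: continuous_on_eq_continuous_at)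
  then show "(\<lambda>n. X (dyadic_above n (fst z)) (snd z)) \<longlonglongrightarrow> case_prod X z"
    using dyadic_above_tendsto by (auto simp: case_prod_beta' intro: isCont_tendsto_compose[of _ "\<lambda>t. X t (snd z)"])
qed

section \<open>Step processes\<close>

abbreviation plane_times :: "'b measure \<Rightarrow> ((real \<times> real) \<times> 'b) measure" where
  "plane_times N \<equiv> (lborel \<Otimes>\<^sub>M lborel) \<Otimes>\<^sub>M N"

text \<open>The integrand of the signed counterpart of \<open>riesz_form\<close>, on the product of the plane with
  the probability space.\<close>
definition riesz_integrand :: "real \<Rightarrow> (real \<Rightarrow> 'b \<Rightarrow> real) \<Rightarrow> (real \<Rightarrow> 'b \<Rightarrow> real) \<Rightarrow> (real \<times> real) \<times> 'b \<Rightarrow> real" where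
  "riesz_integrand q a b z = (case z of ((u, v), \<omega>) \<Rightarrow> \<bar>u - v\<bar> powr q * (a u \<omega> * b v \<omega>))"

lemma riesz_integrand_add:
  "riesz_integrand q (\<lambda>u \<omega>. a u \<omega> + a' u \<omega>) b z = riesz_integrand q a b z + riesz_integrand q a' b z"
  "riesz_integrand q b (\<lambda>u \<omega>. a u \<omega> + a' u \<omega>) z = riesz_integrand q b a z + riesz_integrand q b a' z"
  by (auto simp: riesz_integrand_def algebra_simps split: prod.splits)

lemma pair_sigma_finite_plane:
  assumes "prob_space N" shows "pair_sigma_finite ((lborel :: real measure) \<Otimes>\<^sub>M (lborel :: real measure)) N"
proof -
  interpret prob_space N by fact
  show ?thesis
    by (intro pair_sigma_finite.intro sigma_finite_pair_measure lborel.sigma_finite_measure_axioms sigma_finite_measure_axioms)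
qed

lemma measurable_riesz_integrand:
  assumes [measurable]: "case_prod a \<in> borel_measurable (borel \<Otimes>\<^sub>M N)" "case_prod b \<in> borel_measurable (borel \<Otimes>\<^sub>M N)"
  shows "riesz_integrand q a b \<in> borel_measurable (plane_times N)"
  unfolding riesz_integrand_def[abs_def] case_prod_beta by measurable

lemma nn_integral_riesz_integrand:
  assumes N: "prob_space N"
    and [measurable]: "case_prod a \<in> borel_measurable (borel \<Otimes>\<^sub>M N)" "case_prod b \<in> borel_measurable (borel \<Otimes>\<^sub>M N)"
  shows "(\<integral>\<^sup>+z. ennreal \<bar>riesz_integrand q a b z\<bar> \<partial>plane_times N) =
     riesz_form N q (\<lambda>u \<omega>. ennreal \<bar>a u \<omega>\<bar>) (\<lambda>v \<omega>. ennreal \<bar>b v \<omega>\<bar>)"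
proof -
  interpret prob_space N by fact
  interpret P: pair_sigma_finite "(lborel :: real measure) \<Otimes>\<^sub>M (lborel :: real measure)" N
    by (rule pair_sigma_finite_plane[OF N])
  note [measurable] = measurable_riesz_integrand[OF assms(2,3)]
  have "(\<integral>\<^sup>+z. ennreal \<bar>riesz_integrand q a b z\<bar> \<partial>plane_times N) =
     (\<integral>\<^sup>+p. \<integral>\<^sup>+\<omega>. ennreal \<bar>riesz_integrand q a b (p, \<omega>)\<bar> \<partial>N \<partial>(lborel \<Otimes>\<^sub>M lborel))"
    by (rule nn_integral_fst[symmetric]) measurable
  also have "\<dots> = (\<integral>\<^sup>+u. \<integral>\<^sup>+v. \<integral>\<^sup>+\<omega>. ennreal \<bar>riesz_integrand q a b ((u, v), \<omega>)\<bar> \<partial>N \<partial>lborel \<partial>lborel)"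
    by (rule lborel.nn_integral_fst[symmetric]) measurable
  also have "\<dots> = riesz_form N q (\<lambda>u \<omega>. ennreal \<bar>a u \<omega>\<bar>) (\<lambda>v \<omega>. ennreal \<bar>b v \<omega>\<bar>)"
    by (simp add: riesz_form_def riesz_integrand_def abs_mult ennreal_mult)
  finally show ?thesis .
qed

lemma integrable_riesz_integrand_iff:
  assumes N: "prob_space N"
    and [measurable]: "case_prod a \<in> borel_measurable (borel \<Otimes>\<^sub>M N)" "case_prod b \<in> borel_measurable (borel \<Otimes>\<^sub>M N)"
  shows "integrable (plane_times N) (riesz_integrand q a b) \<longleftrightarrow>
     riesz_form N q (\<lambda>u \<omega>. ennreal \<bar>a u \<omega>\<bar>) (\<lambda>v \<omega>. ennreal \<bar>b v \<omega>\<bar>) < \<infinity>"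
  using measurable_riesz_integrand[OF assms(2,3)] nn_integral_riesz_integrand[OF assms]
  by (simp add: integrable_iff_bounded)

lemma measurable_step_value:
  assumes Y: "Y \<in> N \<rightarrow>\<^sub>M E" and S: "S \<in> step_processes N E Y t"
  shows "case_prod (step_value Y S) \<in> borel_measurable (borel \<Otimes>\<^sub>M N)"
  using S
proof (induction S)
  case Nil
  then show ?case by (simp add: step_value_def[abs_def])
next
  case (Cons x S)
  obtain a b g where x: "x = (a, b, g)" by (cases x) auto
  from Cons have [measurable]: "g \<in> borel_measurable E" and S: "S \<in> step_processes N E Y t"
    by (auto simp: step_processes_def x)
  note [measurable] = Y Cons.IH[OF S]
  have "case_prod (step_value Y (x # S)) =
     (\<lambda>z. g (Y (snd z)) * indicator {a<..b} (fst z) + step_value Y S (fst z) (snd z))"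
    by (auto simp: step_value_def x)
  then show ?case by simp
qed

text \<open>Both sides are bilinear in the two step processes, so it is enough to consider single terms.
  For these, independence separates the expectation of the coefficients from that of the
  increments of the fractional Brownian motion.\<close>
lemma step_integral_isometry:
  fixes N :: "'b measure" and Y :: "'b \<Rightarrow> real \<Rightarrow> real" and S T :: "(real \<Rightarrow> real) step_process"
  assumes N: "prob_space N" and B: "fractional_brownian_motion N H B" and H: "1 / 2 < H"
    and indep: "prob_space.indep_var N E Y (path_space {0..}) (path_on {0..} B)"
    and S: "S \<in> step_processes N E Y t" and T: "T \<in> step_processes N E Y s"
  shows "integrable N (\<lambda>\<omega>. step_integral B Y S \<omega> * step_integral B Y T \<omega>) \<and>
    integrable (plane_times N) (riesz_integrand (2 * H - 2) (step_value Y S) (step_value Y T)) \<and>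
    (LINT \<omega>|N. step_integral B Y S \<omega> * step_integral B Y T \<omega>) =
      H * (2 * H - 1) * (LINT z|plane_times N. riesz_integrand (2 * H - 2) (step_value Y S) (step_value Y T) z)"
proof -
  interpret prob_space N by fact
  interpret P: pair_sigma_finite "(lborel :: real measure) \<Otimes>\<^sub>M (lborel :: real measure)" N
    by (rule pair_sigma_finite_plane[OF N])
  have Y[measurable]: "Y \<in> N \<rightarrow>\<^sub>M E" using indep by (auto simp: indep_var_eq)
  let ?q = "2 * H - 2" and ?c = "H * (2 * H - 1)"
  define val where "val x r \<omega> = (case x of (a, b, g) \<Rightarrow> g (Y \<omega>) * (indicator {a<..b} r :: real))"
    for x :: "real \<times> real \<times> ((real \<Rightarrow> real) \<Rightarrow> real)" and r \<omega>
  define int where "int x \<omega> = (case x of (a, b, g) \<Rightarrow> g (Y \<omega>) * (B b \<omega> - B a \<omega>))"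
    for x :: "real \<times> real \<times> ((real \<Rightarrow> real) \<Rightarrow> real)" and \<omega>
  define ok where "ok x \<longleftrightarrow> (case x of (a, b, g) \<Rightarrow> 0 \<le> a \<and> a \<le> b \<and> g \<in> borel_measurable E \<and> integrable N (\<lambda>\<omega>. (g (Y \<omega>))\<^sup>2))"
    for x :: "real \<times> real \<times> ((real \<Rightarrow> real) \<Rightarrow> real)"
  \<comment> \<open>The claim for a pair of (integral, integrand) pairs, closed under addition in each argument.\<close>
  define good where "good I V J W \<longleftrightarrow> integrable N (\<lambda>\<omega>. I \<omega> * J \<omega>) \<and>
    integrable (plane_times N) (riesz_integrand ?q V W) \<and>
    (LINT \<omega>|N. I \<omega> * J \<omega>) = ?c * (LINT z|plane_times N. riesz_integrand ?q V W z)"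
    for I J :: "'b \<Rightarrow> real" and V W :: "real \<Rightarrow> 'b \<Rightarrow> real"
  have single: "good (int x) (val x) (int y) (val y)" if ok: "ok x" "ok y" for x y
  proof -
    obtain a b g c d g' where xy: "x = (a, b, g)" "y = (c, d, g')" by (cases x, cases y) auto
    have le: "0 \<le> a" "a \<le> b" "0 \<le> c" "c \<le> d" and g[measurable]: "g \<in> borel_measurable E" "g' \<in> borel_measurable E"
      and sq: "integrable N (\<lambda>\<omega>. (g (Y \<omega>))\<^sup>2)" "integrable N (\<lambda>\<omega>. (g' (Y \<omega>))\<^sup>2)"
      using ok by (auto simp: ok_def xy)
    let ?G = "\<lambda>\<omega>. g (Y \<omega>) * g' (Y \<omega>)" and ?D = "\<lambda>\<omega>. (B b \<omega> - B a \<omega>) * (B d \<omega> - B c \<omega>)"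
    let ?R = "\<lambda>p. \<bar>fst p - snd p\<bar> powr ?q * (indicator {a<..b} (fst p) * indicator {c<..d} (snd p)) :: real"
    have iG: "integrable N ?G" using sq by (intro integrable_mult_of_squares) auto
    note inc = fbm_increment_covariance[OF N B H le]
    have "indep_var borel ((\<lambda>y. g y * g' y) \<circ> Y) borel ((\<lambda>p. (p b - p a) * (p d - p c)) \<circ> path_on {0..} B)"
    proof (rule indep_var_compose[OF indep])
      have eval: "(\<lambda>p. p x) \<in> borel_measurable (path_space {0..})" if "x \<ge> 0" for x
        using that by (intro measurable_component_singleton) auto
      show "(\<lambda>p. (p b - p a) * (p d - p c)) \<in> borel_measurable (path_space {0..})"
        by (intro borel_measurable_times borel_measurable_diff eval) (use le in auto)
    qed measurable
    also have "(\<lambda>p. (p b - p a) * (p d - p c)) \<circ> path_on {0..} B = ?D"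
      using le by (auto simp: path_on_def)
    also have "(\<lambda>y. g y * g' y) \<circ> Y = ?G" by auto
    finally have ind: "indep_var borel ?G borel ?D" .
    have I: "(\<lambda>\<omega>. int x \<omega> * int y \<omega>) = (\<lambda>\<omega>. ?G \<omega> * ?D \<omega>)" by (auto simp: int_def xy mult_ac)
    have E: "integrable N (\<lambda>\<omega>. int x \<omega> * int y \<omega>)" "(LINT \<omega>|N. int x \<omega> * int y \<omega>) = (LINT \<omega>|N. ?G \<omega>) * (LINT \<omega>|N. ?D \<omega>)"
      unfolding I using indep_var_integrable[OF ind iG inc(1)] indep_var_lebesgue_integral[OF ind iG inc(1)] by auto
    have [measurable]: "?R \<in> borel_measurable (lborel \<Otimes>\<^sub>M lborel)" by measurable
    have Rn: "ennreal ?c * (\<integral>\<^sup>+p. ennreal (?R p) \<partial>(lborel \<Otimes>\<^sub>M lborel)) = ennreal (LINT \<omega>|N. ?D \<omega>)"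
      unfolding inc(2) by (subst lborel.nn_integral_fst[symmetric])
        (auto simp: ennreal_mult' ennreal_indicator[symmetric] simp del: ennreal_indicator)
    have c: "?c > 0" using H by (intro mult_pos_pos) auto
    have Rfin: "(\<integral>\<^sup>+p. ennreal (?R p) \<partial>(lborel \<Otimes>\<^sub>M lborel)) < \<infinity>"
    proof (rule ccontr)
      assume "\<not> (\<integral>\<^sup>+p. ennreal (?R p) \<partial>(lborel \<Otimes>\<^sub>M lborel)) < \<infinity>"
      then have "(\<integral>\<^sup>+p. ennreal (?R p) \<partial>(lborel \<Otimes>\<^sub>M lborel)) = \<infinity>" by (simp add: less_top[symmetric])
      then show False using Rn H by (auto simp: ennreal_mult_top split: if_splits)
    qed
    have R: "integrable (lborel \<Otimes>\<^sub>M lborel) ?R" using Rfin by (simp add: integrable_iff_bounded)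
    have R0: "AE p in lborel \<Otimes>\<^sub>M lborel. 0 \<le> ?R p" by (intro AE_I2) simp
    have RL: "?c * (LINT p|(lborel \<Otimes>\<^sub>M lborel). ?R p) = (LINT \<omega>|N. ?D \<omega>)"
    proof -
      have "ennreal (?c * (LINT p|(lborel \<Otimes>\<^sub>M lborel). ?R p)) = ennreal (LINT \<omega>|N. ?D \<omega>)"
        unfolding Rn[symmetric] nn_integral_eq_integral[OF R R0] using less_imp_le[OF c] by (rule ennreal_mult')
      moreover have "0 \<le> ?c * (LINT p|(lborel \<Otimes>\<^sub>M lborel). ?R p)"
        using less_imp_le[OF c] R0 by (intro mult_nonneg_nonneg[OF _ integral_nonneg_AE])
      ultimately show ?thesis using inc(3) by (simp add: ennreal_inj)
    qed
    have V: "riesz_integrand ?q (val x) (val y) = (\<lambda>z. ?R (fst z) * ?G (snd z))"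
      by (auto simp: riesz_integrand_def val_def xy)
    have [measurable]: "(\<lambda>z. ?R (fst z) * ?G (snd z)) \<in> borel_measurable (plane_times N)" by measurable
    have PI: "integrable (plane_times N) (\<lambda>z. ?R (fst z) * ?G (snd z))"
    proof (rule P.Fubini_integrable)
      show "integrable (lborel \<Otimes>\<^sub>M lborel) (\<lambda>p. LINT \<omega>|N. norm (?R (fst (p, \<omega>)) * ?G (snd (p, \<omega>))))"
        using R by (simp add: abs_mult)
      show "AE p in lborel \<Otimes>\<^sub>M lborel. integrable N (\<lambda>\<omega>. ?R (fst (p, \<omega>)) * ?G (snd (p, \<omega>)))"
        using iG by simp
    qed measurable
    have PL: "(LINT z|plane_times N. ?R (fst z) * ?G (snd z)) = (LINT p|(lborel \<Otimes>\<^sub>M lborel). ?R p) * (LINT \<omega>|N. ?G \<omega>)"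
      by (subst P.integral_fst'[OF PI, symmetric]) simp
    show ?thesis
      unfolding good_def V using E PI PL RL by (simp add: mult.commute)
  qed
  have add_left: "good (\<lambda>\<omega>. I \<omega> + I' \<omega>) (\<lambda>r \<omega>. V r \<omega> + V' r \<omega>) J W" if "good I V J W" "good I' V' J W" for I I' V V' J W
  proof -
    have "(\<lambda>\<omega>. (I \<omega> + I' \<omega>) * J \<omega>) = (\<lambda>\<omega>. I \<omega> * J \<omega> + I' \<omega> * J \<omega>)" by (simp add: algebra_simps)
    then show ?thesis using that unfolding good_def riesz_integrand_add by (simp add: riesz_integrand_add distrib_left)
  qed
  have add_right: "good J W (\<lambda>\<omega>. I \<omega> + I' \<omega>) (\<lambda>r \<omega>. V r \<omega> + V' r \<omega>)" if "good J W I V" "good J W I' V'" for I I' V V' J W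
  proof -
    have "(\<lambda>\<omega>. J \<omega> * (I \<omega> + I' \<omega>)) = (\<lambda>\<omega>. J \<omega> * I \<omega> + J \<omega> * I' \<omega>)" by (simp add: algebra_simps)
    then show ?thesis using that unfolding good_def riesz_integrand_add by (simp add: riesz_integrand_add distrib_left)
  qed
  have zero: "good (\<lambda>_. 0) (\<lambda>_ _. 0) J W" "good J W (\<lambda>_. 0) (\<lambda>_ _. 0)" for J W
    by (simp_all add: good_def riesz_integrand_def[abs_def] case_prod_beta')
  have row: "good (int x) (val x) (step_integral B Y T) (step_value Y T)" if "ok x" "\<And>y. y \<in> set T \<Longrightarrow> ok y" for x T
    using that(2)
  proof (induction T)
    case Nil then show ?case using zero(2) by (simp add: step_integral_def[abs_def] step_value_def[abs_def])
  next
    case (Cons y T)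
    have "step_integral B Y (y # T) = (\<lambda>\<omega>. int y \<omega> + step_integral B Y T \<omega>)"
      "step_value Y (y # T) = (\<lambda>r \<omega>. val y r \<omega> + step_value Y T r \<omega>)"
      by (auto simp: step_integral_def step_value_def int_def val_def fun_eq_iff)
    then show ?case using add_right[OF single[OF that(1), of y] Cons.IH] Cons.prems by simp
  qed
  have "good (step_integral B Y S) (step_value Y S) (step_integral B Y T) (step_value Y T)"
    if "\<And>x. x \<in> set S \<Longrightarrow> ok x" "\<And>y. y \<in> set T \<Longrightarrow> ok y" for S T
    using that(1)
  proof (induction S)
    case Nil then show ?case using zero(1) by (simp add: step_integral_def[abs_def] step_value_def[abs_def])
  next
    case (Cons x S)
    have "step_integral B Y (x # S) = (\<lambda>\<omega>. int x \<omega> + step_integral B Y S \<omega>)"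
      "step_value Y (x # S) = (\<lambda>r \<omega>. val x r \<omega> + step_value Y S r \<omega>)"
      by (auto simp: step_integral_def step_value_def int_def val_def fun_eq_iff)
    then show ?case using add_left[OF row[of x T] Cons.IH] Cons.prems that(2) by simp
  qed
  moreover have "\<And>x. x \<in> set S \<Longrightarrow> ok x" "\<And>y. y \<in> set T \<Longrightarrow> ok y"
    using S T by (force simp: step_processes_def ok_def)+
  ultimately show ?thesis by (auto simp: good_def)
qed

section \<open>Covariance of the Wiener integral\<close>

lemma ennreal_tendsto_0_of_square:
  fixes e b :: "nat \<Rightarrow> ennreal"
  assumes "\<And>n. (e n)\<^sup>2 \<le> b n" "b \<longlonglongrightarrow> 0"
  shows "e \<longlonglongrightarrow> 0"
proof (rule order_tendstoI)
  fix y :: ennreal assume y: "0 < y"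
  then have "0 < y\<^sup>2" by (simp add: power2_eq_square ennreal_zero_less_mult_iff)
  then have "\<forall>\<^sub>F n in sequentially. b n < y\<^sup>2" using assms(2) by (rule order_tendstoD(2)[rotated])
  then show "\<forall>\<^sub>F n in sequentially. e n < y"
  proof (rule eventually_mono)
    fix n assume "b n < y\<^sup>2"
    then have "(e n)\<^sup>2 < y\<^sup>2" using assms(1)[of n] by (rule le_less_trans[rotated])
    then show "e n < y" by (metis not_le power_mono zero_le)
  qed
qed auto

text \<open>Continuity of a bilinear form, reduced to numbers: \<open>p\<close> and \<open>q\<close> are the squared distances of
  the approximations to their limits, \<open>f\<close> and \<open>f'\<close> the squared norms of the limits, \<open>r\<close> the squared
  norm of the second approximation. The error splits as \<open>(S - F, T) + (F, T - F')\<close>, with both parts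
  controlled by the Cauchy-Schwarz inequality. It is applied to the form with the singular
  kernel and to the inner product of \<open>L\<^sup>2\<close>.\<close>
lemma limit_of_bilinear_form:
  fixes p q r e1 e2 :: "nat \<Rightarrow> ennreal" and i :: "nat \<Rightarrow> real"
  assumes lim: "p \<longlonglongrightarrow> 0" "q \<longlonglongrightarrow> 0" and fin: "f < \<infinity>" "f' < \<infinity>"
    and e1: "\<And>n. (e1 n)\<^sup>2 \<le> p n * r n" and r: "\<And>n. r n \<le> 2 * q n + 2 * f'"
    and e2: "\<And>n. (e2 n)\<^sup>2 \<le> f * q n" and i: "\<And>n. ennreal \<bar>i n - l\<bar> \<le> e1 n + e2 n"
  shows "i \<longlonglongrightarrow> l"
proof -
  have "(\<lambda>n. 2 * q n + 2 * f') \<longlonglongrightarrow> 2 * 0 + 2 * f'"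
    using lim by (intro tendsto_add tendsto_mult_ennreal tendsto_const) auto
  then have "(\<lambda>n. p n * (2 * q n + 2 * f')) \<longlonglongrightarrow> 0 * (2 * 0 + 2 * f')"
    using lim fin by (intro tendsto_mult_ennreal) (auto simp: ennreal_mult_eq_top_iff)
  then have "(\<lambda>n. p n * (2 * q n + 2 * f')) \<longlonglongrightarrow> 0" by simp
  then have 1: "e1 \<longlonglongrightarrow> 0"
    by (rule ennreal_tendsto_0_of_square[rotated]) (meson e1 r mult_left_mono order_trans zero_le)
  have "(\<lambda>n. f * q n) \<longlonglongrightarrow> f * 0" using lim fin by (intro tendsto_mult_ennreal tendsto_const) auto
  then have 2: "e2 \<longlonglongrightarrow> 0" by (intro ennreal_tendsto_0_of_square[OF e2]) simp
  have "(\<lambda>n. e1 n + e2 n) \<longlonglongrightarrow> 0" using tendsto_add[OF 1 2] by simp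
  then have "(\<lambda>n. ennreal \<bar>i n - l\<bar>) \<longlonglongrightarrow> 0"
    by (rule tendsto_sandwich[OF _ _ tendsto_const, rotated 2]) (auto simp: i)
  then have "(\<lambda>n. \<bar>i n - l\<bar>) \<longlonglongrightarrow> 0" by (subst (asm) ennreal_tendsto_0_iff) auto
  then show ?thesis by (simp add: tendsto_rabs_zero_iff LIM_zero_iff)
qed

text \<open>Convergence of \<open>S n\<close> and \<open>T n\<close> in the norm of the form first shows that the limits have finite
  norm, so that the limiting integrand is integrable, and then the bilinear form is continuous.\<close>
lemma riesz_integral_limit:
  fixes S T :: "nat \<Rightarrow> real \<Rightarrow> 'b \<Rightarrow> real"
  assumes N: "prob_space N" and q: "-1 < q" "q < 0"
    and mS[measurable]: "\<And>n. case_prod (S n) \<in> borel_measurable (borel \<Otimes>\<^sub>M N)"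
    and mT[measurable]: "\<And>n. case_prod (T n) \<in> borel_measurable (borel \<Otimes>\<^sub>M N)"
    and mF[measurable]: "case_prod F \<in> borel_measurable (borel \<Otimes>\<^sub>M N)" "case_prod F' \<in> borel_measurable (borel \<Otimes>\<^sub>M N)"
    and S: "(\<lambda>n. riesz_form N q (\<lambda>u \<omega>. ennreal \<bar>S n u \<omega> - F u \<omega>\<bar>) (\<lambda>u \<omega>. ennreal \<bar>S n u \<omega> - F u \<omega>\<bar>)) \<longlonglongrightarrow> 0"
    and T: "(\<lambda>n. riesz_form N q (\<lambda>u \<omega>. ennreal \<bar>T n u \<omega> - F' u \<omega>\<bar>) (\<lambda>u \<omega>. ennreal \<bar>T n u \<omega> - F' u \<omega>\<bar>)) \<longlonglongrightarrow> 0"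
    and Sf: "\<And>n. riesz_form N q (\<lambda>u \<omega>. ennreal \<bar>S n u \<omega>\<bar>) (\<lambda>u \<omega>. ennreal \<bar>S n u \<omega>\<bar>) < \<infinity>"
    and Tf: "\<And>n. riesz_form N q (\<lambda>u \<omega>. ennreal \<bar>T n u \<omega>\<bar>) (\<lambda>u \<omega>. ennreal \<bar>T n u \<omega>\<bar>) < \<infinity>"
  shows "integrable (plane_times N) (riesz_integrand q F F')"
    and "(\<lambda>n. LINT z|plane_times N. riesz_integrand q (S n) (T n) z) \<longlonglongrightarrow> (LINT z|plane_times N. riesz_integrand q F F' z)"
proof -
  let ?R = "\<lambda>a b. riesz_form N q (\<lambda>u \<omega>. ennreal \<bar>a u \<omega>\<bar>) (\<lambda>u \<omega>. ennreal \<bar>b u \<omega>\<bar>)"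
  have CS: "(?R a b)\<^sup>2 \<le> ?R a a * ?R b b"
    if [measurable]: "case_prod a \<in> borel_measurable (borel \<Otimes>\<^sub>M N)" "case_prod b \<in> borel_measurable (borel \<Otimes>\<^sub>M N)"
    for a b :: "real \<Rightarrow> 'b \<Rightarrow> real"
    by (intro riesz_form_Cauchy_Schwarz N q) measurable
  have fin2: "?R a b < \<infinity>" if "?R a a < \<infinity>" "?R b b < \<infinity>"
    and [measurable]: "case_prod a \<in> borel_measurable (borel \<Otimes>\<^sub>M N)" "case_prod b \<in> borel_measurable (borel \<Otimes>\<^sub>M N)"
    for a b :: "real \<Rightarrow> 'b \<Rightarrow> real"
  proof -
    have "(?R a b)\<^sup>2 < \<infinity>" using CS[OF that(3,4)] that(1,2) by (simp add: ennreal_mult_less_top le_less_trans)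
    then show ?thesis by (simp add: power_less_top_ennreal)
  qed
  have tri: "?R a a \<le> 2 * ?R (\<lambda>u \<omega>. a u \<omega> - b u \<omega>) (\<lambda>u \<omega>. a u \<omega> - b u \<omega>) + 2 * ?R b b"
    if [measurable]: "case_prod a \<in> borel_measurable (borel \<Otimes>\<^sub>M N)" "case_prod b \<in> borel_measurable (borel \<Otimes>\<^sub>M N)"
    for a b :: "real \<Rightarrow> 'b \<Rightarrow> real"
    by (intro riesz_form_quasi_triangle N q; (measurable)?) (auto simp: ennreal_plus[symmetric] simp del: ennreal_plus intro!: ennreal_leI)
  have finF: "?R F F < \<infinity>"
    if [measurable]: "\<And>n. case_prod (S n) \<in> borel_measurable (borel \<Otimes>\<^sub>M N)" "case_prod F \<in> borel_measurable (borel \<Otimes>\<^sub>M N)"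
      and lim: "(\<lambda>n. ?R (\<lambda>u \<omega>. S n u \<omega> - F u \<omega>) (\<lambda>u \<omega>. S n u \<omega> - F u \<omega>)) \<longlonglongrightarrow> 0" and f: "\<And>n. ?R (S n) (S n) < \<infinity>"
    for S and F :: "real \<Rightarrow> 'b \<Rightarrow> real"
  proof -
    have "\<forall>\<^sub>F n in sequentially. ?R (\<lambda>u \<omega>. S n u \<omega> - F u \<omega>) (\<lambda>u \<omega>. S n u \<omega> - F u \<omega>) < 1"
      using lim by (rule order_tendstoD(2)) simp
    then obtain n where n: "?R (\<lambda>u \<omega>. S n u \<omega> - F u \<omega>) (\<lambda>u \<omega>. S n u \<omega> - F u \<omega>) < 1"
      by (auto simp: eventually_sequentially)
    have "?R F F \<le> 2 * ?R (\<lambda>u \<omega>. S n u \<omega> - F u \<omega>) (\<lambda>u \<omega>. S n u \<omega> - F u \<omega>) + 2 * ?R (S n) (S n)"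
      using tri[of F "S n"] by (simp add: abs_minus_commute[of "F _ _"])
    also have "\<dots> < \<infinity>" using f[of n] n by (auto simp: ennreal_mult_less_top intro: less_trans)
    finally show ?thesis .
  qed
  have fF: "?R F F < \<infinity>" by (rule finF[OF mS mF(1) S Sf])
  have fF': "?R F' F' < \<infinity>" by (rule finF[OF mT mF(2) T Tf])
  note iff = integrable_riesz_integrand_iff[OF N]
  show int: "integrable (plane_times N) (riesz_integrand q F F')"
    using fin2[OF fF fF'] by (simp add: iff)
  show "(\<lambda>n. LINT z|plane_times N. riesz_integrand q (S n) (T n) z) \<longlonglongrightarrow> (LINT z|plane_times N. riesz_integrand q F F' z)"
  proof (rule limit_of_bilinear_form[OF S T fF fF'])
    fix n
    let ?D = "\<lambda>u \<omega>. S n u \<omega> - F u \<omega>" and ?D' = "\<lambda>u \<omega>. T n u \<omega> - F' u \<omega>"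
    show "(?R ?D (T n))\<^sup>2 \<le> ?R ?D ?D * ?R (T n) (T n)" by (rule CS) measurable
    show "?R (T n) (T n) \<le> 2 * ?R ?D' ?D' + 2 * ?R F' F'" by (rule tri) measurable
    show "(?R F ?D')\<^sup>2 \<le> ?R F F * ?R ?D' ?D'" by (rule CS) measurable
    have intST: "integrable (plane_times N) (riesz_integrand q (S n) (T n))"
      using fin2[OF Sf Tf] by (simp add: iff)
    note mm = measurable_riesz_integrand
    have D: "case_prod ?D \<in> borel_measurable (borel \<Otimes>\<^sub>M N)" "case_prod ?D' \<in> borel_measurable (borel \<Otimes>\<^sub>M N)" by measurable
    have eq: "riesz_integrand q (S n) (T n) z - riesz_integrand q F F' z =
       riesz_integrand q ?D (T n) z + riesz_integrand q F ?D' z" for z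
      by (auto simp: riesz_integrand_def algebra_simps split: prod.splits)
    have "ennreal \<bar>(LINT z|plane_times N. riesz_integrand q (S n) (T n) z) - (LINT z|plane_times N. riesz_integrand q F F' z)\<bar> =
      ennreal (norm (LINT z|plane_times N. riesz_integrand q (S n) (T n) z - riesz_integrand q F F' z))"
      using int intST by simp
    also have "\<dots> \<le> (\<integral>\<^sup>+z. ennreal (norm (riesz_integrand q (S n) (T n) z - riesz_integrand q F F' z)) \<partial>plane_times N)"
      by (rule integral_norm_bound_ennreal) (use int intST in simp)
    also have "\<dots> \<le> (\<integral>\<^sup>+z. ennreal \<bar>riesz_integrand q ?D (T n) z\<bar> + ennreal \<bar>riesz_integrand q F ?D' z\<bar> \<partial>plane_times N)"
      unfolding eq by (intro nn_integral_mono) (auto simp: ennreal_plus[symmetric] simp del: ennreal_plus intro!: ennreal_leI abs_triangle_ineq)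
    also have "\<dots> = (\<integral>\<^sup>+z. ennreal \<bar>riesz_integrand q ?D (T n) z\<bar> \<partial>plane_times N) + (\<integral>\<^sup>+z. ennreal \<bar>riesz_integrand q F ?D' z\<bar> \<partial>plane_times N)"
      using mm[OF D(1) mT] mm[OF mF(1) D(2)] by (intro nn_integral_add) auto
    also have "\<dots> = ?R ?D (T n) + ?R F ?D'"
      by (subst nn_integral_riesz_integrand[OF N D(1) mT], subst nn_integral_riesz_integrand[OF N mF(1) D(2)]) simp
    finally show "ennreal \<bar>(LINT z|plane_times N. riesz_integrand q (S n) (T n) z) - (LINT z|plane_times N. riesz_integrand q F F' z)\<bar> \<le> ?R ?D (T n) + ?R F ?D'" .
  qed
qed

lemma square_integrable_iff_nn_integral:
  fixes X :: "'b \<Rightarrow> real"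
  assumes "X \<in> borel_measurable N"
  shows "integrable N (\<lambda>\<omega>. (X \<omega>)\<^sup>2) \<longleftrightarrow> (\<integral>\<^sup>+\<omega>. ennreal ((X \<omega>)\<^sup>2) \<partial>N) < \<infinity>"
  using assms by (simp add: integrable_iff_bounded)

lemma L2_limit_square_integrable:
  fixes X :: "nat \<Rightarrow> 'b \<Rightarrow> real"
  assumes [measurable]: "\<And>n. X n \<in> borel_measurable N" "L \<in> borel_measurable N"
    and sq: "\<And>n. integrable N (\<lambda>\<omega>. (X n \<omega>)\<^sup>2)"
    and lim: "(\<lambda>n. \<integral>\<^sup>+\<omega>. ennreal ((X n \<omega> - L \<omega>)\<^sup>2) \<partial>N) \<longlonglongrightarrow> 0"
  shows "integrable N (\<lambda>\<omega>. (L \<omega>)\<^sup>2)"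
proof -
  have "\<forall>\<^sub>F n in sequentially. (\<integral>\<^sup>+\<omega>. ennreal ((X n \<omega> - L \<omega>)\<^sup>2) \<partial>N) < 1"
    using lim by (rule order_tendstoD(2)) simp
  then obtain n where n: "(\<integral>\<^sup>+\<omega>. ennreal ((X n \<omega> - L \<omega>)\<^sup>2) \<partial>N) < 1" by (auto simp: eventually_sequentially)
  then have "(\<integral>\<^sup>+\<omega>. ennreal ((X n \<omega> - L \<omega>)\<^sup>2) \<partial>N) < \<infinity>" by (auto intro: less_trans)
  then have "integrable N (\<lambda>\<omega>. (X n \<omega> - L \<omega>)\<^sup>2)" by (subst square_integrable_iff_nn_integral) auto
  then have "integrable N (\<lambda>\<omega>. 2 * (X n \<omega>)\<^sup>2 + 2 * (X n \<omega> - L \<omega>)\<^sup>2)" using sq by simp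
  then show ?thesis
  proof (rule Bochner_Integration.integrable_bound)
    show "AE \<omega> in N. norm ((L \<omega>)\<^sup>2) \<le> norm (2 * (X n \<omega>)\<^sup>2 + 2 * (X n \<omega> - L \<omega>)\<^sup>2)"
    proof (intro AE_I2)
      fix \<omega>
      have "0 \<le> (2 * X n \<omega> - L \<omega>)\<^sup>2" by simp
      then have "(L \<omega>)\<^sup>2 \<le> 2 * (X n \<omega>)\<^sup>2 + 2 * (X n \<omega> - L \<omega>)\<^sup>2"
        by (simp add: power2_eq_square algebra_simps)
      then show "norm ((L \<omega>)\<^sup>2) \<le> norm (2 * (X n \<omega>)\<^sup>2 + 2 * (X n \<omega> - L \<omega>)\<^sup>2)" by simp
    qed
  qed measurable
qed

lemma L2_limit_inner_product:
  fixes X Y :: "nat \<Rightarrow> 'b \<Rightarrow> real"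
  assumes m[measurable]: "\<And>n. X n \<in> borel_measurable N" "\<And>n. Y n \<in> borel_measurable N" "L \<in> borel_measurable N" "K \<in> borel_measurable N"
    and X: "\<And>n. integrable N (\<lambda>\<omega>. (X n \<omega>)\<^sup>2)" "(\<lambda>n. \<integral>\<^sup>+\<omega>. ennreal ((X n \<omega> - L \<omega>)\<^sup>2) \<partial>N) \<longlonglongrightarrow> 0"
    and Y: "\<And>n. integrable N (\<lambda>\<omega>. (Y n \<omega>)\<^sup>2)" "(\<lambda>n. \<integral>\<^sup>+\<omega>. ennreal ((Y n \<omega> - K \<omega>)\<^sup>2) \<partial>N) \<longlonglongrightarrow> 0"
  shows "(\<lambda>n. LINT \<omega>|N. X n \<omega> * Y n \<omega>) \<longlonglongrightarrow> (LINT \<omega>|N. L \<omega> * K \<omega>)"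
proof -
  have L: "integrable N (\<lambda>\<omega>. (L \<omega>)\<^sup>2)" by (rule L2_limit_square_integrable[OF m(1,3) X])
  have K: "integrable N (\<lambda>\<omega>. (K \<omega>)\<^sup>2)" by (rule L2_limit_square_integrable[OF m(2,4) Y])
  let ?R = "\<lambda>a b. \<integral>\<^sup>+\<omega>. ennreal \<bar>a \<omega>\<bar> * ennreal \<bar>b \<omega>\<bar> \<partial>N" and ?Q = "\<lambda>a. \<integral>\<^sup>+\<omega>. ennreal ((a \<omega>)\<^sup>2) \<partial>N"
  have CS: "(?R a b)\<^sup>2 \<le> ?Q a * ?Q b" if [measurable]: "a \<in> borel_measurable N" "b \<in> borel_measurable N"
    for a b :: "'b \<Rightarrow> real"
    using Cauchy_Schwarz_nn_integral[of "\<lambda>\<omega>. ennreal \<bar>a \<omega>\<bar>" N "\<lambda>\<omega>. ennreal \<bar>b \<omega>\<bar>"] by (simp add: ennreal_power)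
  show ?thesis
  proof (rule limit_of_bilinear_form[OF X(2) Y(2)])
    show "?Q L < \<infinity>" "?Q K < \<infinity>" using L K by (simp_all add: square_integrable_iff_nn_integral)
    fix n
    let ?D = "\<lambda>\<omega>. X n \<omega> - L \<omega>" and ?D' = "\<lambda>\<omega>. Y n \<omega> - K \<omega>"
    show "(?R ?D (Y n))\<^sup>2 \<le> ?Q ?D * ?Q (Y n)" by (rule CS) measurable
    show "(?R L ?D')\<^sup>2 \<le> ?Q L * ?Q ?D'" by (rule CS) measurable
    have "?Q (Y n) \<le> (\<integral>\<^sup>+\<omega>. 2 * ennreal ((Y n \<omega> - K \<omega>)\<^sup>2) + 2 * ennreal ((K \<omega>)\<^sup>2) \<partial>N)"
    proof (intro nn_integral_mono)
      fix \<omega>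
      have "0 \<le> (Y n \<omega> - 2 * K \<omega>)\<^sup>2" by simp
      then have "(Y n \<omega>)\<^sup>2 \<le> 2 * (Y n \<omega> - K \<omega>)\<^sup>2 + 2 * (K \<omega>)\<^sup>2"
        by (simp add: power2_eq_square algebra_simps)
      then have "ennreal ((Y n \<omega>)\<^sup>2) \<le> ennreal (2 * (Y n \<omega> - K \<omega>)\<^sup>2 + 2 * (K \<omega>)\<^sup>2)" by (rule ennreal_leI)
      then show "ennreal ((Y n \<omega>)\<^sup>2) \<le> 2 * ennreal ((Y n \<omega> - K \<omega>)\<^sup>2) + 2 * ennreal ((K \<omega>)\<^sup>2)"
        by (simp add: ennreal_mult)
    qed
    then show "?Q (Y n) \<le> 2 * ?Q ?D' + 2 * ?Q K" by (simp add: nn_integral_add nn_integral_cmult)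
    have iXY: "integrable N (\<lambda>\<omega>. X n \<omega> * Y n \<omega>)" "integrable N (\<lambda>\<omega>. L \<omega> * K \<omega>)"
      using X Y L K by (auto intro!: integrable_mult_of_squares)
    have eq: "X n \<omega> * Y n \<omega> - L \<omega> * K \<omega> = ?D \<omega> * Y n \<omega> + L \<omega> * ?D' \<omega>" for \<omega>
      by (simp add: algebra_simps)
    have "ennreal \<bar>(LINT \<omega>|N. X n \<omega> * Y n \<omega>) - (LINT \<omega>|N. L \<omega> * K \<omega>)\<bar> =
       ennreal (norm (LINT \<omega>|N. X n \<omega> * Y n \<omega> - L \<omega> * K \<omega>))" using iXY by simp
    also have "\<dots> \<le> (\<integral>\<^sup>+\<omega>. ennreal (norm (X n \<omega> * Y n \<omega> - L \<omega> * K \<omega>)) \<partial>N)"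
      by (rule integral_norm_bound_ennreal) (use iXY in simp)
    also have "\<dots> \<le> (\<integral>\<^sup>+\<omega>. ennreal \<bar>?D \<omega>\<bar> * ennreal \<bar>Y n \<omega>\<bar> + ennreal \<bar>L \<omega>\<bar> * ennreal \<bar>?D' \<omega>\<bar> \<partial>N)"
      unfolding eq
      by (intro nn_integral_mono)
        (auto simp: ennreal_plus[symmetric] ennreal_mult'[symmetric] abs_mult[symmetric] simp del: ennreal_plus
          intro!: ennreal_leI abs_triangle_ineq)
    also have "\<dots> = ?R ?D (Y n) + ?R L ?D'" by (rule nn_integral_add) measurable
    finally show "ennreal \<bar>(LINT \<omega>|N. X n \<omega> * Y n \<omega>) - (LINT \<omega>|N. L \<omega> * K \<omega>)\<bar> \<le> ?R ?D (Y n) + ?R L ?D'" .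
  qed
qed

lemma step_value_outside:
  assumes "S \<in> step_processes N E Y t" "r \<le> 0 \<or> t < r"
  shows "step_value Y S r \<omega> = 0"
  using assms
proof (induction S)
  case (Cons x S)
  obtain a b g where x: "x = (a, b, g)" by (cases x) auto
  from Cons show ?case by (auto simp: x step_value_def step_processes_def indicator_def)
qed (simp add: step_value_def)

text \<open>Replacing \<open>Z\<close> by its measurable version changes no inner expectation, because these involve
  only two time points. The step process may differ from 0 at the single point \<open>t\<close>, which the
  definition of the norm excludes; it is a null set.\<close>
lemma fbm_sqnorm_eq_riesz_form:
  assumes N: "prob_space N" and S: "S \<in> step_processes N E Y t"
    and m[measurable]: "case_prod (step_value Y S) \<in> borel_measurable (borel \<Otimes>\<^sub>M N)"
    and Z: "\<And>u. u > 0 \<Longrightarrow> Z u \<in> borel_measurable N"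
    and Z': "\<And>u. u > 0 \<Longrightarrow> AE \<omega> in N. Z' u \<omega> = Z u \<omega>"
    and F: "F = (\<lambda>r \<omega>. if 0 < r \<and> r < t then Z' (t - r) \<omega> else 0)"
  shows "fbm_sqnorm N H t (\<lambda>r \<omega>. step_value Y S r \<omega> - Z (t - r) \<omega>) =
     ennreal (H * (2 * H - 1)) *
     riesz_form N (2 * H - 2) (\<lambda>u \<omega>. ennreal \<bar>step_value Y S u \<omega> - F u \<omega>\<bar>) (\<lambda>u \<omega>. ennreal \<bar>step_value Y S u \<omega> - F u \<omega>\<bar>)"
proof -
  let ?D = "\<lambda>r \<omega>. step_value Y S r \<omega> - Z (t - r) \<omega>" and ?D' = "\<lambda>u \<omega>. step_value Y S u \<omega> - F u \<omega>"
  let ?k = "\<lambda>u v. ennreal (\<bar>u - v\<bar> powr (2 * H - 2))"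
  have zero: "?D' u \<omega> = 0" if "u \<notin> {0<..<t}" "u \<noteq> t" for u \<omega>
    using that step_value_outside[OF S, of u \<omega>] by (auto simp: F)
  have eq: "AE \<omega> in N. ?D' u \<omega> = ?D u \<omega>" if "u \<in> {0<..<t}" for u
    using Z'[of "t - u"] that by (auto simp: F elim: eventually_mono)
  have inner: "(\<integral>\<^sup>+\<omega>. ?k u v * (ennreal \<bar>?D' u \<omega>\<bar> * ennreal \<bar>?D' v \<omega>\<bar>) \<partial>N) =
      ?k u v * (\<integral>\<^sup>+\<omega>. ennreal \<bar>?D u \<omega> * ?D v \<omega>\<bar> \<partial>N) * indicator {0<..<t} v * indicator {0<..<t} u"
    if "u \<noteq> t" "v \<noteq> t" for u v
  proof (cases "u \<in> {0<..<t} \<and> v \<in> {0<..<t}")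
    case True
    then have "AE \<omega> in N. ?k u v * (ennreal \<bar>?D' u \<omega>\<bar> * ennreal \<bar>?D' v \<omega>\<bar>) = ?k u v * ennreal \<bar>?D u \<omega> * ?D v \<omega>\<bar>"
      using eq[of u] eq[of v] by (auto simp: abs_mult ennreal_mult)
    then have "(\<integral>\<^sup>+\<omega>. ?k u v * (ennreal \<bar>?D' u \<omega>\<bar> * ennreal \<bar>?D' v \<omega>\<bar>) \<partial>N) = (\<integral>\<^sup>+\<omega>. ?k u v * ennreal \<bar>?D u \<omega> * ?D v \<omega>\<bar> \<partial>N)"
      by (rule nn_integral_cong_AE)
    also have "\<dots> = ?k u v * (\<integral>\<^sup>+\<omega>. ennreal \<bar>?D u \<omega> * ?D v \<omega>\<bar> \<partial>N)"
    proof (rule nn_integral_cmult)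
      have "Z (t - u) \<in> borel_measurable N" "Z (t - v) \<in> borel_measurable N" using True Z by auto
      then show "(\<lambda>\<omega>. ennreal \<bar>?D u \<omega> * ?D v \<omega>\<bar>) \<in> borel_measurable N" by measurable
    qed
    finally show ?thesis using True by simp
  next
    case False
    then have "(\<integral>\<^sup>+\<omega>. ?k u v * (ennreal \<bar>?D' u \<omega>\<bar> * ennreal \<bar>?D' v \<omega>\<bar>) \<partial>N) = (\<integral>\<^sup>+\<omega>. 0 \<partial>N)"
      using zero that by (intro nn_integral_cong) auto
    then show ?thesis using False by (auto simp: indicator_def)
  qed
  have "riesz_form N (2 * H - 2) (\<lambda>u \<omega>. ennreal \<bar>?D' u \<omega>\<bar>) (\<lambda>u \<omega>. ennreal \<bar>?D' u \<omega>\<bar>) =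
    (\<integral>\<^sup>+u\<in>{0<..<t}. (\<integral>\<^sup>+v\<in>{0<..<t}. ?k u v * (\<integral>\<^sup>+\<omega>. ennreal \<bar>?D u \<omega> * ?D v \<omega>\<bar> \<partial>N) \<partial>lborel) \<partial>lborel)"
    unfolding riesz_form_def
  proof (rule nn_integral_cong_AE, rule eventually_mono[OF AE_lborel_singleton[of t]])
    fix u assume u: "u \<noteq> t"
    have "(\<integral>\<^sup>+v. \<integral>\<^sup>+\<omega>. ?k u v * (ennreal \<bar>?D' u \<omega>\<bar> * ennreal \<bar>?D' v \<omega>\<bar>) \<partial>N \<partial>lborel) =
      (\<integral>\<^sup>+v. ?k u v * (\<integral>\<^sup>+\<omega>. ennreal \<bar>?D u \<omega> * ?D v \<omega>\<bar> \<partial>N) * indicator {0<..<t} v * indicator {0<..<t} u \<partial>lborel)"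
      by (rule nn_integral_cong_AE, rule eventually_mono[OF AE_lborel_singleton[of t]]) (rule inner[OF u])
    also have "\<dots> = (\<integral>\<^sup>+v\<in>{0<..<t}. ?k u v * (\<integral>\<^sup>+\<omega>. ennreal \<bar>?D u \<omega> * ?D v \<omega>\<bar> \<partial>N) \<partial>lborel) * indicator {0<..<t} u"
      by (cases "u \<in> {0<..<t}") auto
    finally show "(\<integral>\<^sup>+v. \<integral>\<^sup>+\<omega>. ?k u v * (ennreal \<bar>?D' u \<omega>\<bar> * ennreal \<bar>?D' v \<omega>\<bar>) \<partial>N \<partial>lborel) = \<dots>" .
  qed
  then show ?thesis unfolding fbm_sqnorm_def by simp
qed

lemma measurable_step_integral:
  assumes [measurable]: "Y \<in> N \<rightarrow>\<^sub>M E" and B: "\<And>b. b \<ge> 0 \<Longrightarrow> B b \<in> borel_measurable N"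
    and S: "S \<in> step_processes N E Y t"
  shows "step_integral B Y S \<in> borel_measurable N"
  using S
proof (induction S)
  case Nil
  then show ?case by (simp add: step_integral_def[abs_def])
next
  case (Cons x S)
  obtain a b g where x: "x = (a, b, g)" by (cases x) auto
  from Cons have [measurable]: "g \<in> borel_measurable E" and S: "S \<in> step_processes N E Y t" and ab: "0 \<le> a" "a \<le> b"
    by (auto simp: step_processes_def x)
  have [measurable]: "B a \<in> borel_measurable N" "B b \<in> borel_measurable N" using ab B by auto
  note [measurable] = Cons.IH[OF S]
  have "step_integral B Y (x # S) = (\<lambda>\<omega>. g (Y \<omega>) * (B b \<omega> - B a \<omega>) + step_integral B Y S \<omega>)"
    by (auto simp: step_integral_def x)
  then show ?case by simp
qed

text \<open>Both sides of the isometry for step processes converge: the left one by convergence of the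
  integrals in \<open>L\<^sup>2\<close>, the right one by convergence of the integrands in the norm.\<close>
lemma fbm_integral_covariance:
  fixes N :: "'b measure" and Y :: "'b \<Rightarrow> real \<Rightarrow> real"
  assumes N: "prob_space N" and B: "fractional_brownian_motion N H B" and H: "1 / 2 < H" "H < 1"
    and Z: "centered_gaussian_process N {0<..} Z" and \<gamma>: "\<gamma> > 0"
    and cov: "\<And>s t. s > 0 \<Longrightarrow> t > 0 \<Longrightarrow> (LINT \<omega>|N. Z t \<omega> * Z s \<omega>) = (t + s) powr (- \<gamma>)"
    and indep: "prob_space.indep_var N E Y (path_space {0..}) (path_on {0..} B)"
    and J: "\<And>t. t \<ge> 0 \<Longrightarrow> has_fbm_integral N H B E Y t (\<lambda>r. Z (t - r)) (J t)"
    and ts: "0 \<le> t" "0 \<le> s"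
  shows "integrable (lborel \<Otimes>\<^sub>M lborel) (variance_kernel H \<gamma> t s)"
    and "(LINT \<omega>|N. J t \<omega> * J s \<omega>) = H * (2 * H - 1) * (LINT p|(lborel \<Otimes>\<^sub>M lborel). variance_kernel H \<gamma> t s p)"
proof -
  interpret prob_space N by fact
  interpret P: pair_sigma_finite "(lborel :: real measure) \<Otimes>\<^sub>M (lborel :: real measure)" N
    by (rule pair_sigma_finite_plane[OF N])
  have Y[measurable]: "Y \<in> N \<rightarrow>\<^sub>M E" using indep by (auto simp: indep_var_eq)
  define c where "c = H * (2 * H - 1)"
  have c: "c > 0" using H by (auto simp: c_def intro!: mult_pos_pos)
  let ?q = "2 * H - 2"
  have q: "-1 < ?q" "?q < 0" using H by auto
  note Zm = centered_gaussian_process_square_integrable[OF N Z]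
  have Zp: "integrable N (\<lambda>\<omega>. Z t \<omega> * Z s \<omega>)" if "s > 0" "t > 0" for s t
    using that Zm by (intro integrable_mult_of_squares) auto
  have m: "\<And>t. t > 0 \<Longrightarrow> Z t \<in> borel_measurable N"
    using Zm by auto
  obtain Z' where Z'm[measurable]: "case_prod Z' \<in> borel_measurable (borel \<Otimes>\<^sub>M N)"
    and Z': "\<And>t. t > 0 \<Longrightarrow> AE \<omega> in N. Z' t \<omega> = Z t \<omega>"
    using measurable_modification[OF N \<gamma> m Zp cov] by blast
  have Bm: "B b \<in> borel_measurable N" if "b \<ge> 0" for b
    using B that centered_gaussian_process_square_integrable(1)[OF N, of "{0..}" B b]
    by (auto simp: fractional_brownian_motion_def)
  define F where "F t r \<omega> = (if 0 < r \<and> r < t then Z' (t - r) \<omega> else 0)" for t r \<omega>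
  have Fm[measurable]: "case_prod (F t) \<in> borel_measurable (borel \<Otimes>\<^sub>M N)" for t
    unfolding F_def[abs_def] case_prod_beta' by measurable
  let ?R = "\<lambda>a. riesz_form N ?q (\<lambda>u \<omega>. ennreal \<bar>a u \<omega>\<bar>) (\<lambda>u \<omega>. ennreal \<bar>a u \<omega>\<bar>)"
  have approx: "\<exists>S. (\<forall>n. S n \<in> step_processes N E Y t) \<and>
      (\<lambda>n. ?R (\<lambda>u \<omega>. step_value Y (S n) u \<omega> - F t u \<omega>)) \<longlonglongrightarrow> 0 \<and>
      (\<lambda>n. \<integral>\<^sup>+\<omega>. ennreal ((step_integral B Y (S n) \<omega> - J t \<omega>)\<^sup>2) \<partial>N) \<longlonglongrightarrow> 0" if t0: "t \<ge> 0" for t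
  proof -
    obtain S where S: "\<And>n. S n \<in> step_processes N E Y t"
      and l: "(\<lambda>n. fbm_sqnorm N H t (\<lambda>r \<omega>. step_value Y (S n) r \<omega> - Z (t - r) \<omega>)) \<longlonglongrightarrow> 0"
      and L2: "(\<lambda>n. \<integral>\<^sup>+\<omega>. ennreal ((step_integral B Y (S n) \<omega> - J t \<omega>)\<^sup>2) \<partial>N) \<longlonglongrightarrow> 0"
      using J[OF t0] by (auto simp: has_fbm_integral_def)
    have eq: "?R (\<lambda>u \<omega>. step_value Y (S n) u \<omega> - F t u \<omega>) =
       ennreal (1 / c) * fbm_sqnorm N H t (\<lambda>r \<omega>. step_value Y (S n) r \<omega> - Z (t - r) \<omega>)" for n
    proof -
      have sq: "fbm_sqnorm N H t (\<lambda>r \<omega>. step_value Y (S n) r \<omega> - Z (t - r) \<omega>) =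
         ennreal c * ?R (\<lambda>u \<omega>. step_value Y (S n) u \<omega> - F t u \<omega>)"
        unfolding c_def
        by (rule fbm_sqnorm_eq_riesz_form[OF N S measurable_step_value[OF Y S] _ Z'])
          (use Zm in \<open>auto simp: F_def fun_eq_iff\<close>)
      have "ennreal (1 / c) * ennreal c = 1" using c by (simp add: ennreal_mult'[symmetric])
      then show ?thesis unfolding sq by (simp add: mult.assoc[symmetric])
    qed
    have "(\<lambda>n. ennreal (1 / c) * fbm_sqnorm N H t (\<lambda>r \<omega>. step_value Y (S n) r \<omega> - Z (t - r) \<omega>)) \<longlonglongrightarrow> ennreal (1 / c) * 0"
      using l by (intro tendsto_mult_ennreal tendsto_const) auto
    then have "(\<lambda>n. ?R (\<lambda>u \<omega>. step_value Y (S n) u \<omega> - F t u \<omega>)) \<longlonglongrightarrow> 0"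
      unfolding eq by (simp only: mult_zero_right)
    then show ?thesis using S L2 by blast
  qed
  obtain S where S: "\<And>n. S n \<in> step_processes N E Y t"
    and S0: "(\<lambda>n. ?R (\<lambda>u \<omega>. step_value Y (S n) u \<omega> - F t u \<omega>)) \<longlonglongrightarrow> 0"
    and SJ: "(\<lambda>n. \<integral>\<^sup>+\<omega>. ennreal ((step_integral B Y (S n) \<omega> - J t \<omega>)\<^sup>2) \<partial>N) \<longlonglongrightarrow> 0"
    using approx[OF ts(1)] by blast
  obtain T where T: "\<And>n. T n \<in> step_processes N E Y s"
    and T0: "(\<lambda>n. ?R (\<lambda>u \<omega>. step_value Y (T n) u \<omega> - F s u \<omega>)) \<longlonglongrightarrow> 0"
    and TJ: "(\<lambda>n. \<integral>\<^sup>+\<omega>. ennreal ((step_integral B Y (T n) \<omega> - J s \<omega>)\<^sup>2) \<partial>N) \<longlonglongrightarrow> 0"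
    using approx[OF ts(2)] by blast
  note iso = step_integral_isometry[OF N B H(1) indep]
  note mv = measurable_step_value[OF Y]
  have RS: "?R (step_value Y S) < \<infinity>" if "S \<in> step_processes N E Y t" for S t
    using iso[OF that that] integrable_riesz_integrand_iff[OF N mv[OF that] mv[OF that], of ?q] by simp
  have sqI: "integrable N (\<lambda>\<omega>. (step_integral B Y S \<omega>)\<^sup>2)" if "S \<in> step_processes N E Y t" for S t
    using iso[OF that that] by (simp add: power2_eq_square)
  have mI: "step_integral B Y S \<in> borel_measurable N" if "S \<in> step_processes N E Y t" for S t
    by (rule measurable_step_integral[OF Y Bm that])
  have mJ: "J t \<in> borel_measurable N" if "t \<ge> 0" for t using J[OF that] by (simp add: has_fbm_integral_def)
  note lim = riesz_integral_limit[OF N q mv[OF S] mv[OF T] Fm Fm S0 T0 RS[OF S] RS[OF T]]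
  have "(\<lambda>n. LINT \<omega>|N. step_integral B Y (S n) \<omega> * step_integral B Y (T n) \<omega>) \<longlonglongrightarrow> (LINT \<omega>|N. J t \<omega> * J s \<omega>)"
    by (rule L2_limit_inner_product[OF mI[OF S] mI[OF T] mJ[OF ts(1)] mJ[OF ts(2)] sqI[OF S] SJ sqI[OF T] TJ])
  moreover have "(\<lambda>n. LINT \<omega>|N. step_integral B Y (S n) \<omega> * step_integral B Y (T n) \<omega>) \<longlonglongrightarrow>
      c * (LINT z|plane_times N. riesz_integrand ?q (F t) (F s) z)"
    using tendsto_mult_left[OF lim(2), of c] iso[OF S T] by (simp add: c_def)
  ultimately have cov_plane: "(LINT \<omega>|N. J t \<omega> * J s \<omega>) = c * (LINT z|plane_times N. riesz_integrand ?q (F t) (F s) z)"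
    by (rule LIMSEQ_unique)
  have kernel: "(LINT \<omega>|N. riesz_integrand ?q (F t) (F s) (p, \<omega>)) = variance_kernel H \<gamma> t s p" for p
  proof -
    obtain u v where p: "p = (u, v)" by (cases p)
    have "(LINT \<omega>|N. riesz_integrand ?q (F t) (F s) (p, \<omega>)) = \<bar>u - v\<bar> powr ?q * (LINT \<omega>|N. F t u \<omega> * F s v \<omega>)"
      by (simp add: riesz_integrand_def p)
    also have "\<dots> = variance_kernel H \<gamma> t s p"
    proof (cases "0 < u \<and> u < t \<and> 0 < v \<and> v < s")
      case True
      have [measurable]: "Z (t - u) \<in> borel_measurable N" "Z (s - v) \<in> borel_measurable N" using True Zm by auto
      have "AE \<omega> in N. F t u \<omega> * F s v \<omega> = Z (t - u) \<omega> * Z (s - v) \<omega>"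
        using Z'[of "t - u"] Z'[of "s - v"] True by (auto simp: F_def)
      then have "(LINT \<omega>|N. F t u \<omega> * F s v \<omega>) = (LINT \<omega>|N. Z (t - u) \<omega> * Z (s - v) \<omega>)"
        by (intro integral_cong_AE) auto
      also have "\<dots> = (t - u + (s - v)) powr (-\<gamma>)" using True cov by simp
      finally show ?thesis using True by (simp add: variance_kernel_def p algebra_simps)
    next
      case False
      then have "(\<lambda>\<omega>. F t u \<omega> * F s v \<omega>) = (\<lambda>\<omega>. 0)" by (auto simp: F_def fun_eq_iff)
      then have "(LINT \<omega>|N. F t u \<omega> * F s v \<omega>) = 0" by (simp only: Bochner_Integration.integral_zero)
      then show ?thesis using False by (auto simp: variance_kernel_def p)
    qed
    finally show ?thesis .
  qed
  show "integrable (lborel \<Otimes>\<^sub>M lborel) (variance_kernel H \<gamma> t s)"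
    using P.integrable_fst'[OF lim(1)] by (simp add: kernel)
  show "(LINT \<omega>|N. J t \<omega> * J s \<omega>) = H * (2 * H - 1) * (LINT p|(lborel \<Otimes>\<^sub>M lborel). variance_kernel H \<gamma> t s p)"
    unfolding cov_plane P.integral_fst'[OF lim(1), symmetric] kernel c_def ..
qed

section \<open>Almost sure regularity\<close>

theorem theorem3p7:
  fixes H \<gamma> :: real
    and N :: "'b measure" and B Z J :: "real \<Rightarrow> 'b \<Rightarrow> real"
    and M :: "'a measure" and G :: "real \<Rightarrow> 'a \<Rightarrow> real"
  assumes "1 / 2 < H" and "H < 1" and "0 < \<gamma>" and "\<gamma> < 2 * H"
    and "prob_space N"
    and "fractional_brownian_motion N H B"
    and "centered_gaussian_process N {0<..} Z"
    and "\<And>s t. s > 0 \<Longrightarrow> t > 0 \<Longrightarrow> (LINT \<omega>|N. Z t \<omega> * Z s \<omega>) = (t + s) powr (- \<gamma>)"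
    and "independent_processes N {0<..} Z {0..} B"
    and "\<And>t. t \<ge> 0 \<Longrightarrow>
           has_fbm_integral N H B (path_space {0<..}) (path_on {0<..} Z) t (\<lambda>r. Z (t - r)) (J t)"
    and "prob_space M"
    and "centered_gaussian_process M {0..} G"
    and "\<And>s t. s \<ge> 0 \<Longrightarrow> t \<ge> 0 \<Longrightarrow>
           (LINT \<omega>|M. G t \<omega> * G s \<omega>) = (LINT \<omega>|N. J t \<omega> * J s \<omega>)"
    and "AE \<omega> in M. continuous_on {0..} (\<lambda>t. G t \<omega>)"
  shows "AE \<omega> in M. (\<lambda>t. G t \<omega>) \<in> besov_orlicz_space (H - \<gamma> / 2) {0<..<1}"
proof -
  note H = assms(1,2) and \<gamma> = assms(3,4) and M = assms(11) and G = assms(12)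
  interpret prob_space M by fact
  define \<alpha> where "\<alpha> = H - \<gamma> / 2"
  define c where "c = H * (2 * H - 1)"
  have \<alpha>: "\<alpha> > 0" and c: "c > 0" using H \<gamma> by (auto simp: \<alpha>_def c_def intro!: mult_pos_pos)
  have J: "integrable (lborel \<Otimes>\<^sub>M lborel) (variance_kernel H \<gamma> t s)"
    "(LINT \<omega>|N. J t \<omega> * J s \<omega>) = H * (2 * H - 1) * (LINT p|(lborel \<Otimes>\<^sub>M lborel). variance_kernel H \<gamma> t s p)"
    if "t \<ge> 0" "s \<ge> 0" for t s
    by (rule fbm_integral_covariance[OF assms(5,6) H assms(7) \<gamma>(1) assms(8)
      assms(9)[unfolded independent_processes_def] assms(10)]; use that in simp)+
  have cov: "(LINT \<omega>|M. G t \<omega> * G s \<omega>) = c * (LINT p|(lborel \<Otimes>\<^sub>M lborel). variance_kernel H \<gamma> t s p)"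
    and int: "integrable (lborel \<Otimes>\<^sub>M lborel) (variance_kernel H \<gamma> t s)" if "s \<ge> 0" "t \<ge> 0" for s t
    using J[OF that(2,1)] assms(13)[OF that] by (simp_all add: c_def)
  note Gt = centered_gaussian_process_square_integrable[OF M G]
  have intG: "integrable M (\<lambda>\<omega>. G t \<omega> * G s \<omega>)" if "s \<ge> 0" "t \<ge> 0" for s t
    using that Gt by (intro integrable_mult_of_squares) auto
  note inc = increment_covariance[OF cov int intG]
  obtain C1 where C1: "C1 \<ge> 0" "\<And>h t. h > 0 \<Longrightarrow>
      (LINT p|(lborel \<Otimes>\<^sub>M lborel). increment_kernel H \<gamma> h t t p) \<le> C1 * h powr (2 * H - \<gamma>)"
    using increment_variance_bound[OF H \<gamma>] by blast
  obtain C2 where C2: "C2 \<ge> 0" "\<And>h. h > 0 \<Longrightarrow>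
    (\<integral>\<^sup>+t. \<integral>\<^sup>+s. ennreal \<bar>LINT p|(lborel \<Otimes>\<^sub>M lborel). increment_kernel H \<gamma> h t s p\<bar>
        * (indicator {0<..<1 - h} t * indicator {0<..<1 - h} s) \<partial>lborel \<partial>lborel)
       \<le> ennreal (C2 * h powr (2 - \<gamma>))"
    using increment_covariance_bound[OF H \<gamma>] by blast
  \<comment> \<open>The summand 1 keeps \<open>L\<close> positive when \<open>C1\<close> vanishes.\<close>
  define L where "L = sqrt (c * C1 + 1)"
  have L: "L > 0" "L\<^sup>2 = c * C1 + 1" using c C1(1) by (auto simp: L_def add_nonneg_pos)
  obtain A where A: "A \<in> null_sets M" and A': "{\<omega> \<in> space M. \<not> continuous_on {0..} (\<lambda>t. G t \<omega>)} \<subseteq> A"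
    using assms(14) unfolding eventually_ae_filter by blast
  have [measurable]: "A \<in> sets M" using A by auto
  \<comment> \<open>On the null set the path is replaced by 0, and to the left of 0 it is extended by its value
    at 0, so that all paths are continuous on the real line and the process is jointly measurable.\<close>
  define G' where "G' t \<omega> = (if \<omega> \<in> A then 0 else G (max 0 t) \<omega>)" for t \<omega>
  have G'm: "G' t \<in> borel_measurable M" for t
  proof -
    have [measurable]: "G (max 0 t) \<in> borel_measurable M" using Gt by simp
    show ?thesis unfolding G'_def[abs_def] by measurable
  qed
  have G'c: "continuous_on UNIV (\<lambda>t. G' t \<omega>)" if "\<omega> \<in> space M" for \<omega>
  proof (cases "\<omega> \<in> A")
    case False
    then have "continuous_on UNIV (\<lambda>t. G (max 0 t) \<omega>)"
      using A' that by (intro continuous_on_compose2[of "{0..}" "\<lambda>t. G t \<omega>" UNIV "max 0"] continuous_intros) auto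
    then show ?thesis using False by (simp add: G'_def)
  qed (simp add: G'_def)
  have [measurable]: "case_prod G' \<in> borel_measurable (borel \<Otimes>\<^sub>M M)"
    by (rule measurable_continuous_paths[OF G'm G'c])
  have G'_eq: "AE \<omega> in M. \<forall>t\<ge>0. G' t \<omega> = G t \<omega>"
    using AE_not_in[OF A] by eventually_elim (auto simp: G'_def max_def)
  define h where "h n = (1 / 2 ^ n :: real)" for n :: nat
  have h: "h n > 0" "h n \<le> 1" for n by (auto simp: h_def)
  define D where "D n = L * h n powr \<alpha>" for n
  have D: "D n > 0" for n using L h(1)[of n] by (simp add: D_def)
  have D2: "(D n)\<^sup>2 = L\<^sup>2 * h n powr (2 * H - \<gamma>)" for n
    using h[of n] by (simp add: D_def \<alpha>_def power_mult_distrib power2_eq_square[of "_ powr _"] powr_add[symmetric])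
  define X where "X n s \<omega> = (G' (s + h n) \<omega> - G' s \<omega>) / D n" for n s \<omega>
  define X0 where "X0 n s \<omega> = (G (s + h n) \<omega> - G s \<omega>) / D n" for n s \<omega>
  have X_eq: "AE \<omega> in M. X n s \<omega> = X0 n s \<omega>" if "s \<ge> 0" for n s
    using G'_eq by (rule eventually_mono) (use h[of n] that in \<open>simp add: X_def X0_def\<close>)
  have Xm: "case_prod (X n) \<in> borel_measurable (borel \<Otimes>\<^sub>M M)" for n
    unfolding X_def[abs_def] case_prod_beta' by measurable
  have Xm1[measurable]: "X n s \<in> borel_measurable M" for n s
    using G'm unfolding X_def[abs_def] by measurable
  have X0m[measurable]: "X0 n s \<in> borel_measurable M" if "s \<ge> 0" for n s
  proof -
    have "G (s + h n) \<in> borel_measurable M" "G s \<in> borel_measurable M" using Gt that h[of n] by auto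
    then show ?thesis unfolding X0_def[abs_def] by measurable
  qed
  have prodX: "(LINT \<omega>|M. X n s \<omega> * X n t \<omega>) =
      c / (D n)\<^sup>2 * (LINT p|(lborel \<Otimes>\<^sub>M lborel). increment_kernel H \<gamma> (h n) s t p)" if "s \<ge> 0" "t \<ge> 0" for n s t
  proof -
    have "(LINT \<omega>|M. X n s \<omega> * X n t \<omega>) = (LINT \<omega>|M. X0 n s \<omega> * X0 n t \<omega>)"
    proof (rule integral_cong_AE)
      show "AE \<omega> in M. X n s \<omega> * X n t \<omega> = X0 n s \<omega> * X0 n t \<omega>"
        using X_eq[OF that(1), of n] X_eq[OF that(2), of n] by eventually_elim simp
    qed (use X0m that in measurable)
    also have "\<dots> = (LINT \<omega>|M. (G (s + h n) \<omega> - G s \<omega>) * (G (t + h n) \<omega> - G t \<omega>) / (D n)\<^sup>2)"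
      by (simp add: X0_def power2_eq_square)
    also have "\<dots> = c / (D n)\<^sup>2 * (LINT p|(lborel \<Otimes>\<^sub>M lborel). increment_kernel H \<gamma> (h n) s t p)"
      using inc[OF _ _ _ _ _ _ h(1), of t s n] that by simp
    finally show ?thesis .
  qed
  \<comment> \<open>The powers of \<open>h n\<close> cancel to \<open>(2 - \<gamma>) - (2 * H - \<gamma>) = 2 - 2 * H\<close>.\<close>
  define b where "b n = c * C2 / L\<^sup>2 * h n powr (2 - 2 * H)" for n
  define \<Phi> where "\<Phi> n \<omega> = (\<integral>\<^sup>+s. ennreal (exp ((X n s \<omega>)\<^sup>2 / 8)) * indicator {0<..<1 - h n} s \<partial>lborel)" for n \<omega>
  have b0: "b n \<ge> 0" for n using c C2(1) by (simp add: b_def)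
  have moments: "\<Phi> n \<in> borel_measurable M" "(\<integral>\<^sup>+\<omega>. \<Phi> n \<omega> \<partial>M) \<le> ennreal (sqrt 2)"
    "(\<integral>\<^sup>+\<omega>. (\<Phi> n \<omega>)\<^sup>2 \<partial>M) \<le> (\<integral>\<^sup>+\<omega>. \<Phi> n \<omega> \<partial>M)\<^sup>2 + ennreal (2 * b n)" for n
  proof -
    have gauss: "gaussian_rv M (\<lambda>\<omega>. w * X n s \<omega> + v * X n t \<omega>)" if "s \<in> {0<..<1 - h n}" "t \<in> {0<..<1 - h n}" for s t w v
    proof (rule gaussian_rv_cong_AE)
      let ?a = "\<lambda>i. [w / D n, - w / D n, v / D n, - v / D n] ! i" and ?t = "\<lambda>i. [s + h n, s, t + h n, t] ! i"
      have "gaussian_rv M (\<lambda>\<omega>. \<Sum>i<4::nat. ?a i * G (?t i) \<omega>)"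
        using that h[of n]
        by (intro centered_gaussian_process_linear_combination[OF G]) (auto simp: less_Suc_eq numeral_eq_Suc)
      also have "(\<lambda>\<omega>. \<Sum>i<4::nat. ?a i * G (?t i) \<omega>) = (\<lambda>\<omega>. w * X0 n s \<omega> + v * X0 n t \<omega>)"
        by (auto simp: X0_def numeral_eq_Suc fun_eq_iff diff_divide_distrib algebra_simps)
      finally show "gaussian_rv M (\<lambda>\<omega>. w * X0 n s \<omega> + v * X0 n t \<omega>)" .
      show "AE \<omega> in M. w * X0 n s \<omega> + v * X0 n t \<omega> = w * X n s \<omega> + v * X n t \<omega>"
        using X_eq[of s n] X_eq[of t n] that by auto
    qed measurable
    have centered: "(LINT \<omega>|M. X n s \<omega>) = 0" if "s \<in> {0<..<1 - h n}" for s
    proof -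
      have "(LINT \<omega>|M. X n s \<omega>) = (LINT \<omega>|M. X0 n s \<omega>)"
        using X_eq[of s n] X0m[of s n] that by (intro integral_cong_AE) auto
      also have "\<dots> = 0"
        using Gt(3) G that h[of n] by (simp add: X0_def centered_gaussian_process_def)
      finally show ?thesis .
    qed
    have var: "(LINT \<omega>|M. (X n s \<omega>)\<^sup>2) \<le> 1" if "s \<in> {0<..<1 - h n}" for s
    proof -
      have "(LINT \<omega>|M. (X n s \<omega>)\<^sup>2) = c / (D n)\<^sup>2 * (LINT p|(lborel \<Otimes>\<^sub>M lborel). increment_kernel H \<gamma> (h n) s s p)"
        using prodX[of s s n] that by (simp add: power2_eq_square)
      also have "\<dots> \<le> c / (D n)\<^sup>2 * (C1 * h n powr (2 * H - \<gamma>))"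
        using c D[of n] by (intro mult_left_mono C1(2) h) auto
      also have "\<dots> = c * C1 / L\<^sup>2" using h[of n] by (simp add: D2)
      also have "\<dots> \<le> 1"
      proof -
        have "0 \<le> c * C1" using c C1(1) by simp
        then show ?thesis unfolding L(2) by (simp add: divide_le_eq_1)
      qed
      finally show ?thesis .
    qed
    have covb: "(\<integral>\<^sup>+s. \<integral>\<^sup>+t. ennreal \<bar>LINT \<omega>|M. X n s \<omega> * X n t \<omega>\<bar> *
        (indicator {0<..<1 - h n} s * indicator {0<..<1 - h n} t) \<partial>lborel \<partial>lborel) \<le> ennreal (b n)"
    proof -
      define K where "K s t = ennreal \<bar>LINT p|(lborel \<Otimes>\<^sub>M lborel). increment_kernel H \<gamma> (h n) s t p\<bar>
        * (indicator {0<..<1 - h n} s * indicator {0<..<1 - h n} t)" for s t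
      note [measurable] = measurable_increment_kernel_integral
      have Km: "(\<lambda>x. K (fst x) (snd x)) \<in> borel_measurable (borel \<Otimes>\<^sub>M borel)" unfolding K_def by measurable
      have K1: "K s \<in> borel_measurable borel" for s
        using measurable_compose[OF measurable_Pair1' Km, of s] by simp
      have K2: "(\<lambda>s. \<integral>\<^sup>+t. K s t \<partial>lborel) \<in> borel_measurable borel"
        using lborel.borel_measurable_nn_integral[of K borel] Km by (simp add: case_prod_beta')
      have "(\<integral>\<^sup>+s. \<integral>\<^sup>+t. ennreal \<bar>LINT \<omega>|M. X n s \<omega> * X n t \<omega>\<bar> *
        (indicator {0<..<1 - h n} s * indicator {0<..<1 - h n} t) \<partial>lborel \<partial>lborel) = (\<integral>\<^sup>+s. \<integral>\<^sup>+t. ennreal (c / (D n)\<^sup>2) * K s t \<partial>lborel \<partial>lborel)"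
      proof (intro nn_integral_cong)
        fix s t
        show "ennreal \<bar>LINT \<omega>|M. X n s \<omega> * X n t \<omega>\<bar> * (indicator {0<..<1 - h n} s * indicator {0<..<1 - h n} t)
           = ennreal (c / (D n)\<^sup>2) * K s t"
        proof (cases "s \<in> {0<..<1 - h n} \<and> t \<in> {0<..<1 - h n}")
          case True
          then have st: "s \<ge> 0" "t \<ge> 0" by auto
          have "0 \<le> c / (D n)\<^sup>2" using c by simp
          then have "ennreal \<bar>LINT \<omega>|M. X n s \<omega> * X n t \<omega>\<bar> =
              ennreal (c / (D n)\<^sup>2) * ennreal \<bar>LINT p|(lborel \<Otimes>\<^sub>M lborel). increment_kernel H \<gamma> (h n) s t p\<bar>"
            unfolding prodX[OF st] by (simp only: abs_mult abs_of_nonneg ennreal_mult')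
          then show ?thesis unfolding K_def by (simp only: mult.assoc)
        qed (auto simp: K_def)
      qed
      also have "\<dots> = ennreal (c / (D n)\<^sup>2) * (\<integral>\<^sup>+s. \<integral>\<^sup>+t. K s t \<partial>lborel \<partial>lborel)"
        using K1 K2 by (simp add: nn_integral_cmult)
      also have "\<dots> \<le> ennreal (c / (D n)\<^sup>2) * ennreal (C2 * h n powr (2 - \<gamma>))"
        unfolding K_def by (intro mult_left_mono C2(2) h) auto
      also have "\<dots> = ennreal (c / (D n)\<^sup>2 * (C2 * h n powr (2 - \<gamma>)))"
        by (rule ennreal_mult'[symmetric]) (use c in simp)
      also have "c / (D n)\<^sup>2 * (C2 * h n powr (2 - \<gamma>)) = b n"
      proof -
        have "h n powr (2 - \<gamma>) = h n powr (2 - 2 * H) * h n powr (2 * H - \<gamma>)" by (simp add: powr_add[symmetric])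
        then show ?thesis using h[of n] by (simp add: D2 b_def)
      qed
      finally show ?thesis .
    qed
    have J: "{0<..<1 - h n} \<in> sets borel" "emeasure lborel {0<..<1 - h n} \<le> 1" using h[of n] by auto
    note mom = gaussian_exp_square_functional_moments[OF M Xm J gauss centered var covb b0, folded \<Phi>_def]
    show "\<Phi> n \<in> borel_measurable M" "(\<integral>\<^sup>+\<omega>. \<Phi> n \<omega> \<partial>M) \<le> ennreal (sqrt 2)"
      "(\<integral>\<^sup>+\<omega>. (\<Phi> n \<omega>)\<^sup>2 \<partial>M) \<le> (\<integral>\<^sup>+\<omega>. \<Phi> n \<omega> \<partial>M)\<^sup>2 + ennreal (2 * b n)"
      using mom by (simp_all add: \<Phi>_def[abs_def])
  qed
  have "summable (\<lambda>n. 2 * b n)"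
  proof -
    have "(1 / 2) powr (2 - 2 * H) < (1::real)" using H powr_less_mono2[of "2 - 2 * H" "1/2" 1] by auto
    then show ?thesis unfolding b_def h_def powr_dyadic by (intro summable_mult summable_geometric) auto
  qed
  then have "AE \<omega> in M. \<exists>K. \<forall>n. \<Phi> n \<omega> \<le> ennreal K"
    using moments b0 by (intro AE_bounded_of_summable_variance[OF M, where a="sqrt 2" and b="\<lambda>n. 2 * b n"]) auto
  then show ?thesis
    using AE_space G'_eq
  proof eventually_elim
    case (elim \<omega>)
    then obtain K where K: "\<And>n. \<Phi> n \<omega> \<le> ennreal K" by blast
    have "(\<lambda>t. G' t \<omega>) \<in> besov_orlicz_space \<alpha> {0<..<1}"
    proof (rule besov_orlicz_spaceI_dyadic[OF G'c \<alpha> L(1)])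
      show "(1::real) \<le> max 1 K" by simp
      fix n :: nat
      show "(\<integral>\<^sup>+s. ennreal (exp (((G' (s + 1 / 2 ^ n) \<omega> - G' s \<omega>) / (L * (1 / 2 ^ n) powr \<alpha>))\<^sup>2 / 8))
           * indicator {0<..<1 - 1 / 2 ^ n} s \<partial>lborel) \<le> ennreal (max 1 K)"
        using K[of n] by (auto simp: \<Phi>_def X_def D_def h_def intro: order_trans[OF _ ennreal_leI])
    qed (use elim in simp)
    then show ?case
      unfolding \<alpha>_def by (rule besov_orlicz_space_cong[rotated]) (use elim in auto)
  qed
qed

end
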